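(* Let $T>0$. Let $\phi\colon\mathbb{R}\to\mathbb{R}$ be an increasing homeomorphism with $\phi(\mathbb{R})=\mathbb{R}$ and $\phi(0)=0$, let $f,q\colon\mathbb{R}\to\mathbb{R}$ be continuous, and let $a,e\in L^{\infty}(0,T)$ with $a(t)\ge 0$ for a.e. $t\in[0,T]$, $\frac1T\int_0^T a(t)\,dt=1$ and $\frac1T\int_0^T e(t)\,dt=0$. Assume $\lim_{u\to-\infty}q(u)=\lim_{u\to+\infty}q(u)=+\infty$. For $s\in\mathbb{R}$ consider $$(\phi(u'))'+f(u)u'+a(t)q(u)=s+e(t). \qquad (\mathscr{W\!E}_s)$$ Then there exists $s_0\in\mathbb{R}$ such that: for $s<s_0$, $(\mathscr{W\!E}_s)$ has no $T$-periodic solutions; for $s=s_0$, $(\mathscr{W\!E}_s)$ has at least one $T$-periodic solution; for $s>s_0$, $(\mathscr{W\!E}_s)$ has at least two $T$-periodic solutions.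
   Context: A $T$-periodic solution of $(\mathscr{W\!E}_s)$ is a function $u\in\mathcal{C}^1([0,T])$ with $u(0)=u(T)$, $u'(0)=u'(T)$, such that $\phi(u')$ is absolutely continuous and the equation holds for a.e. $t\in[0,T]$. *)

theory Defs
  imports "HOL-Analysis.Analysis"
begin

definition abs_cont_on :: "real \<Rightarrow> real \<Rightarrow> (real \<Rightarrow> real) \<Rightarrow> bool" where
  "abs_cont_on a b g \<longleftrightarrow>
     (\<forall>\<epsilon>>0. \<exists>\<delta>>0. \<forall>(n::nat) (x::nat \<Rightarrow> real) (y::nat \<Rightarrow> real).
        (\<forall>i<n. a \<le> x i \<and> x i \<le> y i \<and> y i \<le> b) \<and>
        (\<forall>i<n. \<forall>j<n. i \<noteq> j \<longrightarrow> y i \<le> x j \<or> y j \<le> x i) \<and>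
        (\<Sum>i<n. y i - x i) < \<delta>
        \<longrightarrow> (\<Sum>i<n. \<bar>g (y i) - g (x i)\<bar>) < \<epsilon>)"

definition periodic_solution ::
  "(real \<Rightarrow> real) \<Rightarrow> (real \<Rightarrow> real) \<Rightarrow> (real \<Rightarrow> real) \<Rightarrow> (real \<Rightarrow> real) \<Rightarrow> (real \<Rightarrow> real)
   \<Rightarrow> real \<Rightarrow> real \<Rightarrow> (real \<Rightarrow> real) \<Rightarrow> bool" where
  "periodic_solution \<phi> f a q e T s u \<longleftrightarrow>
     (\<exists>du. (\<forall>t\<in>{0..T}. (u has_real_derivative du t) (at t within {0..T})) \<and>
           continuous_on {0..T} du \<and>
           u 0 = u T \<and> du 0 = du T \<and>
           abs_cont_on 0 T (\<lambda>t. \<phi> (du t)) \<and>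
           (AE t in lebesgue. t \<in> {0..T} \<longrightarrow>
              ((\<lambda>x. \<phi> (du x)) has_real_derivative
                 (s + e t - f (u t) * du t - a t * q (u t))) (at t within {0..T})))"

definition Linf_on :: "real \<Rightarrow> (real \<Rightarrow> real) \<Rightarrow> bool" where
  "Linf_on T g \<longleftrightarrow> set_borel_measurable lebesgue {0..T} g \<and>
     (\<exists>B. AE t in lebesgue. t \<in> {0..T} \<longrightarrow> \<bar>g t\<bar> \<le> B)"

end

theory Submission
  imports Defs "HOL-Complex_Analysis.Great_Picard"
begin

hide_const (open) Polynomial.content

text \<open>
  Write \<^term>\<open>F\<close> for an antiderivative of \<^term>\<open>f\<close> and \<^term>\<open>\<psi>\<close> for the inverse
  of \<^term>\<open>\<phi>\<close>. A solution satisfies \<open>u' = \<psi> (k + \<integral> (s + e - a q(u)) - F u)\<close>, where the constant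
  \<open>k\<close> is determined by periodicity and \<open>s\<close> is the \<open>a\<close>-weighted mean of \<open>q(u)\<close>. Comparing a time with the
  times where the same level is crossed upwards and downwards eliminates \<open>F\<close>, so that \<open>|\<phi>(u')|\<close> is at most
  \<open>\<integral> |s + e - a q(u)|\<close>; coercivity of \<open>q\<close> then bounds all solutions with bounded level.

  Given an upper solution \<open>b\<close> of level \<open>s'\<close> and \<open>s > s'\<close>, a solution touching \<open>b\<close> from below has level at most
  \<open>s'\<close>, whereas a solution with \<open>max (u - b) = \<plusminus>M\<close>, for a large \<open>M\<close>, has level above \<open>s\<close>. Treating
  \<open>max (u - b)\<close> as an additional unknown in Schauder's theorem, a Poincare--Miranda argument on each of
  \<open>[-M, 0]\<close> and \<open>[0, M]\<close> produces two solutions of level \<open>s\<close>, without any degree theory. Hence the set of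
  levels is upward closed, and compactness shows that it contains its infimum. It is not empty because the
  solution of the problem with \<open>q = 0\<close> is an upper solution.
\<close>

section \<open>Fixed points of operators on Lipschitz functions\<close>

text \<open>The equation is integrated once because \<open>\<phi>\<close> is only a homeomorphism
  and \<open>a\<close>, \<open>e\<close> are only bounded. In the fixed point problem the level is
  an output: it is computed from the candidate, so that the forcing has integral zero for every
  candidate and equality of \<open>u'\<close> at both ends comes for free. This leaves one additive
  constant free. Fixing it through max (u - b) makes the comparison at a touching point available,
  and the sign of this number later separates the two solutions. Solutions with a given value of it
  need not be unique, so there is no continuous branch to which the intermediate value theorem could
  be applied. The operator has to be bounded and uniformly continuous, which \<open>F\<close> and
  \<open>q\<close> do not allow as they stand; both are truncated. The truncation can be undone
  because the a priori bound does not involve \<open>F\<close> at all and involves \<open>q\<close>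
  only through its lower bound and its coercivity, so that the radius is fixed before
  truncating.\<close>

text \<open>The library's Brouwer theorem has the dimension in the type; here it has to vary, hence the
  direct appeal to Kuhn's lemma.\<close>
lemma approximate_fixed_point_cube:
  fixes g :: "(nat \<Rightarrow> real) \<Rightarrow> nat \<Rightarrow> real"
  assumes range: "\<And>x i. \<lbrakk>\<forall>j<n. x j \<in> {0..1}; i < n\<rbrakk> \<Longrightarrow> g x i \<in> {0..1}"
    and uc: "\<And>\<epsilon>. \<epsilon> > 0 \<Longrightarrow> \<exists>\<delta>>0. \<forall>x y. (\<forall>i<n. x i \<in> {0..1}) \<longrightarrow> (\<forall>i<n. y i \<in> {0..1}) \<longrightarrow>
               (\<forall>i<n. \<bar>x i - y i\<bar> \<le> \<delta>) \<longrightarrow> (\<forall>i<n. \<bar>g x i - g y i\<bar> \<le> \<epsilon>)"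
    and "\<epsilon> > 0"
  obtains x where "\<forall>i<n. x i \<in> {0..1}" "\<forall>i<n. \<bar>g x i - x i\<bar> \<le> \<epsilon>"
proof -
  obtain \<delta> where "\<delta> > 0" and \<delta>: "\<And>x y i. \<lbrakk>\<forall>i<n. x i \<in> {0..1}; \<forall>i<n. y i \<in> {0..1};
      \<forall>i<n. \<bar>x i - y i\<bar> \<le> \<delta>; i < n\<rbrakk> \<Longrightarrow> \<bar>g x i - g y i\<bar> \<le> \<epsilon>/2"
    using uc[of "\<epsilon>/2"] \<open>\<epsilon> > 0\<close> by (metis half_gt_zero)
  obtain p :: nat where "p > 0" and p: "1 / real p < min \<delta> (\<epsilon>/2)"
    using real_arch_inverse[of "min \<delta> (\<epsilon>/2)"] \<open>\<delta> > 0\<close> \<open>\<epsilon> > 0\<close> by (auto simp: inverse_eq_divide)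
  define sc where "sc = (\<lambda>(x::nat \<Rightarrow> nat) j. real (x j) / real p)"
  \<comment> \<open>Label 0 says that \<open>g\<close> does not push coordinate \<open>i\<close>
    down. The top face gets label 1 by decree, as Kuhn's lemma demands, even where \<open>g\<close>
    fixes the coordinate.\<close>
  define label :: "(nat \<Rightarrow> nat) \<Rightarrow> nat \<Rightarrow> nat"
    where "label = (\<lambda>x i. if x i < p \<and> sc x i \<le> g (sc x) i then 0 else 1)"
  have sc01: "\<forall>i<n. sc x i \<in> {0..1}" if "\<forall>i<n. x i \<le> p" for x
    using that \<open>p > 0\<close> by (auto simp: sc_def)
  obtain r where r: "\<forall>i<n. r i < p"
    and rs: "\<forall>i<n. \<exists>a b. (\<forall>j<n. r j \<le> a j \<and> a j \<le> r j + 1) \<and>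
               (\<forall>j<n. r j \<le> b j \<and> b j \<le> r j + 1) \<and> label a i \<noteq> label b i"
  proof (rule kuhn_lemma[OF \<open>p > 0\<close>, of n label])
    show "\<forall>x. (\<forall>i<n. x i \<le> p) \<longrightarrow> (\<forall>i<n. x i = 0 \<longrightarrow> label x i = 0)"
    proof (intro allI impI)
      fix x i assume x: "\<forall>i<n. x i \<le> p" and "i < n" "x i = 0"
      with range[OF sc01[OF x] \<open>i < n\<close>] \<open>p > 0\<close> show "label x i = 0"
        by (auto simp: label_def sc_def)
    qed
  qed (auto simp: label_def)
  \<comment> \<open>At \<open>sc r\<close> itself neither inequality is known: a vertex of label 0
    gives the lower one, a vertex of label 1 the upper one, and uniform continuity carries both to
    \<open>sc r\<close>.\<close>
  have low: "sc r i - \<epsilon>/2 \<le> g (sc r) i" and upp: "g (sc r) i \<le> sc r i + \<epsilon>" if "i < n" for i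
  proof -
    obtain a b where a: "\<forall>j<n. r j \<le> a j \<and> a j \<le> r j + 1" and b: "\<forall>j<n. r j \<le> b j \<and> b j \<le> r j + 1"
      and la: "label a i = 0" and lb: "label b i = 1"
    proof -
      obtain a b where ab: "\<forall>j<n. r j \<le> a j \<and> a j \<le> r j + 1" "\<forall>j<n. r j \<le> b j \<and> b j \<le> r j + 1"
        "label a i \<noteq> label b i"
        using rs \<open>i < n\<close> by blast
      then have "(label a i = 0 \<and> label b i = 1) \<or> (label b i = 0 \<and> label a i = 1)"
        by (auto simp: label_def split: if_splits)
      then show thesis
        using that ab by blast
    qed
    have near: "\<bar>g (sc r) i - g (sc c) i\<bar> \<le> \<epsilon>/2" and cp: "\<forall>j<n. c j \<le> p"
      and diff: "sc r i \<le> sc c i" "sc c i \<le> sc r i + \<epsilon>/2"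
      if c: "\<forall>j<n. r j \<le> c j \<and> c j \<le> r j + 1" for c
    proof -
      show cp: "\<forall>j<n. c j \<le> p"
        using r c by (metis Suc_eq_plus1 Suc_leI le_trans)
      have d: "sc r j \<le> sc c j \<and> sc c j \<le> sc r j + 1 / p" if "j < n" for j
      proof -
        have "real (c j) \<le> real (r j) + 1" "real (r j) \<le> real (c j)"
          using c that by (metis of_nat_1 of_nat_add of_nat_le_iff, simp)
        then show ?thesis
          using \<open>p > 0\<close> by (simp add: sc_def divide_simps)
      qed
      show "sc r i \<le> sc c i" "sc c i \<le> sc r i + \<epsilon>/2"
        using d[OF \<open>i < n\<close>] p by auto
      have rp: "\<forall>j<n. r j \<le> p" using r by (simp add: less_imp_le)
      show "\<bar>g (sc r) i - g (sc c) i\<bar> \<le> \<epsilon>/2"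
      proof (rule \<delta>[OF sc01[OF rp] sc01[OF cp] _ \<open>i < n\<close>])
        show "\<forall>i<n. \<bar>sc r i - sc c i\<bar> \<le> \<delta>"
          using d p by (smt (verit))
      qed
    qed
    show "sc r i - \<epsilon>/2 \<le> g (sc r) i"
      proof -
      have "sc a i \<le> g (sc a) i" using la by (simp add: label_def split: if_splits)
      then show ?thesis using near[OF a] diff[OF a] by linarith
    qed
    have "g (sc b) i \<le> sc b i"
    proof (cases "b i < p")
      case True
      then show ?thesis using lb by (auto simp: label_def split: if_splits)
    next
      \<comment> \<open>On the top face the label carries no information, but there
        \<open>sc b i = 1\<close> bounds \<open>g\<close> trivially.\<close>
      case False
      then have "sc b i = 1"
        using cp[OF b] \<open>i < n\<close> \<open>p > 0\<close> by (auto simp: sc_def dest!: spec[of _ i])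
      then show ?thesis using range[OF sc01[OF cp[OF b]] \<open>i < n\<close>] by auto
    qed
    then show "g (sc r) i \<le> sc r i + \<epsilon>"
      using near[OF b] diff[OF b] by linarith
  qed
  show thesis
  proof (rule that[of "sc r"])
    show "\<forall>i<n. sc r i \<in> {0..1}" using sc01 r by (simp add: less_imp_le)
    show "\<forall>i<n. \<bar>g (sc r) i - sc r i\<bar> \<le> \<epsilon>"
      using low upp \<open>\<epsilon> > 0\<close> by (smt (verit) field_sum_of_halves)
  qed
qed

section \<open>Balls of Lipschitz functions: compactness and interpolation from finitely many
  nodes\<close>

definition lip_ball :: "real \<Rightarrow> real \<Rightarrow> real \<Rightarrow> (real \<Rightarrow> real) set" where
  "lip_ball T R L = {v. (\<forall>t\<in>{0..T}. \<bar>v t\<bar> \<le> R) \<and> (\<forall>s\<in>{0..T}. \<forall>t\<in>{0..T}. \<bar>v s - v t\<bar> \<le> L * \<bar>s - t\<bar>)}"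

lemma lip_ballD:
  assumes "v \<in> lip_ball T R L"
  shows "t \<in> {0..T} \<Longrightarrow> \<bar>v t\<bar> \<le> R"
    and "\<lbrakk>s \<in> {0..T}; t \<in> {0..T}\<rbrakk> \<Longrightarrow> \<bar>v s - v t\<bar> \<le> L * \<bar>s - t\<bar>"
  using assms by (auto simp: lip_ball_def)

lemma lip_ball_continuous:
  assumes "v \<in> lip_ball T R L"
  shows "continuous_on {0..T} v"
proof (cases "T \<ge> 0")
  case True
  then have "L \<ge> 0" if "T > 0"
    using lip_ballD(2)[OF assms, of 0 T] that
    by (smt (verit, best) atLeastAtMost_iff mult_neg_pos)
  show ?thesis
  proof (cases "T = 0")
    case False
    with True \<open>T > 0 \<Longrightarrow> L \<ge> 0\<close> have "L-lipschitz_on {0..T} v"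
      using lip_ballD(2)[OF assms] by (auto simp: lipschitz_on_def dist_real_def)
    then show ?thesis by (rule lipschitz_on_continuous_on)
  qed simp
qed simp

text \<open>Both defining inequalities survive pointwise limits, so the limit provided by
  Arzela-Ascoli stays in the ball.\<close>

lemma lip_ball_compact:
  assumes v: "\<And>n. v n \<in> lip_ball T R L" and "L \<ge> 0"
  obtains u k where "u \<in> lip_ball T R L" "strict_mono (k :: nat \<Rightarrow> nat)"
    "\<And>e. 0 < e \<Longrightarrow> \<exists>N. \<forall>n\<ge>N. \<forall>t\<in>{0..T}. \<bar>v (k n) t - u t\<bar> < e"
proof -
  have "\<exists>d>0. \<forall>n y. y \<in> {0..T} \<and> norm (x - y) < d \<longrightarrow> norm (v n x - v n y) < e"
    if "x \<in> {0..T}" "0 < e" for x e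
  proof (intro exI conjI allI impI)
    show "e / (L + 1) > 0" using that \<open>L \<ge> 0\<close> by simp
    fix n y assume y: "y \<in> {0..T} \<and> norm (x - y) < e / (L + 1)"
    then have "\<bar>x - y\<bar> * (L + 1) < e" using \<open>L \<ge> 0\<close> by (simp add: pos_less_divide_eq)
    moreover have "\<bar>v n x - v n y\<bar> \<le> L * \<bar>x - y\<bar>"
      using lip_ballD(2)[OF v] that y by blast
    ultimately show "norm (v n x - v n y) < e"
      by (simp add: algebra_simps)
  qed
  then obtain u k where k: "strict_mono (k :: nat \<Rightarrow> nat)"
    and lim: "\<And>e. 0 < e \<Longrightarrow> \<exists>N. \<forall>n x. n \<ge> N \<and> x \<in> {0..T} \<longrightarrow> norm (v (k n) x - u x) < e"
    using Arzela_Ascoli[of "{0..T}" v R] lip_ballD(1)[OF v] by (metis compact_Icc real_norm_def)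
  have tend: "(\<lambda>n. v (k n) t) \<longlonglongrightarrow> u t" if "t \<in> {0..T}" for t
    unfolding LIMSEQ_iff using lim that by blast
  have "u \<in> lip_ball T R L"
    unfolding lip_ball_def
  proof (intro CollectI conjI ballI)
    fix t assume "t \<in> {0..T}"
    then have "(\<lambda>n. \<bar>v (k n) t\<bar>) \<longlonglongrightarrow> \<bar>u t\<bar>" by (intro tendsto_intros tend)
    then show "\<bar>u t\<bar> \<le> R"
      by (rule LIMSEQ_le_const2) (use lip_ballD(1)[OF v] \<open>t \<in> {0..T}\<close> in blast)
    fix s assume "s \<in> {0..T}"
    then have "(\<lambda>n. \<bar>v (k n) t - v (k n) s\<bar>) \<longlonglongrightarrow> \<bar>u t - u s\<bar>"
      using \<open>t \<in> {0..T}\<close> by (intro tendsto_intros tend)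
    then show "\<bar>u t - u s\<bar> \<le> L * \<bar>t - s\<bar>"
      by (rule LIMSEQ_le_const2) (use lip_ballD(2)[OF v] \<open>t \<in> {0..T}\<close> \<open>s \<in> {0..T}\<close> in blast)
  qed
  then show thesis
    using that[OF _ k] lim by (metis real_norm_def)
qed

lemma Min_image_diff_le:
  fixes f g :: "'a \<Rightarrow> real"
  assumes "finite I" "I \<noteq> {}" and "\<And>i. i \<in> I \<Longrightarrow> \<bar>f i - g i\<bar> \<le> d"
  shows "\<bar>Min (f ` I) - Min (g ` I)\<bar> \<le> d"
proof -
  have "Min (f ` I) \<le> Min (g ` I) + d"
    if "\<And>i. i \<in> I \<Longrightarrow> f i \<le> g i + d" for f g :: "'a \<Rightarrow> real"
  proof -
    obtain j where "j \<in> I" "Min (g ` I) = g j"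
      using Min_in[of "g ` I"] assms by (metis (no_types) finite_imageI image_iff image_is_empty)
    moreover have "Min (f ` I) \<le> f j" using \<open>j \<in> I\<close> assms by simp
    ultimately show ?thesis using that[of j] by linarith
  qed
  from this[of f g] this[of g f] show ?thesis
    using assms(3) by (smt (verit))
qed

text \<open>McShane extension: it is Lipschitz with constant \<^term>\<open>L\<close> for arbitrary values at the nodes, so that
  every point of the cube yields an element of the ball.\<close>
definition interp :: "real \<Rightarrow> nat \<Rightarrow> (nat \<Rightarrow> real) \<Rightarrow> (nat \<Rightarrow> real) \<Rightarrow> real \<Rightarrow> real" where
  "interp L n \<tau> x t = Min ((\<lambda>i. x i + L * \<bar>t - \<tau> i\<bar>) ` {..<n})"

lemma interp_lipschitz:
  assumes "0 < n" "0 \<le> L"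
  shows "\<bar>interp L n \<tau> x t - interp L n \<tau> x s\<bar> \<le> L * \<bar>t - s\<bar>"
  unfolding interp_def
proof (rule Min_image_diff_le)
  fix i
  have "\<bar>\<bar>t - \<tau> i\<bar> - \<bar>s - \<tau> i\<bar>\<bar> \<le> \<bar>t - s\<bar>" by linarith
  then have "L * \<bar>\<bar>t - \<tau> i\<bar> - \<bar>s - \<tau> i\<bar>\<bar> \<le> L * \<bar>t - s\<bar>" using assms by (simp add: mult_left_mono)
  then show "\<bar>x i + L * \<bar>t - \<tau> i\<bar> - (x i + L * \<bar>s - \<tau> i\<bar>)\<bar> \<le> L * \<bar>t - s\<bar>"
    using assms by (simp add: abs_mult flip: right_diff_distrib)
qed (use assms in auto)

lemma interp_diff_le:
  assumes "0 < n" "\<forall>i<n. \<bar>x i - y i\<bar> \<le> d"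
  shows "\<bar>interp L n \<tau> x t - interp L n \<tau> y t\<bar> \<le> d"
  unfolding interp_def by (rule Min_image_diff_le) (use assms in auto)

text \<open>The Lipschitz bound makes every term of the minimum at least \<open>w t\<close>, so the
  extension lies above \<open>w\<close>; the single term of a node \<open>j\<close> close to
  \<open>t\<close> bounds it from above.\<close>

lemma interp_approx:
  assumes lip: "\<And>i. i < n \<Longrightarrow> \<bar>w t - w (\<tau> i)\<bar> \<le> L * \<bar>t - \<tau> i\<bar>" and "j < n"
  shows "\<bar>interp L n \<tau> (\<lambda>i. w (\<tau> i)) t - w t\<bar> \<le> 2 * L * \<bar>t - \<tau> j\<bar>"
proof -
  have "w t \<le> interp L n \<tau> (\<lambda>i. w (\<tau> i)) t"
    unfolding interp_def
  proof (rule Min.boundedI)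
    fix a assume "a \<in> (\<lambda>i. w (\<tau> i) + L * \<bar>t - \<tau> i\<bar>) ` {..<n}"
    then obtain i where "i < n" "a = w (\<tau> i) + L * \<bar>t - \<tau> i\<bar>" by auto
    then show "w t \<le> a" using lip[of i] by linarith
  qed (use \<open>j < n\<close> in auto)
  moreover have "interp L n \<tau> (\<lambda>i. w (\<tau> i)) t \<le> w (\<tau> j) + L * \<bar>t - \<tau> j\<bar>"
    unfolding interp_def using \<open>j < n\<close> by (intro Min_le) auto
  ultimately show ?thesis using lip[OF \<open>j < n\<close>] by linarith
qed

lemma clamp_diff_le: "\<bar>max l (min u x) - max l (min u y)\<bar> \<le> \<bar>x - y\<bar>" for x y :: real
  by linarith

text \<open>Schauder's theorem on a ball that is compact in the sup norm. Extending node values,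
  applying \<open>G\<close> and sampling again gives a self-map of a cube. Since \<open>G v\<close>
  is itself \<open>L\<close>-Lipschitz, little is lost between the nodes, and a near fixed point of
  the cube map is one of \<open>G\<close>; compactness and uniform continuity then allow the passage
  to the limit.\<close>

lemma lip_ball_fixed_point:
  assumes "T > 0" "R > 0" "L \<ge> 0"
    and maps: "\<And>v. v \<in> lip_ball T R L \<Longrightarrow> G v \<in> lip_ball T R L"
    and uc: "\<And>\<epsilon>. \<epsilon> > 0 \<Longrightarrow> \<exists>\<delta>>0. \<forall>v\<in>lip_ball T R L. \<forall>w\<in>lip_ball T R L.
              (\<forall>t\<in>{0..T}. \<bar>v t - w t\<bar> \<le> \<delta>) \<longrightarrow> (\<forall>t\<in>{0..T}. \<bar>G v t - G w t\<bar> \<le> \<epsilon>)"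
  obtains u where "u \<in> lip_ball T R L" "\<forall>t\<in>{0..T}. G u t = u t"
proof -
  have approx: "\<exists>u\<in>lip_ball T R L. \<forall>t\<in>{0..T}. \<bar>G u t - u t\<bar> \<le> \<epsilon>" if "\<epsilon> > 0" for \<epsilon>
  proof -
    \<comment> \<open>The interpolation error \<open>2 * L * (T / N)\<close> has to stay below
      \<open>\<epsilon>/2\<close>; the summand 1 covers \<open>L = 0\<close>.\<close>
    obtain N :: nat where "N > 0" and N: "(4 * L * T + 1) / real N < \<epsilon>"
      using real_arch_inverse[of "\<epsilon> / (4 * L * T + 1)"] \<open>\<epsilon> > 0\<close> assms
      by (auto simp: field_simps add_pos_nonneg)
    define \<tau> where "\<tau> = (\<lambda>i. T * real i / real N)"
    \<comment> \<open>Coordinates in [0,1] are stretched to [-R,R]. The extension may exceed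
      \<open>R\<close> between the nodes; clamping restores the bound and keeps the Lipschitz
      constant.\<close>
    define J where "J = (\<lambda>x t. max (-R) (min R (interp L (Suc N) \<tau> (\<lambda>j. R * (2 * x j - 1)) t)))"
    have \<tau>I: "\<tau> i \<in> {0..T}" if "i < Suc N" for i
    proof -
      have "real i \<le> real N" using that by simp
      then have "T * real i \<le> T * real N" using \<open>T > 0\<close> by (simp add: mult_left_mono)
      then show ?thesis using \<open>T > 0\<close> \<open>N > 0\<close> by (simp add: \<tau>_def pos_divide_le_eq)
    qed
    have JX: "J x \<in> lip_ball T R L" for x
      unfolding lip_ball_def J_def
    proof (intro CollectI conjI ballI)
      fix s t
      show "\<bar>max (-R) (min R (interp L (Suc N) \<tau> (\<lambda>j. R * (2 * x j - 1)) s)) -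
        max (-R) (min R (interp L (Suc N) \<tau> (\<lambda>j. R * (2 * x j - 1)) t))\<bar> \<le> L * \<bar>s - t\<bar>"
        using clamp_diff_le interp_lipschitz[of "Suc N" L] \<open>L \<ge> 0\<close> by (meson order_trans zero_less_Suc)
    qed (use \<open>R > 0\<close> in auto)
    have Jd: "\<bar>J x t - J y t\<bar> \<le> 2 * R * d" if "\<forall>i<Suc N. \<bar>x i - y i\<bar> \<le> d" for x y d t
    proof -
      have "\<bar>R * (2 * x i - 1) - R * (2 * y i - 1)\<bar> \<le> 2 * R * d" if "i < Suc N" for i
      proof -
        have "R * (2 * x i - 1) - R * (2 * y i - 1) = 2 * R * (x i - y i)" by (simp add: algebra_simps)
        then have "\<bar>R * (2 * x i - 1) - R * (2 * y i - 1)\<bar> = 2 * R * \<bar>x i - y i\<bar>"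
          using \<open>R > 0\<close> by (simp add: abs_mult)
        then show ?thesis
          using \<open>\<forall>i<Suc N. \<bar>x i - y i\<bar> \<le> d\<close> that \<open>R > 0\<close> by simp
      qed
      then have "\<bar>interp L (Suc N) \<tau> (\<lambda>j. R * (2 * x j - 1)) t - interp L (Suc N) \<tau> (\<lambda>j. R * (2 * y j - 1)) t\<bar> \<le> 2 * R * d"
        by (intro interp_diff_le) auto
      then show ?thesis unfolding J_def using clamp_diff_le order_trans by blast
    qed
    define g where "g = (\<lambda>x i. (G (J x) (\<tau> i) + R) / (2 * R))"
    \<comment> \<open>Stretching by \<open>2 * R\<close> turns an error of
      \<open>\<epsilon> / (4 * R)\<close> into \<open>\<epsilon>/2\<close>; the other half is spent
      on the interpolation.\<close>
    have "\<epsilon> / (4 * R) > 0" using \<open>\<epsilon> > 0\<close> \<open>R > 0\<close> by simp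
    then obtain x where x: "\<forall>i<Suc N. x i \<in> {0..1}" and gx: "\<forall>i<Suc N. \<bar>g x i - x i\<bar> \<le> \<epsilon> / (4 * R)"
    proof (rule approximate_fixed_point_cube[of "Suc N" g "\<epsilon> / (4 * R)", rotated 2])
      show "g x i \<in> {0..1}" if "i < Suc N" for x i
        using lip_ballD(1)[OF maps[OF JX] \<tau>I[OF that], of x] \<open>R > 0\<close> by (auto simp: g_def field_simps)
      fix e :: real assume "e > 0"
      then have "2 * R * e > 0" using \<open>R > 0\<close> by simp
      then obtain \<delta> where "\<delta> > 0" and \<delta>: "\<And>v w t. \<lbrakk>v\<in>lip_ball T R L; w\<in>lip_ball T R L;
          \<forall>t\<in>{0..T}. \<bar>v t - w t\<bar> \<le> \<delta>; t\<in>{0..T}\<rbrakk> \<Longrightarrow> \<bar>G v t - G w t\<bar> \<le> 2 * R * e"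
        using uc by metis
      have "\<bar>g x i - g y i\<bar> \<le> e" if "\<forall>i<Suc N. \<bar>x i - y i\<bar> \<le> \<delta> / (2 * R)" "i < Suc N" for x y i
      proof -
        have "\<bar>J x t - J y t\<bar> \<le> \<delta>" for t using Jd[OF that(1)] \<open>R > 0\<close> by simp
        then have "\<bar>G (J x) (\<tau> i) - G (J y) (\<tau> i)\<bar> \<le> 2 * R * e"
          using \<delta>[OF JX JX] \<tau>I[OF that(2)] by blast
        moreover have "g x i - g y i = (G (J x) (\<tau> i) - G (J y) (\<tau> i)) / (2 * R)"
          by (simp add: g_def diff_divide_distrib add_divide_distrib)
        ultimately show ?thesis using \<open>R > 0\<close> by (simp add: pos_divide_le_eq mult.commute)
      qed
      moreover have "\<delta> / (2 * R) > 0" using \<open>\<delta> > 0\<close> \<open>R > 0\<close> by simp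
      ultimately show "\<exists>\<delta>>0. \<forall>x y. (\<forall>i<Suc N. x i \<in> {0..1}) \<longrightarrow> (\<forall>i<Suc N. y i \<in> {0..1}) \<longrightarrow>
               (\<forall>i<Suc N. \<bar>x i - y i\<bar> \<le> \<delta>) \<longrightarrow> (\<forall>i<Suc N. \<bar>g x i - g y i\<bar> \<le> e)" by blast
    qed blast
    define w where "w = G (J x)"
    have wX: "w \<in> lip_ball T R L" unfolding w_def by (rule maps[OF JX])
    have node: "\<bar>R * (2 * x i - 1) - w (\<tau> i)\<bar> \<le> \<epsilon>/2" if "i < Suc N" for i
    proof -
      have "R * (2 * x i - 1) - w (\<tau> i) = 2 * R * (x i - g x i)"
        using \<open>R > 0\<close> by (simp add: g_def w_def field_simps)
      then have "\<bar>R * (2 * x i - 1) - w (\<tau> i)\<bar> = 2 * R * \<bar>g x i - x i\<bar>"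
        using \<open>R > 0\<close> by (simp add: abs_mult abs_minus_commute)
      also have "\<dots> \<le> 2 * R * (\<epsilon> / (4 * R))" by (rule mult_left_mono) (use gx that \<open>R > 0\<close> in auto)
      finally show ?thesis using \<open>R > 0\<close> by simp
    qed
    have "\<bar>G (J x) t - J x t\<bar> \<le> \<epsilon>" if t: "t \<in> {0..T}" for t
    proof -
      \<comment> \<open>Left neighbour of \<open>t\<close> in the grid. For \<open>t = T\<close> it
        is the node of index \<open>N\<close>, which is why there are \<open>Suc N\<close>
        nodes.\<close>
      define j where "j = nat \<lfloor>t * N / T\<rfloor>"
      have "t * N / T \<ge> 0" using t \<open>T > 0\<close> by simp
      then have j: "real j \<le> t * N / T" "t * N / T < real j + 1" unfolding j_def by linarith+
      then have "real j * T \<le> t * N" "t * N \<le> real j * T + T"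
        using \<open>T > 0\<close> by (simp_all add: field_simps)
      moreover have "t * N \<le> T * N" using t by (simp add: mult_right_mono)
      ultimately have "real j * T \<le> N * T" by (simp add: mult.commute)
      then have "j < Suc N" using \<open>T > 0\<close> by simp
      have "\<bar>t - \<tau> j\<bar> \<le> T / N"
      proof -
        have "t - \<tau> j = (t * N - real j * T) / N" using \<open>N > 0\<close> by (simp add: \<tau>_def field_simps)
        then show ?thesis using \<open>real j * T \<le> t * N\<close> \<open>t * N \<le> real j * T + T\<close> \<open>N > 0\<close>
          by (simp add: divide_right_mono)
      qed
      have "\<bar>interp L (Suc N) \<tau> (\<lambda>i. w (\<tau> i)) t - w t\<bar> \<le> 2 * L * \<bar>t - \<tau> j\<bar>"
        by (rule interp_approx) (use lip_ballD(2)[OF wX] t \<tau>I \<open>j < Suc N\<close> in auto)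
      also have "\<dots> \<le> 2 * L * (T / N)"
        using \<open>\<bar>t - \<tau> j\<bar> \<le> T / N\<close> \<open>L \<ge> 0\<close> by (intro mult_left_mono) auto
      also have "\<dots> \<le> \<epsilon>/2"
        using N \<open>N > 0\<close> by (simp add: field_simps)
      finally have 1: "\<bar>interp L (Suc N) \<tau> (\<lambda>i. w (\<tau> i)) t - w t\<bar> \<le> \<epsilon>/2" .
      have 2: "\<bar>interp L (Suc N) \<tau> (\<lambda>j. R * (2 * x j - 1)) t - interp L (Suc N) \<tau> (\<lambda>i. w (\<tau> i)) t\<bar> \<le> \<epsilon>/2"
        by (rule interp_diff_le) (use node in auto)
      have "\<bar>w t\<bar> \<le> R" using lip_ballD(1)[OF wX t] .
      then have "max (-R) (min R (w t)) = w t" by auto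
      then have "\<bar>J x t - w t\<bar> \<le> \<bar>interp L (Suc N) \<tau> (\<lambda>j. R * (2 * x j - 1)) t - w t\<bar>"
        unfolding J_def using clamp_diff_le[of "-R" R _ "w t"] by metis
      then show ?thesis using 1 2 unfolding w_def by linarith
    qed
    then show ?thesis using JX by blast
  qed
  then have "\<forall>m. \<exists>u\<in>lip_ball T R L. \<forall>t\<in>{0..T}. \<bar>G u t - u t\<bar> \<le> 1 / real (Suc m)" by simp
  then obtain v where vX: "\<And>m. v m \<in> lip_ball T R L"
    and v: "\<And>m t. t \<in> {0..T} \<Longrightarrow> \<bar>G (v m) t - v m t\<bar> \<le> 1 / real (Suc m)" by metis
  obtain u k where uX: "u \<in> lip_ball T R L" and "strict_mono (k :: nat \<Rightarrow> nat)"
    and lim: "\<And>e. 0 < e \<Longrightarrow> \<exists>N. \<forall>n\<ge>N. \<forall>t\<in>{0..T}. \<bar>v (k n) t - u t\<bar> < e"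
    using lip_ball_compact[of v T R L] vX \<open>L \<ge> 0\<close> by blast
  have "G u t = u t" if t: "t \<in> {0..T}" for t
  proof -
    have "\<bar>G u t - u t\<bar> \<le> 0 + \<epsilon>" if "\<epsilon> > 0" for \<epsilon>
    proof -
      obtain \<delta> where "\<delta> > 0" and \<delta>: "\<And>v w t. \<lbrakk>v\<in>lip_ball T R L; w\<in>lip_ball T R L;
          \<forall>t\<in>{0..T}. \<bar>v t - w t\<bar> \<le> \<delta>; t\<in>{0..T}\<rbrakk> \<Longrightarrow> \<bar>G v t - G w t\<bar> \<le> \<epsilon>/3"
        using uc[of "\<epsilon>/3"] \<open>\<epsilon> > 0\<close> by (metis divide_pos_pos zero_less_numeral)
      obtain N1 where N1: "\<forall>n\<ge>N1. \<forall>t\<in>{0..T}. \<bar>v (k n) t - u t\<bar> < min \<delta> (\<epsilon>/3)"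
        using lim[of "min \<delta> (\<epsilon>/3)"] \<open>\<epsilon> > 0\<close> \<open>\<delta> > 0\<close> by auto
      obtain N2 :: nat where "N2 > 0" and N2: "inverse (real N2) < \<epsilon>/3"
        using real_arch_inverse[of "\<epsilon>/3"] \<open>\<epsilon> > 0\<close> by auto
      define n where "n = max N1 N2"
      have "k n \<ge> n" using \<open>strict_mono k\<close> by (simp add: strict_mono_imp_increasing)
      then have "real (Suc (k n)) \<ge> real N2" by (simp add: n_def)
      then have "1 / real (Suc (k n)) \<le> inverse (real N2)"
        using \<open>N2 > 0\<close> by (simp add: inverse_eq_divide frac_le)
      then have a: "\<bar>G (v (k n)) t - v (k n) t\<bar> \<le> \<epsilon>/3" using v[OF t, of "k n"] N2 by linarith
      have b: "\<forall>t\<in>{0..T}. \<bar>v (k n) t - u t\<bar> < min \<delta> (\<epsilon>/3)" using N1 by (simp add: n_def)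
      then have "\<forall>t\<in>{0..T}. \<bar>v (k n) t - u t\<bar> \<le> \<delta>" by (auto intro: less_imp_le)
      then have "\<bar>G (v (k n)) t - G u t\<bar> \<le> \<epsilon>/3" by (rule \<delta>[OF vX uX _ t])
      moreover have "\<bar>v (k n) t - u t\<bar> \<le> \<epsilon>/3" using b t by (auto intro: less_imp_le)
      ultimately show ?thesis using a by linarith
    qed
    then show ?thesis using field_le_epsilon[of "\<bar>G u t - u t\<bar>" 0] by simp
  qed
  then show thesis using that uX by blast
qed

section \<open>Lebesgue differentiation and absolutely continuous functions\<close>

lemma tagged_partial_division_real:
  fixes a b :: real
  assumes p: "p tagged_partial_division_of {a..b}" and "(x, K) \<in> p"
  shows "K = {Inf K..Sup K} \<and> Inf K \<le> x \<and> x \<le> Sup K \<and> a \<le> Inf K \<and> Sup K \<le> b \<and>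
         content K = Sup K - Inf K"
proof -
  obtain u v where uv: "K = cbox u v" "x \<in> K" "K \<subseteq> {a..b}"
    using tagged_partial_division_ofD(2-4)[OF p \<open>(x, K) \<in> p\<close>] by blast
  then have "u \<le> v" by auto
  then show ?thesis using uv by auto
qed

text \<open>To be used for the intervals tagged in a null set, which lie in an open set of small
  measure. An interval occurring with several tags has empty interior, hence content 0, so the sum
  may be taken over the intervals alone.\<close>

lemma sum_content_tagged_le_measure:
  assumes p: "p tagged_partial_division_of S" and U: "\<And>x K. (x, K) \<in> p \<Longrightarrow> K \<subseteq> U" "U \<in> lmeasurable"
  shows "(\<Sum>(x,K)\<in>p. content K) \<le> measure lebesgue U"
proof -
  have td: "p tagged_division_of \<Union>(snd ` p)"
    using tagged_partial_division_of_Union_self[OF p] .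
  note div = division_of_tagged_division[OF td]
  have "(\<Sum>(x,K)\<in>p. content K) = sum content (snd ` p)"
    by (rule sum.over_tagged_division_lemma[OF td]) (simp add: content_eq_0_interior)
  also have "\<dots> = measure lebesgue (\<Union>(snd ` p))"
  proof -
    have "(\<Sum>K\<in>snd ` p. measure lebesgue K) = measure lebesgue (\<Union>(snd ` p))"
    proof (rule measure_negligible_finite_Union[symmetric])
      show "finite (snd ` p)" using division_ofD(1)[OF div] .
      show "S \<in> lmeasurable" if "S \<in> snd ` p" for S
        using division_ofD(4)[OF div that] by auto
      show "pairwise (\<lambda>S T. negligible (S \<inter> T)) (snd ` p)"
        unfolding pairwise_def
      proof (intro ballI impI)
        fix S T assume ST: "S \<in> snd ` p" "T \<in> snd ` p" "S \<noteq> T"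
        obtain a b c d where eq: "S = cbox a b" "T = cbox c d"
          using division_ofD(4)[OF div ST(1)] division_ofD(4)[OF div ST(2)] by auto
        have "interior (S \<inter> T) = {}"
          using division_ofD(5)[OF div ST(1,2) ST(3)] by (simp add: interior_Int)
        then show "negligible (S \<inter> T)"
          unfolding eq by (intro negligible_convex_interior[THEN iffD2]) (auto intro: convex_Int)
      qed
    qed
    moreover have "(\<Sum>K\<in>snd ` p. measure lebesgue K) = sum content (snd ` p)"
    proof (rule sum.cong)
      fix K assume "K \<in> snd ` p"
      then obtain u v where "K = cbox u v" using division_ofD(4)[OF div] by blast
      then show "measure lebesgue K = content K" by simp
    qed simp
    ultimately show ?thesis by simp
  qed
  also have "\<dots> \<le> measure lebesgue U"
  proof (rule measure_mono_fmeasurable)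
    show "\<Union>(snd ` p) \<subseteq> U" using U(1) by fastforce
    show "\<Union>(snd ` p) \<in> sets lebesgue"
    proof (rule sets.finite_Union[OF division_ofD(1)[OF div]], rule subsetI)
      fix K assume "K \<in> snd ` p"
      then obtain u v where "K = cbox u v" using division_ofD(4)[OF div] by blast
      then show "K \<in> sets lebesgue" by simp
    qed
  qed (rule U)
  finally show ?thesis .
qed

text \<open>At a bad point arbitrarily short intervals violate the estimate of Henstock's lemma by a fixed factor;
  a Vitali subfamily of them covers almost all bad points and has small total length.\<close>
lemma integral_has_real_derivative_negligible:
  fixes g :: "real \<Rightarrow> real"
  assumes int: "g integrable_on {a..b}"
  shows "negligible {x\<in>{a..b}. \<not> ((\<lambda>t. integral {a..t} g) has_real_derivative g x) (at x within {a..b})}"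
proof -
  define I where "I = (\<lambda>t. integral {a..t} g)"
  define bad where "bad = (\<lambda>n x y. \<bar>y - x\<bar> / real (Suc n) < \<bar>I y - I x - g x * (y - x)\<bar>)"
  define B where "B = (\<lambda>n. {x\<in>{a..b}. \<forall>d>0. \<exists>y\<in>{a..b}. y \<noteq> x \<and> \<bar>y - x\<bar> < d \<and> bad n x y})"
  have Idiff: "I v - I u = integral {u..v} g" if "a \<le> u" "u \<le> v" "v \<le> b" for u v
  proof -
    have "g integrable_on {a..v}" by (rule integrable_subinterval_real[OF int]) (use that in auto)
    then have "integral {a..u} g + integral {u..v} g = integral {a..v} g"
      using that by (intro Henstock_Kurzweil_Integration.integral_combine) auto
    then show ?thesis by (simp add: I_def)
  qed
  have "negligible (B n)" for n
    unfolding negligible_outer_le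
  proof (intro allI impI)
    fix e :: real assume "e > 0"
    \<comment> \<open>An interval violating the estimate at rate \<open>1 / Suc n\<close> is at most
      \<open>Suc n\<close> times as long as its Henstock error; a total error below
      \<open>\<epsilon>\<close> therefore means total length at most \<open>e\<close>.\<close>
    define \<epsilon> where "\<epsilon> = e / real (Suc n)"
    have "\<epsilon> > 0" using \<open>e > 0\<close> by (simp add: \<epsilon>_def)
    obtain \<gamma> where "gauge \<gamma>" and \<gamma>: "\<And>p. \<lbrakk>p tagged_partial_division_of (cbox a b); \<gamma> fine p\<rbrakk> \<Longrightarrow>
             sum (\<lambda>(x,k). norm (content k *\<^sub>R g x - integral k g)) p < \<epsilon>"
      using Henstock_lemma[of g a b \<epsilon>] int \<open>\<epsilon> > 0\<close> by auto
    \<comment> \<open>The interval between \<open>x\<close> and \<open>y\<close>, written as a ball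
      around its midpoint to fit the Vitali theorem; its tag \<open>x\<close> remains an
      endpoint.\<close>
    define C where "C = (\<lambda>(x,y). cball ((x + y) / 2) (\<bar>y - x\<bar> / 2) :: real set)"
    have Ceq: "C (x,y) = {min x y..max x y}" for x y
      by (auto simp: C_def cball_eq_atLeastAtMost field_simps abs_real_def)
    define K where "K = {(x,y). x \<in> B n \<and> y \<in> {a..b} \<and> y \<noteq> x \<and> C (x,y) \<subseteq> \<gamma> x \<and> bad n x y}"
    have cover: "\<exists>i. i \<in> K \<and> x \<in> cball ((fst i + snd i) / 2) (\<bar>snd i - fst i\<bar> / 2) \<and> \<bar>snd i - fst i\<bar> / 2 < d"
      if x: "x \<in> B n" and "d > 0" for x d
    proof -
      obtain r where "r > 0" and r: "ball x r \<subseteq> \<gamma> x"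
        using \<open>gauge \<gamma>\<close> unfolding gauge_def by (meson openE)
      obtain y where y: "y \<in> {a..b}" "y \<noteq> x" "\<bar>y - x\<bar> < min r d" "bad n x y"
      proof -
        have "min r d > 0" using \<open>r > 0\<close> \<open>d > 0\<close> by simp
        then have "\<exists>y\<in>{a..b}. y \<noteq> x \<and> \<bar>y - x\<bar> < min r d \<and> bad n x y"
          using x unfolding B_def by blast
        then show thesis using that by blast
      qed
      have "C (x,y) \<subseteq> ball x r"
        unfolding Ceq using y(3) by (auto simp: dist_real_def)
      then have "(x,y) \<in> K" using x y r by (auto simp: K_def)
      moreover have "x \<in> C (x,y)" by (simp add: Ceq)
      ultimately show ?thesis
        using y(3) by (intro exI[of _ "(x,y)"]) (auto simp: C_def)
    qed
    obtain F where F: "countable F" "F \<subseteq> K"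
      and disj: "pairwise (\<lambda>i j. disjnt (C i) (C j)) F" and rest: "negligible (B n - (\<Union>i\<in>F. C i))"
    proof -
      have *: "cball ((fst i + snd i) / 2) (\<bar>snd i - fst i\<bar> / 2) = C i" for i
        by (simp add: C_def split_def)
      show thesis
      proof (rule Vitali_covering_theorem_cballs[of K "\<lambda>i. \<bar>snd i - fst i\<bar> / 2" "B n" "\<lambda>i. (fst i + snd i) / 2"])
        show "0 < \<bar>snd i - fst i\<bar> / 2" if "i \<in> K" for i
          using that by (simp add: K_def split_def)
      next
        fix F assume "countable F" "F \<subseteq> K"
          "pairwise (\<lambda>i j. disjnt (cball ((fst i + snd i) / 2) (\<bar>snd i - fst i\<bar> / 2))
             (cball ((fst j + snd j) / 2) (\<bar>snd j - fst j\<bar> / 2))) F"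
          "negligible (B n - (\<Union>i\<in>F. cball ((fst i + snd i) / 2) (\<bar>snd i - fst i\<bar> / 2)))"
        then show thesis using that unfolding * by blast
      qed (rule cover)
    qed
    have Csub: "C i \<subseteq> {a..b}" if "i \<in> F" for i
    proof -
      obtain x y where "i = (x,y)" by fastforce
      then show ?thesis using that F(2) by (auto simp: Ceq K_def B_def)
    qed
    \<comment> \<open>Henstock's lemma speaks of finite partial divisions, so the length is first
      bounded for finite subfamilies; the countable union follows by approximation.\<close>
    have fin: "measure lebesgue (\<Union>i\<in>G. C i) \<le> e" if "finite G" "G \<subseteq> F" for G
    proof -
      define p where "p = (\<lambda>i. (fst i, C i)) ` G"
      have pd: "p tagged_partial_division_of cbox a b"
        unfolding tagged_partial_division_of_def
      proof (intro conjI allI impI)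
        show "finite p" using that by (simp add: p_def)
        fix x L assume "(x, L) \<in> p"
        then obtain y where "(x,y) \<in> G" "L = C (x,y)" by (auto simp: p_def)
        then show "x \<in> L" "L \<subseteq> cbox a b" "\<exists>u v. L = cbox u v"
          using Csub[of "(x,y)"] that by (auto simp: Ceq)
      next
        fix x1 K1 x2 K2 assume "(x1, K1) \<in> p \<and> (x2, K2) \<in> p \<and> (x1, K1) \<noteq> (x2, K2)"
        then obtain i j where ij: "i \<in> G" "j \<in> G" "K1 = C i" "K2 = C j" "i \<noteq> j" by (auto simp: p_def)
        then have "C i \<inter> C j = {}" using disj \<open>G \<subseteq> F\<close> by (auto simp: pairwise_def disjnt_def)
        then show "interior K1 \<inter> interior K2 = {}"
          using ij interior_subset by blast
      qed
      have fine: "\<gamma> fine p"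
      proof (rule fineI)
        fix x L assume "(x, L) \<in> p"
        then obtain y where y: "(x,y) \<in> G" "L = C (x,y)" by (auto simp: p_def)
        then have "(x,y) \<in> K" using \<open>G \<subseteq> F\<close> F(2) by auto
        then show "L \<subseteq> \<gamma> x" by (simp add: K_def y(2))
      qed
      have each: "content L / real (Suc n) \<le> norm (content L *\<^sub>R g x - integral L g)" if xL: "(x, L) \<in> p" for x L
      proof -
        obtain y where y: "(x,y) \<in> G" "L = C (x,y)" using xL by (auto simp: p_def)
        then have "(x,y) \<in> K" using \<open>G \<subseteq> F\<close> F(2) by auto
        then have xy: "x \<in> {a..b}" "y \<in> {a..b}" "bad n x y" by (auto simp: K_def B_def)
        have L: "L = {min x y..max x y}" using y Ceq by simp
        have c: "content L = \<bar>y - x\<bar>" by (simp add: L max_def min_def)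
        have "\<bar>I y - I x - g x * (y - x)\<bar> = \<bar>content L * g x - integral L g\<bar>"
          using Idiff[of x y] Idiff[of y x] xy(1,2) c by (cases "x \<le> y") (auto simp: L algebra_simps)
        then show ?thesis using xy(3) c by (simp add: bad_def)
      qed
      have "(\<Sum>(x,L)\<in>p. content L) \<le> (\<Sum>(x,L)\<in>p. real (Suc n) * norm (content L *\<^sub>R g x - integral L g))"
        using each by (intro sum_mono) (auto simp: field_simps)
      also have "\<dots> = real (Suc n) * (\<Sum>(x,L)\<in>p. norm (content L *\<^sub>R g x - integral L g))"
        by (simp add: sum_distrib_left split_def)
      also have "\<dots> \<le> real (Suc n) * \<epsilon>"
        using \<gamma>[OF pd fine] by (intro mult_left_mono) auto
      also have "\<dots> = e" by (simp add: \<epsilon>_def)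
      finally have "(\<Sum>(x,L)\<in>p. content L) \<le> e" .
      moreover have "measure lebesgue (\<Union>i\<in>G. C i) \<le> (\<Sum>i\<in>G. measure lebesgue (C i))"
        by (rule measure_UNION_le[OF \<open>finite G\<close>]) (auto simp: C_def)
      moreover have "(\<Sum>i\<in>G. measure lebesgue (C i)) = (\<Sum>(x,L)\<in>p. content L)"
      proof -
        have "inj_on (\<lambda>i. (fst i, C i)) G"
        proof (rule inj_onI)
          fix i j assume ij: "i \<in> G" "j \<in> G" "(fst i, C i) = (fst j, C j)"
          obtain x y where "i = (x,y)" by fastforce
          then have "C i \<noteq> {}" by (simp add: Ceq)
          moreover have "i \<in> F" "j \<in> F" "C i = C j" using ij \<open>G \<subseteq> F\<close> by auto
          ultimately show "i = j"
            using disj unfolding pairwise_def disjnt_def by (metis Int_absorb)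
        qed
        then show ?thesis
          unfolding p_def by (subst sum.reindex) (auto simp: C_def intro!: sum.cong)
      qed
      ultimately show ?thesis by linarith
    qed
    define U where "U = (\<Union>i\<in>F. C i)"
    have Ulm: "U \<in> lmeasurable"
    proof (rule fmeasurableI2[of "{a..b}"])
      show "U \<in> sets lebesgue"
        unfolding U_def using F(1) by (intro sets.countable_UN') (auto simp: C_def)
    qed (use Csub in \<open>auto simp: U_def\<close>)
    have Ule: "measure lebesgue U \<le> e"
    proof (rule field_le_epsilon)
      fix d :: real assume "d > 0"
      obtain D where D: "D \<subseteq> C ` F" "finite D" "measure lebesgue (\<Union>(C ` F)) - d < measure lebesgue (\<Union>D)"
      proof (rule measure_countable_Union_approachable[of "C ` F" d e])
        show "measure lebesgue (\<Union>D') \<le> e" if "D' \<subseteq> C ` F" "finite D'" for D'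
          using fin finite_subset_image[OF that(2,1)] by metis
      qed (use F(1) \<open>d > 0\<close> in \<open>auto simp: C_def\<close>)
      moreover have "measure lebesgue (\<Union>D) \<le> e"
        using fin finite_subset_image[OF D(2,1)] by metis
      ultimately show "measure lebesgue U \<le> e + d" by (simp add: U_def)
    qed
    show "\<exists>T. B n \<subseteq> T \<and> T \<in> lmeasurable \<and> measure lebesgue T \<le> e"
    proof (intro exI conjI)
      show "B n \<subseteq> U \<union> (B n - U)" by blast
      have neg: "negligible (B n - U)" using rest by (simp add: U_def)
      then show "U \<union> (B n - U) \<in> lmeasurable"
        using Ulm by (intro fmeasurable.Un) (auto intro: negligible_imp_measurable)
      have "measure lebesgue (U \<union> (B n - U)) \<le> measure lebesgue U + measure lebesgue (B n - U)"
        using Ulm neg by (intro measure_Un_le) (auto intro: negligible_imp_sets)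
      then show "measure lebesgue (U \<union> (B n - U)) \<le> e"
        using Ule negligible_imp_measure0[OF neg] by linarith
    qed
  qed
  then have "negligible (\<Union>n. B n)" by (intro negligible_Union_nat)
  then show ?thesis
  proof (rule negligible_subset, intro subsetI)
    fix x assume "x \<in> {x\<in>{a..b}. \<not> ((\<lambda>t. integral {a..t} g) has_real_derivative g x) (at x within {a..b})}"
    then have x: "x \<in> {a..b}" and nd: "\<not> (I has_real_derivative g x) (at x within {a..b})"
      by (auto simp: I_def)
    show "x \<in> (\<Union>n. B n)"
    proof (rule ccontr)
      assume nB: "x \<notin> (\<Union>n. B n)"
      have "(I has_real_derivative g x) (at x within {a..b})"
        unfolding has_field_derivative_def has_derivative_within_alt
      proof (intro conjI allI impI bounded_linear_mult_right)
        fix e :: real assume "e > 0"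
        obtain n where n: "inverse (real (Suc n)) < e" using reals_Archimedean[OF \<open>e > 0\<close>] by blast
        have "x \<notin> B n" using nB by blast
        then obtain d where "d > 0" and d: "\<And>y. \<lbrakk>y\<in>{a..b}; y \<noteq> x; \<bar>y - x\<bar> < d\<rbrakk> \<Longrightarrow> \<not> bad n x y"
          using x unfolding B_def by blast
        have "norm (I y - I x - g x * (y - x)) \<le> e * norm (y - x)" if "y \<in> {a..b}" "norm (y - x) < d" for y
        proof (cases "y = x")
          case False
          then have "\<bar>I y - I x - g x * (y - x)\<bar> \<le> inverse (real (Suc n)) * \<bar>y - x\<bar>"
            using d[of y] that by (simp add: bad_def field_simps)
          also have "\<dots> \<le> e * \<bar>y - x\<bar>" using n by (intro mult_right_mono) auto
          finally show ?thesis by simp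
        qed simp
        then show "\<exists>d>0. \<forall>y\<in>{a..b}. norm (y - x) < d \<longrightarrow> norm (I y - I x - g x * (y - x)) \<le> e * norm (y - x)"
          using \<open>d > 0\<close> by blast
      qed
      with nd show False by contradiction
    qed
  qed
qed

text \<open>Transfers absolute continuity from finite sequences of intervals to tagged partial
  divisions, the language of the gauge integral.\<close>

lemma abs_cont_on_tagged_sum:
  assumes ac: "abs_cont_on a b g" and "\<epsilon> > 0"
  obtains \<delta> where "\<delta> > 0"
    "\<And>p. \<lbrakk>p tagged_partial_division_of {a..b}; (\<Sum>(x,K)\<in>p. content K) < \<delta>\<rbrakk>
       \<Longrightarrow> (\<Sum>(x,K)\<in>p. \<bar>g (Sup K) - g (Inf K)\<bar>) < \<epsilon>"
proof -
  obtain \<delta> where "\<delta> > 0" and \<delta>: "\<And>(n::nat) (x::nat \<Rightarrow> real) (y::nat \<Rightarrow> real).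
        \<lbrakk>\<forall>i<n. a \<le> x i \<and> x i \<le> y i \<and> y i \<le> b;
        \<forall>i<n. \<forall>j<n. i \<noteq> j \<longrightarrow> y i \<le> x j \<or> y j \<le> x i; (\<Sum>i<n. y i - x i) < \<delta>\<rbrakk>
        \<Longrightarrow> (\<Sum>i<n. \<bar>g (y i) - g (x i)\<bar>) < \<epsilon>"
  proof -
    from ac \<open>\<epsilon> > 0\<close> obtain \<delta> where "\<delta> > 0" and "\<forall>(n::nat) (x::nat \<Rightarrow> real) (y::nat \<Rightarrow> real).
        (\<forall>i<n. a \<le> x i \<and> x i \<le> y i \<and> y i \<le> b) \<and>
        (\<forall>i<n. \<forall>j<n. i \<noteq> j \<longrightarrow> y i \<le> x j \<or> y j \<le> x i) \<and>
        (\<Sum>i<n. y i - x i) < \<delta>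
        \<longrightarrow> (\<Sum>i<n. \<bar>g (y i) - g (x i)\<bar>) < \<epsilon>"
      unfolding abs_cont_on_def by blast
    then show thesis by (intro that) auto
  qed
  show thesis
  proof (rule that[OF \<open>\<delta> > 0\<close>])
    fix p assume p: "p tagged_partial_division_of {a..b}" and sm: "(\<Sum>(x,K)\<in>p. content K) < \<delta>"
    \<comment> \<open>Degenerate intervals are dropped: a point inside another interval has disjoint
      interior from it, yet violates the ordering that \<open>abs_cont_on\<close> demands. It
      contributes 0 to both sums.\<close>
    define p' where "p' = {(x,K)\<in>p. Inf K < Sup K}"
    have "finite p" using p by (auto simp: tagged_partial_division_of_def)
    have "p' \<subseteq> p" by (auto simp: p'_def)
    note K = tagged_partial_division_real[OF p]
    obtain h n where h: "bij_betw h {..<n::nat} p'"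
      using finite_subset[OF \<open>p' \<subseteq> p\<close> \<open>finite p\<close>] by (metis atLeast0LessThan ex_bij_betw_nat_finite)
    have hp: "h i \<in> p'" if "i < n" for i using h that by (auto simp: bij_betw_def)
    define x where "x = (\<lambda>i. Inf (snd (h i)))"
    define y where "y = (\<lambda>i. Sup (snd (h i)))"
    have reind: "(\<Sum>i<n. \<Phi> (h i)) = sum \<Phi> p'" for \<Phi> :: "_ \<Rightarrow> real"
      using sum.reindex_bij_betw[OF h] .
    have "(\<Sum>i<n. \<bar>g (y i) - g (x i)\<bar>) < \<epsilon>"
    proof (rule \<delta>)
      show "\<forall>i<n. a \<le> x i \<and> x i \<le> y i \<and> y i \<le> b"
        proof (intro allI impI)
        fix i assume "i < n"
        obtain s A where hi: "h i = (s,A)" by fastforce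
        then have "(s,A) \<in> p" using hp[OF \<open>i < n\<close>] \<open>p' \<subseteq> p\<close> by auto
        from K[OF this] show "a \<le> x i \<and> x i \<le> y i \<and> y i \<le> b"
          unfolding x_def y_def hi by auto
      qed
      show "\<forall>i<n. \<forall>j<n. i \<noteq> j \<longrightarrow> y i \<le> x j \<or> y j \<le> x i"
      proof (intro allI impI)
        fix i j assume ij: "i < n" "j < n" "i \<noteq> j"
        obtain s A t B where hij: "h i = (s,A)" "h j = (t,B)" by fastforce
        have "h i \<noteq> h j" using h ij by (auto simp: bij_betw_def inj_on_def)
        then have "interior A \<inter> interior B = {}"
        proof (intro tagged_partial_division_ofD(5)[OF p])
          show "(s,A) \<in> p" "(t,B) \<in> p"
            using hp[OF ij(1)] hp[OF ij(2)] \<open>p' \<subseteq> p\<close> hij by auto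
        qed (use hij in simp)
        moreover have "A = {x i..y i}" "B = {x j..y j}" "x i < y i" "x j < y j"
          using K[of s A] K[of t B] hp[OF ij(1)] hp[OF ij(2)] hij by (auto simp: x_def y_def p'_def)
        ultimately have disj: "{x i<..<y i} \<inter> {x j<..<y j} = {}" by simp
        show "y i \<le> x j \<or> y j \<le> x i"
        proof (rule ccontr)
          assume "\<not> ?thesis"
          then have "max (x i) (x j) < min (y i) (y j)"
            using \<open>x i < y i\<close> \<open>x j < y j\<close> by auto
          then obtain z where "max (x i) (x j) < z" "z < min (y i) (y j)" using dense by blast
          then have "z \<in> {x i<..<y i} \<inter> {x j<..<y j}" by auto
          with disj show False by blast
        qed
      qed
      have "(\<Sum>i<n. y i - x i) = (\<Sum>(x,K)\<in>p'. Sup K - Inf K)"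
        using reind[of "\<lambda>(x,K). Sup K - Inf K"] by (simp add: x_def y_def split_def)
      also have "\<dots> = (\<Sum>(x,K)\<in>p'. content K)"
        using K \<open>p' \<subseteq> p\<close> by (intro sum.cong) auto
      also have "\<dots> \<le> (\<Sum>(x,K)\<in>p. content K)"
        by (rule sum_mono2[OF \<open>finite p\<close> \<open>p' \<subseteq> p\<close>]) auto
      finally show "(\<Sum>i<n. y i - x i) < \<delta>" using sm by linarith
    qed
    also have "(\<Sum>i<n. \<bar>g (y i) - g (x i)\<bar>) = (\<Sum>(x,K)\<in>p'. \<bar>g (Sup K) - g (Inf K)\<bar>)"
      using reind[of "\<lambda>(x,K). \<bar>g (Sup K) - g (Inf K)\<bar>"] by (simp add: x_def y_def split_def)
    also have "\<dots> = (\<Sum>(x,K)\<in>p. \<bar>g (Sup K) - g (Inf K)\<bar>)"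
    proof (rule sum.mono_neutral_left[OF \<open>finite p\<close> \<open>p' \<subseteq> p\<close>], rule ballI)
      fix i assume i: "i \<in> p - p'"
      obtain s A where "i = (s,A)" by fastforce
      then have "Inf A = Sup A" using i K[of s A] by (auto simp: p'_def)
      then show "(case i of (x, K) \<Rightarrow> \<bar>g (Sup K) - g (Inf K)\<bar>) = 0" by (simp add: \<open>i = (s,A)\<close>)
    qed
    finally show "(\<Sum>(x,K)\<in>p. \<bar>g (Sup K) - g (Inf K)\<bar>) < \<epsilon>" .
  qed
qed

text \<open>Off \<open>N\<close> the gauge comes from differentiability at the tag. On
  \<open>N\<close> nothing is known about derivatives, but the intervals tagged there have small
  total length, and absolute continuity makes the increments of \<open>g\<close> over them small.
  The lemma turns an equation that holds almost everywhere into its integrated form.\<close>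

lemma fundamental_theorem_of_calculus_abs_cont:
  fixes g g' :: "real \<Rightarrow> real"
  assumes "a \<le> b" and ac: "abs_cont_on a b g" and "negligible N"
    and deriv: "\<And>x. x \<in> {a..b} - N \<Longrightarrow> (g has_real_derivative g' x) (at x within {a..b})"
  shows "(g' has_integral (g b - g a)) {a..b}"
proof -
  \<comment> \<open>With the integrand set to 0 on \<open>N\<close>, tags in \<open>N\<close>
    contribute nothing but increments of \<open>g\<close>.\<close>
  define h where "h = (\<lambda>x. if x \<in> N then 0 else g' x)"
  have "(h has_integral (g b - g a)) {a..b}"
    unfolding has_integral_real
  proof (intro allI impI)
    fix e :: real assume "e > 0"
    \<comment> \<open>The errors off \<open>N\<close> add up to \<open>\<epsilon> * (b - a)\<close>,
      at most \<open>e/4\<close>; the summand 1 covers \<open>a = b\<close>.\<close>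
    define \<epsilon> where "\<epsilon> = e / (4 * (b - a + 1))"
    have "\<epsilon> > 0" using \<open>e > 0\<close> \<open>a \<le> b\<close> by (simp add: \<epsilon>_def)
    have "\<exists>d>0. x \<in> {a..b} - N \<longrightarrow> (\<forall>y\<in>{a..b}. \<bar>y - x\<bar> < d \<longrightarrow> \<bar>g y - g x - g' x * (y - x)\<bar> \<le> \<epsilon> * \<bar>y - x\<bar>)" for x
    proof (cases "x \<in> {a..b} - N")
      case True
      then show ?thesis
        using deriv[OF True] \<open>\<epsilon> > 0\<close>
        unfolding has_field_derivative_def has_derivative_within_alt by auto
    qed (auto intro: exI[of _ 1])
    then obtain d where dpos: "\<And>x. d x > 0"
      and d: "\<And>x y. \<lbrakk>x \<in> {a..b} - N; y \<in> {a..b}; \<bar>y - x\<bar> < d x\<rbrakk> \<Longrightarrow> \<bar>g y - g x - g' x * (y - x)\<bar> \<le> \<epsilon> * \<bar>y - x\<bar>"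
      by metis
    obtain \<delta> where "\<delta> > 0" and \<delta>: "\<And>p. \<lbrakk>p tagged_partial_division_of {a..b}; (\<Sum>(x,K)\<in>p. content K) < \<delta>\<rbrakk>
       \<Longrightarrow> (\<Sum>(x,K)\<in>p. \<bar>g (Sup K) - g (Inf K)\<bar>) < e/2"
      using abs_cont_on_tagged_sum[OF ac, of "e/2"] \<open>e > 0\<close> by auto
    obtain U where "open U" "N \<subseteq> U" "U - N \<in> lmeasurable" and mU: "emeasure lebesgue (U - N) < ennreal \<delta>"
      using sets_lebesgue_outer_open[OF negligible_imp_sets[OF \<open>negligible N\<close>] \<open>\<delta> > 0\<close>] by metis
    have Ueq: "U = (U - N) \<union> N" using \<open>N \<subseteq> U\<close> by blast
    have Ulm: "U \<in> lmeasurable"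
      using \<open>U - N \<in> lmeasurable\<close> negligible_imp_measurable[OF \<open>negligible N\<close>] by (subst Ueq) (rule fmeasurable.Un)
    have "measure lebesgue U \<le> measure lebesgue (U - N) + measure lebesgue N"
      using \<open>U - N \<in> lmeasurable\<close> negligible_imp_sets[OF \<open>negligible N\<close>] by (subst Ueq) (rule measure_Un_le, auto)
    also have "\<dots> < \<delta>"
      using mU negligible_imp_measure0[OF \<open>negligible N\<close>] \<open>\<delta> > 0\<close> \<open>U - N \<in> lmeasurable\<close>
      by (simp add: emeasure_eq_measure2 ennreal_less_iff)
    finally have Uless: "measure lebesgue U < \<delta>" .
    define \<gamma> where "\<gamma> = (\<lambda>x. if x \<in> N then U else ball x (d x))"
    have "gauge \<gamma>"
      unfolding gauge_def \<gamma>_def using \<open>open U\<close> \<open>N \<subseteq> U\<close> dpos by auto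
    moreover have "norm ((\<Sum>(x,K)\<in>p. content K *\<^sub>R h x) - (g b - g a)) < e"
      if p: "p tagged_division_of {a..b}" and fine: "\<gamma> fine p" for p
    proof -
      have "finite p" using p by auto
      define D where "D = (\<lambda>(x,K). content K * h x - (g (Sup K) - g (Inf K)))"
      define P1 where "P1 = {(x,K)\<in>p. x \<in> N}"
      define P2 where "P2 = {(x,K)\<in>p. x \<notin> N}"
      have "p tagged_partial_division_of {a..b}" using p by (simp add: tagged_division_of_def)
      note K = tagged_partial_division_real[OF this]
      have "(\<Sum>(x,K)\<in>p. content K *\<^sub>R h x) - (g b - g a) = sum D p"
        using additive_tagged_division_1[OF \<open>a \<le> b\<close> p, of g]
        by (simp add: D_def split_def sum_subtractf)
      also have "\<dots> = sum D P1 + sum D P2"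
      proof -
        have "p = P1 \<union> P2" "P1 \<inter> P2 = {}" by (auto simp: P1_def P2_def)
        then show ?thesis using \<open>finite p\<close> by (metis (no_types) finite_Un sum.union_disjoint)
      qed
      finally have eq: "(\<Sum>(x,K)\<in>p. content K *\<^sub>R h x) - (g b - g a) = sum D P1 + sum D P2" .
      have P1: "\<bar>sum D P1\<bar> < e/2"
      proof -
        have pd: "P1 tagged_partial_division_of {a..b}"
          by (rule tagged_partial_division_subset[of p])
            (use \<open>p tagged_partial_division_of {a..b}\<close> in \<open>auto simp: P1_def\<close>)
        have "(\<Sum>(x,K)\<in>P1. content K) \<le> measure lebesgue U"
        proof (rule sum_content_tagged_le_measure[OF pd _ Ulm])
          fix x K assume "(x, K) \<in> P1"
          then have "(x, K) \<in> p" "x \<in> N" by (simp_all add: P1_def)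
          moreover from this have "K \<subseteq> \<gamma> x" using fine unfolding fine_def by blast
          ultimately show "K \<subseteq> U" by (simp add: \<gamma>_def)
        qed
        then have "(\<Sum>(x,K)\<in>P1. \<bar>g (Sup K) - g (Inf K)\<bar>) < e/2"
          using \<delta>[OF pd] Uless by linarith
        moreover have "\<bar>sum D P1\<bar> \<le> (\<Sum>(x,K)\<in>P1. \<bar>g (Sup K) - g (Inf K)\<bar>)"
          by (rule order_trans[OF sum_abs], rule sum_mono) (auto simp: D_def P1_def h_def)
        ultimately show ?thesis by linarith
      qed
      have P2: "\<bar>sum D P2\<bar> \<le> e/4"
      proof -
        have "\<bar>D i\<bar> \<le> \<epsilon> * content (snd i)" if "i \<in> P2" for i
        proof -
          obtain x A where i: "i = (x,A)" by fastforce
          then have xA: "(x,A) \<in> p" "x \<notin> N" using that by (auto simp: P2_def)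
          note KA = K[OF xA(1), THEN conjunct2] and A = K[OF xA(1), THEN conjunct1]
          have "A \<subseteq> \<gamma> x" using fine xA(1) by (rule fineD)
          then have "A \<subseteq> ball x (d x)" using xA(2) by (simp add: \<gamma>_def)
          moreover have "Inf A \<in> A" "Sup A \<in> A"
          proof -
            have "Inf A \<in> {Inf A..Sup A}" "Sup A \<in> {Inf A..Sup A}" using KA by auto
            then show "Inf A \<in> A" "Sup A \<in> A" unfolding A[symmetric] .
          qed
          ultimately have near: "\<bar>Inf A - x\<bar> < d x" "\<bar>Sup A - x\<bar> < d x"
            by (auto simp: dist_real_def)
          have xab: "x \<in> {a..b} - N" using KA xA by auto
          have "\<bar>g (Inf A) - g x - g' x * (Inf A - x)\<bar> \<le> \<epsilon> * \<bar>Inf A - x\<bar>"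
            "\<bar>g (Sup A) - g x - g' x * (Sup A - x)\<bar> \<le> \<epsilon> * \<bar>Sup A - x\<bar>"
            using d[OF xab _ near(1)] d[OF xab _ near(2)] KA by auto
          moreover have "D i = (g (Inf A) - g x - g' x * (Inf A - x)) - (g (Sup A) - g x - g' x * (Sup A - x))"
          proof -
            have c: "content A = Sup A - Inf A" using KA by blast
            have "D i = content A * g' x - (g (Sup A) - g (Inf A))" using xA by (simp add: i D_def h_def)
            then show ?thesis unfolding c by (simp add: algebra_simps)
          qed
          moreover have "\<epsilon> * \<bar>Inf A - x\<bar> + \<epsilon> * \<bar>Sup A - x\<bar> = \<epsilon> * content A"
          proof -
            have "\<bar>Inf A - x\<bar> + \<bar>Sup A - x\<bar> = content A" using KA by auto
            then show ?thesis by (simp flip: distrib_left)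
          qed
          ultimately show ?thesis by (simp add: i)
        qed
        then have "\<bar>sum D P2\<bar> \<le> (\<Sum>i\<in>P2. \<epsilon> * content (snd i))"
          by (intro order_trans[OF sum_abs] sum_mono)
        also have "\<dots> \<le> (\<Sum>i\<in>p. \<epsilon> * content (snd i))"
          using \<open>finite p\<close> \<open>\<epsilon> > 0\<close> by (intro sum_mono2) (auto simp: P2_def)
        also have "\<dots> = \<epsilon> * (b - a)"
          using additive_content_tagged_division[of p a b] p \<open>a \<le> b\<close>
          by (simp add: sum_distrib_left[symmetric] split_def)
        also have "\<dots> \<le> e/4"
          using \<open>e > 0\<close> \<open>a \<le> b\<close> by (simp add: \<epsilon>_def field_simps)
        finally show ?thesis .
      qed
      show ?thesis unfolding eq real_norm_def using P1 P2 \<open>e > 0\<close> by linarith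
    qed
    ultimately show "\<exists>\<gamma>. gauge \<gamma> \<and> (\<forall>p. p tagged_division_of {a..b} \<and> \<gamma> fine p \<longrightarrow>
        norm ((\<Sum>(x,K)\<in>p. content K *\<^sub>R h x) - (g b - g a)) < e)"
      by (intro exI[of _ \<gamma>] conjI allI impI) simp_all
  qed
  then show ?thesis
    by (rule has_integral_spike[OF \<open>negligible N\<close>, rotated]) (auto simp: h_def)
qed

section \<open>A priori bound\<close>

text \<open>At the first time in \<open>{x..y}\<close> at which the level is reached,
  \<open>u\<close> comes from below, so the derivative there cannot be negative.\<close>

lemma upcrossing:
  fixes u :: "real \<Rightarrow> real"
  assumes deriv: "\<And>t. t \<in> {a..b} \<Longrightarrow> (u has_real_derivative du t) (at t within {a..b})"
    and "a \<le> x" "x \<le> y" "y \<le> b" "u x < l" "l \<le> u y"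
  obtains z where "z \<in> {x..y}" "u z = l" "du z \<ge> 0"
proof -
  have cont: "continuous_on {a..b} u"
    by (meson deriv DERIV_continuous_on)
  then have cxy: "continuous_on {x..y} u"
    by (rule continuous_on_subset) (use assms in auto)
  define Z where "Z = {w\<in>{x..y}. l \<le> u w}"
  have "closed Z"
    unfolding Z_def by (intro continuous_on_closed_Collect_le cxy continuous_on_const) auto
  moreover have "Z \<noteq> {}" "bdd_below Z" using assms by (auto simp: Z_def)
  ultimately have zZ: "Inf Z \<in> Z" using closed_contains_Inf by blast
  define z where "z = Inf Z"
  have z: "z \<in> {x..y}" "l \<le> u z" using zZ by (auto simp: z_def Z_def)
  have before: "u w < l" if "w \<in> {x..y}" "w < z" for w
  proof (rule ccontr)
    assume "\<not> u w < l"
    then have "w \<in> Z" using that by (simp add: Z_def)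
    then show False using cInf_lower[OF _ \<open>bdd_below Z\<close>] that by (force simp: z_def)
  qed
  have "x < z" using z \<open>u x < l\<close> by (cases "x = z") auto
  have "u z = l"
  proof (rule ccontr)
    assume "u z \<noteq> l"
    then have "\<exists>w\<ge>x. w \<le> z \<and> u w = l"
      using z \<open>u x < l\<close> \<open>x < z\<close> by (intro IVT') (auto intro: continuous_on_subset[OF cxy])
    then obtain w where "x \<le> w" "w \<le> z" "u w = l" by blast
    then show False using before[of w] z \<open>u z \<noteq> l\<close> by (cases "w = z") auto
  qed
  moreover have "du z \<ge> 0"
  proof (rule ccontr)
    assume "\<not> du z \<ge> 0"
    moreover have "(u has_real_derivative du z) (at z within {a..b})" using deriv z assms by auto
    ultimately obtain d where "d > 0" and d: "\<And>h. \<lbrakk>0 < h; z - h \<in> {a..b}; h < d\<rbrakk> \<Longrightarrow> u z < u (z - h)"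
      using has_real_derivative_neg_dec_left[of u "du z" z "{a..b}"] by force
    define h where "h = min (d/2) (z - x)"
    have "0 < h" "h < d" "x \<le> z - h" using \<open>d > 0\<close> \<open>x < z\<close> by (auto simp: h_def)
    then show False using d[of h] before[of "z - h"] z assms by auto
  qed
  ultimately show thesis using that z by blast
qed

text \<open>If \<open>u\<close> falls at \<open>t\<close>, it has to come back: after
  \<open>t\<close> when it ends at or above the level, and otherwise on \<open>{0..t}\<close>, since
  by periodicity it then starts below the level.\<close>

lemma periodic_level_nonneg_deriv:
  fixes u :: "real \<Rightarrow> real"
  assumes "T > 0"
    and deriv: "\<And>t. t \<in> {0..T} \<Longrightarrow> (u has_real_derivative du t) (at t within {0..T})"
    and per: "u 0 = u T" "du 0 = du T" and t: "t \<in> {0..T}"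
  obtains z where "z \<in> {0..T}" "u z = u t" "du z \<ge> 0"
proof (cases "du t \<ge> 0")
  case True
  then show thesis using that t by blast
next
  case False
  \<comment> \<open>At \<open>t = T\<close> there is no room on the right, so the argument starts
    from the equivalent time 0.\<close>
  define s where "s = (if t = T then 0 else t)"
  have s: "0 \<le> s" "s < T" "u s = u t" "du s < 0" using False \<open>T > 0\<close> t per by (auto simp: s_def)
  then have "(u has_real_derivative du s) (at s within {0..T})" using deriv by auto
  then obtain d where "d > 0" and d: "\<And>h. \<lbrakk>0 < h; s + h \<in> {0..T}; h < d\<rbrakk> \<Longrightarrow> u (s + h) < u s"
    using has_real_derivative_neg_dec_right[of u "du s" s "{0..T}"] s(4) by force
  define y where "y = s + min (d/2) (T - s)"
  have y: "s < y" "y \<le> T" "u y < u t"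
    using \<open>d > 0\<close> s d[of "min (d/2) (T - s)"] by (auto simp: y_def)
  show thesis
  proof (cases "u T \<ge> u t")
    case True
    obtain z where "z \<in> {y..T}" "u z = u t" "du z \<ge> 0"
      by (rule upcrossing[OF deriv, of y T "u t"]) (use y s True in auto)
    then show thesis using that[of z] y s by auto
  next
    case False
    obtain z where "z \<in> {0..t}" "u z = u t" "du z \<ge> 0"
      by (rule upcrossing[OF deriv, of 0 t "u t"]) (use s t False per in auto)
    then show thesis using that[of z] t by auto
  qed
qed

text \<open>The once integrated equation \<open>\<phi>(u') + F(u) = k + \<integral> h\<close>. Equality of \<open>u'\<close> at both ends follows
  from \<open>\<integral> h = 0\<close>.\<close>
definition weak_solution ::
    "real \<Rightarrow> (real \<Rightarrow> real) \<Rightarrow> (real \<Rightarrow> real) \<Rightarrow> (real \<Rightarrow> real) \<Rightarrow> (real \<Rightarrow> real) \<Rightarrow> bool" where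
  "weak_solution T \<psi> F h u \<longleftrightarrow>
     h absolutely_integrable_on {0..T} \<and> integral {0..T} h = 0 \<and> u 0 = u T \<and>
     (\<exists>k. \<forall>t\<in>{0..T}. (u has_real_derivative \<psi> (k + integral {0..t} h - F (u t))) (at t within {0..T}))"

lemma weak_solution_cong:
  assumes "weak_solution T \<psi> F h u" "\<And>t. t \<in> {0..T} \<Longrightarrow> F (u t) = F' (u t)"
    "\<And>t. t \<in> {0..T} \<Longrightarrow> h t = h' t"
  shows "weak_solution T \<psi> F' h' u"
proof -
  have "integral {0..t} h = integral {0..t} h'" if "t \<in> {0..T}" for t
    by (rule integral_cong) (use assms(3) that in auto)
  moreover have "h' absolutely_integrable_on {0..T} \<longleftrightarrow> h absolutely_integrable_on {0..T}"
    by (rule set_integrable_cong) (use assms(3) in auto)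
  moreover have "integral {0..T} h = integral {0..T} h'"
    by (rule integral_cong) (use assms(3) in auto)
  ultimately show ?thesis using assms(1,2) by (simp add: weak_solution_def)
qed

lemma weak_solution_continuous:
  assumes "weak_solution T \<psi> F h u"
  shows "continuous_on {0..T} u"
proof -
  obtain k where k: "\<forall>t\<in>{0..T}. (u has_real_derivative \<psi> (k + integral {0..t} h - F (u t))) (at t within {0..T})"
    using assms unfolding weak_solution_def by blast
  show ?thesis by (rule DERIV_continuous_on) (use k in blast)
qed

lemma abs_integral_diff_le:
  fixes h :: "real \<Rightarrow> real"
  assumes h: "h absolutely_integrable_on {0..T}" and st: "s \<in> {0..T}" "t \<in> {0..T}"
  shows "\<bar>integral {0..t} h - integral {0..s} h\<bar> \<le> integral {0..T} (\<lambda>x. \<bar>h x\<bar>)"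
proof -
  have *: "\<bar>integral {0..t} h - integral {0..s} h\<bar> \<le> integral {0..T} (\<lambda>x. \<bar>h x\<bar>)"
    if "s \<le> t" "s \<in> {0..T}" "t \<in> {0..T}" for s t
  proof -
    have ai: "h absolutely_integrable_on {s..t}"
      by (rule absolutely_integrable_on_subinterval[OF h]) (use that in auto)
    have ints: "h integrable_on {s..t}" "(\<lambda>x. \<bar>h x\<bar>) integrable_on {s..t}" "(\<lambda>x. \<bar>h x\<bar>) integrable_on {0..T}"
      using ai h unfolding absolutely_integrable_on_def by simp_all
    have "h integrable_on {0..t}"
      by (rule integrable_subinterval_real[OF set_lebesgue_integral_eq_integral(1)[OF h]]) (use that in auto)
    with that have "integral {0..s} h + integral {s..t} h = integral {0..t} h"
      by (simp add: Henstock_Kurzweil_Integration.integral_combine)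
    then have "\<bar>integral {0..t} h - integral {0..s} h\<bar> = \<bar>integral {s..t} h\<bar>" by linarith
    also have "\<dots> \<le> integral {s..t} (\<lambda>x. \<bar>h x\<bar>)"
      using integral_norm_bound_integral[of h "{s..t}" "\<lambda>x. \<bar>h x\<bar>"] ints by simp
    also have "\<dots> \<le> integral {0..T} (\<lambda>x. \<bar>h x\<bar>)"
      by (rule integral_subset_le) (simp_all add: ints, use that in simp)
    finally show ?thesis .
  qed
  show ?thesis
  proof (cases "s \<le> t")
    case True
    then show ?thesis by (rule *) (rule st)+
  next
    case False
    then have "\<bar>integral {0..s} h - integral {0..t} h\<bar> \<le> integral {0..T} (\<lambda>x. \<bar>h x\<bar>)"
      by (intro * st) simp
    then show ?thesis by (simp only: abs_minus_commute)
  qed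
qed

locale phi_homeo =
  fixes \<phi> \<psi> :: "real \<Rightarrow> real"
  assumes strict_mono_phi: "strict_mono \<phi>"
    and phi_psi [simp]: "\<phi> (\<psi> x) = x" and psi_phi [simp]: "\<psi> (\<phi> x) = x"
    and continuous_psi: "continuous_on UNIV \<psi>" and phi_0 [simp]: "\<phi> 0 = 0"
begin

lemma phi_le_iff [simp]: "\<phi> x \<le> \<phi> y \<longleftrightarrow> x \<le> y"
  by (rule strict_mono_less_eq[OF strict_mono_phi])

lemma psi_le_iff [simp]: "\<psi> x \<le> \<psi> y \<longleftrightarrow> x \<le> y"
  by (metis phi_le_iff phi_psi)

lemma psi_less_iff [simp]: "\<psi> x < \<psi> y \<longleftrightarrow> x < y"
  by (meson psi_le_iff not_less)

lemma psi_0 [simp]: "\<psi> 0 = 0"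
  by (metis phi_0 psi_phi)

text \<open>For \<open>K \<ge> 0\<close> this is the maximum of \<open>\<bar>\<psi> x\<bar>\<close>
  over \<open>[-K,K]\<close>; both ends appear because \<open>\<psi>\<close> need not be
  odd.\<close>

definition slope :: "real \<Rightarrow> real" where
  "slope K = max (\<psi> K) (- \<psi> (- K))"

lemma slope_mono: "K \<le> K' \<Longrightarrow> slope K \<le> slope K'"
  unfolding slope_def by (intro max.mono) auto

lemma slope_nonneg: "0 \<le> K \<Longrightarrow> 0 \<le> slope K"
  using slope_mono[of 0 K] by (simp add: slope_def)

lemma abs_psi_le: "\<bar>x\<bar> \<le> K \<Longrightarrow> \<bar>\<psi> x\<bar> \<le> slope K"
  using psi_le_iff[of x K] psi_le_iff[of "-K" x] unfolding slope_def by linarith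

text \<open>At a time where the level \<^term>\<open>u t\<close> is crossed upwards (downwards), \<^term>\<open>F (u t)\<close> is
  at most (at least) the primitive of \<^term>\<open>h\<close>; comparing with time \<^term>\<open>t\<close> eliminates
  \<^term>\<open>F\<close> from the bound.\<close>
lemma weak_solution_deriv_bound:
  assumes "T > 0" and sol: "weak_solution T \<psi> F h u" and K: "integral {0..T} (\<lambda>t. \<bar>h t\<bar>) \<le> K"
  shows "\<exists>du. \<forall>t\<in>{0..T}. (u has_real_derivative du t) (at t within {0..T}) \<and> \<bar>du t\<bar> \<le> slope K"
proof -
  obtain k where k: "\<And>t. t \<in> {0..T} \<Longrightarrow>
      (u has_real_derivative \<psi> (k + integral {0..t} h - F (u t))) (at t within {0..T})"
    and h: "h absolutely_integrable_on {0..T}" "integral {0..T} h = 0" and per: "u 0 = u T"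
    using sol unfolding weak_solution_def by blast
  define y where "y = (\<lambda>t. k + integral {0..t} h - F (u t))"
  have "\<bar>\<psi> (y t)\<bar> \<le> slope K" if t: "t \<in> {0..T}" for t
  proof (rule abs_psi_le)
    have dpsi: "\<psi> (y 0) = \<psi> (y T)" using h(2) per by (simp add: y_def)
    obtain z where z: "z \<in> {0..T}" "u z = u t" "\<psi> (y z) \<ge> 0"
      using periodic_level_nonneg_deriv[OF \<open>T > 0\<close>, of u "\<lambda>t. \<psi> (y t)" t] k per dpsi t
      unfolding y_def by blast
    \<comment> \<open>Reflecting \<open>u\<close> turns upward crossings into downward ones.\<close>
    have "((\<lambda>t. - u t) has_real_derivative - \<psi> (y t)) (at t within {0..T})" if "t \<in> {0..T}" for t
      unfolding y_def by (rule DERIV_minus[OF k[OF that]])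
    then obtain w where w: "w \<in> {0..T}" "- u w = - u t" "- \<psi> (y w) \<ge> 0"
      using periodic_level_nonneg_deriv[OF \<open>T > 0\<close>, of "\<lambda>t. - u t" "\<lambda>t. - \<psi> (y t)" t] per dpsi t by auto
    have "y z \<ge> 0" "y w \<le> 0" using z(3) w(3) psi_le_iff[of 0 "y z"] psi_le_iff[of "y w" 0] by simp_all
    moreover have "y t - y z = integral {0..t} h - integral {0..z} h"
      "y t - y w = integral {0..t} h - integral {0..w} h"
      using z(2) w(2) by (simp_all add: y_def)
    ultimately show "\<bar>y t\<bar> \<le> K"
      using abs_integral_diff_le[OF h(1) z(1) t] abs_integral_diff_le[OF h(1) w(1) t] K by linarith
  qed
  with k show ?thesis
    unfolding y_def by (intro exI[of _ "\<lambda>t. \<psi> (k + integral {0..t} h - F (u t))"]) simp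
qed

lemma weak_solution_lipschitz:
  assumes "T > 0" and sol: "weak_solution T \<psi> F h u" and K: "integral {0..T} (\<lambda>t. \<bar>h t\<bar>) \<le> K"
    and "s \<in> {0..T}" "t \<in> {0..T}"
  shows "\<bar>u s - u t\<bar> \<le> slope K * \<bar>s - t\<bar>"
proof -
  obtain du where du: "\<And>t. t\<in>{0..T} \<Longrightarrow> (u has_real_derivative du t) (at t within {0..T})"
    "\<And>t. t\<in>{0..T} \<Longrightarrow> \<bar>du t\<bar> \<le> slope K"
    using weak_solution_deriv_bound[OF assms(1-3)] by metis
  have "norm (u s - u t) \<le> slope K * norm (s - t)"
    by (rule field_differentiable_bound[of "{0..T}" u du])
      (simp_all only: du real_norm_def convex_real_interval assms(4,5))
  then show ?thesis by simp
qed

end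

section \<open>The integral operator\<close>

context phi_homeo
begin

text \<open>The shift for which the primitive \<open>prim T p\<close> returns to 0 at
  \<open>T\<close>. For continuous \<open>p\<close> and \<open>T > 0\<close> it exists and is unique
  because the integral is continuous and strictly increasing in \<open>k\<close>.\<close>

definition kap :: "real \<Rightarrow> (real \<Rightarrow> real) \<Rightarrow> real" where
  "kap T p = (THE k. integral {0..T} (\<lambda>t. \<psi> (k + p t)) = 0)"

definition prim :: "real \<Rightarrow> (real \<Rightarrow> real) \<Rightarrow> real \<Rightarrow> real" where
  "prim T p t = integral {0..t} (\<lambda>\<tau>. \<psi> (kap T p + p \<tau>))"

lemma continuous_on_psi_shift:
  "continuous_on S p \<Longrightarrow> continuous_on S (\<lambda>t. \<psi> (k + p t))"
  by (intro continuous_on_compose2[OF continuous_psi] continuous_intros) auto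

lemma integral_psi_shift_less:
  fixes T :: real
  assumes "T > 0" "continuous_on {0..T} p" "continuous_on {0..T} p'"
    and "\<And>t. t \<in> {0..T} \<Longrightarrow> k + p t < k' + p' t"
  shows "integral {0..T} (\<lambda>t. \<psi> (k + p t)) < integral {0..T} (\<lambda>t. \<psi> (k' + p' t))"
  using assms by (intro integral_less_real continuous_on_psi_shift) auto

text \<open>At \<open>k = M\<close> and \<open>k = - M\<close> the integrand has constant sign, so
  the intermediate value theorem yields the zero together with its bound.\<close>

lemma kap_spec:
  assumes "T > 0" and p: "continuous_on {0..T} p" and M: "\<And>t. t \<in> {0..T} \<Longrightarrow> \<bar>p t\<bar> \<le> M"
  shows "integral {0..T} (\<lambda>t. \<psi> (kap T p + p t)) = 0" "\<bar>kap T p\<bar> \<le> M"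
proof -
  define I where "I = (\<lambda>k. integral {0..T} (\<lambda>t. \<psi> (k + p t)))"
  have int: "(\<lambda>t. \<psi> (k + p t)) integrable_on {0..T}" for k
    by (intro integrable_continuous_real continuous_on_psi_shift p)
  have "continuous_on UNIV I"
  proof -
    have "continuous_on (UNIV \<times> cbox 0 T) (\<lambda>(k, t). \<psi> (k + p t))"
      unfolding split_def
      by (intro continuous_on_compose2[OF continuous_psi] continuous_intros continuous_on_compose2[OF p]) auto
    then show ?thesis
      using integral_continuous_on_param[of UNIV 0 T "\<lambda>k t. \<psi> (k + p t)"] by (simp add: I_def)
  qed
  moreover have "M \<ge> 0" using M[of 0] \<open>T > 0\<close> by auto
  moreover have "I (-M) \<le> 0"
  proof -
    have "\<psi> (- M + p t) \<le> 0" if "t \<in> {0..T}" for t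
      using M[OF that] psi_le_iff[of "-M + p t" 0] by simp
    then have "I (-M) \<le> integral {0..T} (\<lambda>t. 0)"
      unfolding I_def by (intro integral_le int) auto
    then show ?thesis by simp
  qed
  moreover have "0 \<le> I M"
  proof -
    have "0 \<le> \<psi> (M + p t)" if "t \<in> {0..T}" for t
      using M[OF that] psi_le_iff[of 0 "M + p t"] by simp
    then have "integral {0..T} (\<lambda>t. 0) \<le> I M"
      unfolding I_def by (intro integral_le int) auto
    then show ?thesis by simp
  qed
  ultimately obtain k where k: "-M \<le> k" "k \<le> M" "I k = 0"
    using IVT'[of I "-M" 0 M] continuous_on_subset[of UNIV I "{-M..M}"] by auto
  have uniq: "k' = k" if "I k' = 0" for k'
  proof (rule ccontr)
    assume "k' \<noteq> k"
    then show False
      using integral_psi_shift_less[OF \<open>T > 0\<close> p p, of k k'] integral_psi_shift_less[OF \<open>T > 0\<close> p p, of k' k] that k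
      unfolding I_def by (cases "k < k'") auto
  qed
  have "kap T p = k"
    unfolding kap_def using k(3) uniq unfolding I_def by (rule the_equality)
  then show "integral {0..T} (\<lambda>t. \<psi> (kap T p + p t)) = 0" "\<bar>kap T p\<bar> \<le> M"
    using k unfolding I_def by simp_all
qed

lemma continuous_on_abs_bound:
  fixes p :: "real \<Rightarrow> real"
  assumes "continuous_on {0..T} p"
  obtains M where "\<And>t. t \<in> {0..T} \<Longrightarrow> \<bar>p t\<bar> \<le> M"
proof -
  have "bounded (p ` {0..T})"
    using assms by (intro compact_imp_bounded compact_continuous_image) auto
  then obtain M where "\<forall>x\<in>p ` {0..T}. norm x \<le> M" unfolding bounded_iff by blast
  then show thesis by (intro that[of M]) auto
qed

lemma kap_integral:
  assumes "T > 0" and p: "continuous_on {0..T} p"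
  shows "integral {0..T} (\<lambda>t. \<psi> (kap T p + p t)) = 0"
proof -
  obtain M where "\<And>t. t \<in> {0..T} \<Longrightarrow> \<bar>p t\<bar> \<le> M" using continuous_on_abs_bound[OF p] by blast
  then show ?thesis by (rule kap_spec(1)[OF assms])
qed

text \<open>If the constants differed by more than \<open>d\<close>, one of the two integrands would
  be strictly larger throughout, although both integrals vanish.\<close>

lemma kap_diff_le:
  assumes "T > 0" "continuous_on {0..T} p" "continuous_on {0..T} p'"
    and d: "\<And>t. t \<in> {0..T} \<Longrightarrow> \<bar>p t - p' t\<bar> \<le> d"
  shows "\<bar>kap T p - kap T p'\<bar> \<le> d"
proof (rule ccontr)
  assume "\<not> ?thesis"
  then consider "kap T p > kap T p' + d" | "kap T p' > kap T p + d" by linarith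
  then show False
  proof cases
    case 1
    have "kap T p' + p' t < kap T p + p t" if "t \<in> {0..T}" for t using d[OF that] 1 by linarith
    then show False
      using integral_psi_shift_less[OF assms(1,3,2), of "kap T p'" "kap T p"]
        kap_integral[OF assms(1,2)] kap_integral[OF assms(1,3)] by simp
  next
    case 2
    have "kap T p + p t < kap T p' + p' t" if "t \<in> {0..T}" for t using d[OF that] 2 by linarith
    then show False
      using integral_psi_shift_less[OF assms(1,2,3), of "kap T p" "kap T p'"]
        kap_integral[OF assms(1,2)] kap_integral[OF assms(1,3)] by simp
  qed
qed

lemma kap_unique:
  assumes "T > 0" "continuous_on {0..T} p" "integral {0..T} (\<lambda>t. \<psi> (k + p t)) = 0"
  shows "kap T p = k"
proof (rule ccontr)
  assume "kap T p \<noteq> k"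
  then show False
    using integral_psi_shift_less[OF assms(1,2,2), of k "kap T p"] integral_psi_shift_less[OF assms(1,2,2), of "kap T p" k]
      kap_integral[OF assms(1,2)] assms(3) by (cases "k < kap T p") auto
qed

lemma prim_0 [simp]: "prim T p 0 = 0"
  by (simp add: prim_def)

lemma prim_T:
  assumes "T > 0" "continuous_on {0..T} p"
  shows "prim T p T = 0"
  using kap_integral[OF assms] by (simp add: prim_def)

lemma prim_has_derivative:
  assumes "continuous_on {0..T} p" "t \<in> {0..T}"
  shows "(prim T p has_real_derivative \<psi> (kap T p + p t)) (at t within {0..T})"
  unfolding prim_def using assms by (intro integral_has_real_derivative continuous_on_psi_shift)

lemma prim_lipschitz:
  assumes "T > 0" "continuous_on {0..T} p" and M: "\<And>t. t \<in> {0..T} \<Longrightarrow> \<bar>p t\<bar> \<le> M"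
    and "s \<in> {0..T}" "t \<in> {0..T}"
  shows "\<bar>prim T p s - prim T p t\<bar> \<le> slope (2 * M) * \<bar>s - t\<bar>"
proof -
  have "norm (\<psi> (kap T p + p z)) \<le> slope (2 * M)" if "z \<in> {0..T}" for z
    using abs_psi_le[of "kap T p + p z" "2 * M"] kap_spec(2)[OF assms(1-3)] M[OF that] by simp
  then have "norm (prim T p s - prim T p t) \<le> slope (2 * M) * norm (s - t)"
    by (intro field_differentiable_bound[OF _ prim_has_derivative[OF assms(2)]]) (use assms(4,5) in simp_all)
  then show ?thesis by simp
qed

text \<open>Uniform continuity of \<open>\<psi>\<close> is guaranteed on bounded sets only, hence
  the common bound \<open>M\<close>. The arguments of \<open>\<psi>\<close> stay in
  \<open>[-2M,2M]\<close> because \<open>kap\<close> obeys the same bound as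
  \<open>p\<close>.\<close>

lemma prim_uniformly_continuous:
  assumes "T > 0" "\<epsilon> > 0"
  obtains \<delta> where "\<delta> > 0"
    "\<And>p p' t. \<lbrakk>continuous_on {0..T} p; continuous_on {0..T} p'; \<And>t. t \<in> {0..T} \<Longrightarrow> \<bar>p t\<bar> \<le> M;
       \<And>t. t \<in> {0..T} \<Longrightarrow> \<bar>p' t\<bar> \<le> M; \<And>t. t \<in> {0..T} \<Longrightarrow> \<bar>p t - p' t\<bar> \<le> \<delta>; t \<in> {0..T}\<rbrakk>
       \<Longrightarrow> \<bar>prim T p t - prim T p' t\<bar> \<le> \<epsilon>"
proof -
  have "uniformly_continuous_on {-(2*M)..2*M} \<psi>"
    by (intro compact_uniformly_continuous continuous_on_subset[OF continuous_psi]) auto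
  moreover have "\<epsilon> / T > 0" using assms by simp
  ultimately obtain d where "d > 0" and d: "\<And>x y. \<lbrakk>x \<in> {-(2*M)..2*M}; y \<in> {-(2*M)..2*M}; dist y x < d\<rbrakk>
      \<Longrightarrow> dist (\<psi> y) (\<psi> x) < \<epsilon> / T"
    unfolding uniformly_continuous_on_def by metis
  show thesis
  \<comment> \<open>\<open>p\<close> and \<open>kap\<close> each move by at most
    \<open>d / 3\<close>, together by less than \<open>d\<close>.\<close>
  proof (rule that[of "d / 3"])
    show "d / 3 > 0" using \<open>d > 0\<close> by simp
    fix p p' t
    assume p: "continuous_on {0..T} p" and p': "continuous_on {0..T} p'"
      and M: "\<And>t. t \<in> {0..T} \<Longrightarrow> \<bar>p t\<bar> \<le> M" and M': "\<And>t. t \<in> {0..T} \<Longrightarrow> \<bar>p' t\<bar> \<le> M"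
      and diff: "\<And>t. t \<in> {0..T} \<Longrightarrow> \<bar>p t - p' t\<bar> \<le> d / 3" and t: "t \<in> {0..T}"
    define g where "g = (\<lambda>\<tau>. \<psi> (kap T p + p \<tau>) - \<psi> (kap T p' + p' \<tau>))"
    have close: "\<bar>g \<tau>\<bar> \<le> \<epsilon> / T" if \<tau>: "\<tau> \<in> {0..T}" for \<tau>
    proof -
      have "\<bar>kap T p\<bar> \<le> M" "\<bar>kap T p'\<bar> \<le> M"
        using kap_spec(2)[OF \<open>T > 0\<close> p M] kap_spec(2)[OF \<open>T > 0\<close> p' M'] by blast+
      then have "kap T p + p \<tau> \<in> {-(2*M)..2*M}" "kap T p' + p' \<tau> \<in> {-(2*M)..2*M}"
        using M[OF \<tau>] M'[OF \<tau>] by auto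
      moreover have "dist (kap T p + p \<tau>) (kap T p' + p' \<tau>) < d"
        using kap_diff_le[OF \<open>T > 0\<close> p p' diff] diff[OF \<tau>] \<open>d > 0\<close> unfolding dist_real_def by linarith
      ultimately have "dist (\<psi> (kap T p + p \<tau>)) (\<psi> (kap T p' + p' \<tau>)) < \<epsilon> / T" using d by blast
      then show ?thesis by (simp add: g_def dist_real_def)
    qed
    have sub: "{0..t} \<subseteq> {0..T}" using t by auto
    have i: "(\<lambda>\<tau>. \<psi> (kap T p + p \<tau>)) integrable_on {0..t}" "(\<lambda>\<tau>. \<psi> (kap T p' + p' \<tau>)) integrable_on {0..t}"
      by (intro integrable_continuous_real continuous_on_psi_shift continuous_on_subset[OF _ sub] p p')+
    have "prim T p t - prim T p' t = integral {0..t} g"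
      unfolding prim_def g_def by (rule integral_diff[OF i, symmetric])
    also have "\<bar>\<dots>\<bar> \<le> integral {0..t} (\<lambda>_. \<epsilon> / T)"
      using integral_norm_bound_integral[of g "{0..t}" "\<lambda>_. \<epsilon> / T"] close sub integrable_diff[OF i] t
      unfolding g_def[symmetric] by auto
    also have "\<dots> = t * (\<epsilon> / T)" using t by simp
    also have "\<dots> \<le> T * (\<epsilon> / T)" using t assms by (intro mult_right_mono) auto
    also have "\<dots> = \<epsilon>" using \<open>T > 0\<close> by simp
    finally show "\<bar>prim T p t - prim T p' t\<bar> \<le> \<epsilon>" .
  qed
qed

lemma continuous_on_primitive:
  fixes h F u :: "real \<Rightarrow> real"
  assumes "h absolutely_integrable_on {0..T}" "continuous_on UNIV F" "continuous_on {0..T} u"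
  shows "continuous_on {0..T} (\<lambda>t. integral {0..t} h - F (u t))"
  by (intro continuous_on_diff indefinite_integral_continuous_1 set_lebesgue_integral_eq_integral(1)
      assms(1) continuous_on_compose2[OF assms(2) assms(3)]) auto

text \<open>Periodicity forces the constant of the weak form to be \<open>kap\<close>. The operator
  form contains no derivative of \<open>u\<close> and is therefore the one that passes to uniform
  limits.\<close>

lemma weak_solution_imp_prim:
  assumes "T > 0" and sol: "weak_solution T \<psi> F h u" and F: "continuous_on UNIV F" and t: "t \<in> {0..T}"
  shows "u t = u 0 + prim T (\<lambda>t. integral {0..t} h - F (u t)) t"
proof -
  define p where "p = (\<lambda>t. integral {0..t} h - F (u t))"
  have pc: "continuous_on {0..T} p"
    unfolding p_def using sol by (intro continuous_on_primitive F weak_solution_continuous[OF sol]) (simp add: weak_solution_def)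
  obtain k where "\<forall>t\<in>{0..T}. (u has_real_derivative \<psi> (k + integral {0..t} h - F (u t))) (at t within {0..T})"
    using sol unfolding weak_solution_def by blast
  then have k: "(u has_real_derivative \<psi> (k + p t)) (at t within {0..T})" if "t \<in> {0..T}" for t
    using that by (simp add: p_def algebra_simps)
  have int: "((\<lambda>\<tau>. \<psi> (k + p \<tau>)) has_integral (u t - u 0)) {0..t}" if "t \<in> {0..T}" for t
  proof (rule fundamental_theorem_of_calculus)
    show "0 \<le> t" using that by simp
    fix x assume x: "x \<in> {0..t}"
    then have "(u has_real_derivative \<psi> (k + p x)) (at x within {0..t})"
      using that by (intro DERIV_subset[OF k]) auto
    then show "(u has_vector_derivative \<psi> (k + p x)) (at x within {0..t})"
      by (simp add: has_real_derivative_iff_has_vector_derivative)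
  qed
  have "u T = u 0" using sol by (simp add: weak_solution_def)
  then have "integral {0..T} (\<lambda>\<tau>. \<psi> (k + p \<tau>)) = 0"
    using integral_unique[OF int[of T]] \<open>T > 0\<close> by simp
  then have "kap T p = k" by (rule kap_unique[OF \<open>T > 0\<close> pc])
  then show ?thesis
    using integral_unique[OF int[OF t]] unfolding p_def[symmetric] by (simp add: prim_def)
qed

lemma prim_imp_weak_solution:
  assumes "T > 0" and F: "continuous_on UNIV F" and h: "h absolutely_integrable_on {0..T}" "integral {0..T} h = 0"
    and u: "continuous_on {0..T} u"
    and eq: "\<And>t. t \<in> {0..T} \<Longrightarrow> u t = c + prim T (\<lambda>t. integral {0..t} h - F (u t)) t"
  shows "weak_solution T \<psi> F h u"
  unfolding weak_solution_def
proof (intro conjI exI ballI)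
  define p where "p = (\<lambda>t. integral {0..t} h - F (u t))"
  note eq = eq[folded p_def]
  have pc: "continuous_on {0..T} p" unfolding p_def by (intro continuous_on_primitive F u h)
  show "u 0 = u T" using eq[of 0] eq[of T] \<open>T > 0\<close> prim_T[OF \<open>T > 0\<close> pc] by simp
  fix t assume t: "t \<in> {0..T}"
  have "((\<lambda>t. c + prim T p t) has_real_derivative \<psi> (kap T p + p t)) (at t within {0..T})"
    using prim_has_derivative[OF pc t] by (auto intro!: derivative_eq_intros)
  then have "(u has_real_derivative \<psi> (kap T p + p t)) (at t within {0..T})"
    by (rule has_field_derivative_transform_within[of _ _ _ _ 1]) (use t eq in auto)
  then show "(u has_real_derivative \<psi> (kap T p + integral {0..t} h - F (u t))) (at t within {0..T})"
    by (simp add: p_def algebra_simps)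
qed (rule h)+

end

section \<open>Continuity of the operator of the forced equation\<close>

text \<open>Uniform continuity in the sup norm on all continuous functions at once. Scalar
  functionals are included as functions constant in \<open>t\<close>.\<close>

definition sup_continuous :: "real \<Rightarrow> ((real \<Rightarrow> real) \<Rightarrow> real \<Rightarrow> real) \<Rightarrow> bool" where
  "sup_continuous T \<Phi> \<longleftrightarrow> (\<forall>\<epsilon>>0. \<exists>\<delta>>0. \<forall>v w. continuous_on {0..T} v \<longrightarrow> continuous_on {0..T} w \<longrightarrow>
     (\<forall>t\<in>{0..T}. \<bar>v t - w t\<bar> \<le> \<delta>) \<longrightarrow> (\<forall>t\<in>{0..T}. \<bar>\<Phi> v t - \<Phi> w t\<bar> \<le> \<epsilon>))"

lemma sup_continuousI:
  assumes "\<And>\<epsilon>. \<epsilon> > 0 \<Longrightarrow> \<exists>\<delta>>0. \<forall>v w. continuous_on {0..T} v \<longrightarrow> continuous_on {0..T} w \<longrightarrow>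
     (\<forall>t\<in>{0..T}. \<bar>v t - w t\<bar> \<le> \<delta>) \<longrightarrow> (\<forall>t\<in>{0..T}. \<bar>\<Phi> v t - \<Phi> w t\<bar> \<le> \<epsilon>)"
  shows "sup_continuous T \<Phi>"
  unfolding sup_continuous_def by (intro allI impI[OF assms])

lemma sup_continuousE:
  assumes "sup_continuous T \<Phi>" "\<epsilon> > 0"
  obtains \<delta> where "\<delta> > 0" "\<And>v w t. \<lbrakk>continuous_on {0..T} v; continuous_on {0..T} w;
     \<And>t. t \<in> {0..T} \<Longrightarrow> \<bar>v t - w t\<bar> \<le> \<delta>; t \<in> {0..T}\<rbrakk> \<Longrightarrow> \<bar>\<Phi> v t - \<Phi> w t\<bar> \<le> \<epsilon>"
proof -
  obtain \<delta> where "\<delta> > 0" "\<forall>v w. continuous_on {0..T} v \<longrightarrow> continuous_on {0..T} w \<longrightarrow>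
     (\<forall>t\<in>{0..T}. \<bar>v t - w t\<bar> \<le> \<delta>) \<longrightarrow> (\<forall>t\<in>{0..T}. \<bar>\<Phi> v t - \<Phi> w t\<bar> \<le> \<epsilon>)"
    using assms(1)[unfolded sup_continuous_def, THEN spec, THEN mp, OF assms(2)]
    by (elim exE conjE) (rule that)
  then show thesis by (intro that[of \<delta>]) simp_all
qed

text \<open>The common source of the continuity proofs: it suffices that the variation of
  \<open>\<Psi>\<close> is controlled by the sup norm variation of some \<open>\<Phi>\<close>
  already treated.\<close>

lemma sup_continuous_lipschitz:
  assumes "sup_continuous T \<Phi>" "c > 0"
    and lip: "\<And>v w d t. \<lbrakk>continuous_on {0..T} v; continuous_on {0..T} w;
      \<And>t. t \<in> {0..T} \<Longrightarrow> \<bar>\<Phi> v t - \<Phi> w t\<bar> \<le> d; t \<in> {0..T}\<rbrakk> \<Longrightarrow> \<bar>\<Psi> v t - \<Psi> w t\<bar> \<le> c * d"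
  shows "sup_continuous T \<Psi>"
proof (rule sup_continuousI)
  fix \<epsilon> :: real assume "\<epsilon> > 0"
  then have "\<epsilon> / c > 0" using \<open>c > 0\<close> by simp
  then obtain \<delta> where "\<delta> > 0" and \<delta>: "\<And>v w t. \<lbrakk>continuous_on {0..T} v; continuous_on {0..T} w;
     \<And>t. t \<in> {0..T} \<Longrightarrow> \<bar>v t - w t\<bar> \<le> \<delta>; t \<in> {0..T}\<rbrakk> \<Longrightarrow> \<bar>\<Phi> v t - \<Phi> w t\<bar> \<le> \<epsilon> / c"
    by (rule sup_continuousE[OF assms(1)]) blast
  have "\<bar>\<Psi> v t - \<Psi> w t\<bar> \<le> \<epsilon>"
    if "continuous_on {0..T} v" "continuous_on {0..T} w" "\<forall>t\<in>{0..T}. \<bar>v t - w t\<bar> \<le> \<delta>" "t \<in> {0..T}" for v w t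
    using lip[OF that(1,2) \<delta>[OF that(1,2)] that(4)] that(3) \<open>c > 0\<close> by simp
  then show "\<exists>\<delta>>0. \<forall>v w. continuous_on {0..T} v \<longrightarrow> continuous_on {0..T} w \<longrightarrow>
     (\<forall>t\<in>{0..T}. \<bar>v t - w t\<bar> \<le> \<delta>) \<longrightarrow> (\<forall>t\<in>{0..T}. \<bar>\<Psi> v t - \<Psi> w t\<bar> \<le> \<epsilon>)"
    using \<open>\<delta> > 0\<close> by blast
qed

lemma sup_continuous_add:
  assumes "sup_continuous T \<Phi>" "sup_continuous T \<Psi>"
  shows "sup_continuous T (\<lambda>v t. \<Phi> v t + \<Psi> v t)"
proof (rule sup_continuousI)
  fix \<epsilon> :: real assume "\<epsilon> > 0"
  then have "\<epsilon>/2 > 0" by simp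
  obtain d1 where d1: "d1 > 0" "\<And>v w t. \<lbrakk>continuous_on {0..T} v; continuous_on {0..T} w;
     \<And>t. t \<in> {0..T} \<Longrightarrow> \<bar>v t - w t\<bar> \<le> d1; t \<in> {0..T}\<rbrakk> \<Longrightarrow> \<bar>\<Phi> v t - \<Phi> w t\<bar> \<le> \<epsilon>/2"
    by (rule sup_continuousE[OF assms(1) \<open>\<epsilon>/2 > 0\<close>]) blast
  obtain d2 where d2: "d2 > 0" "\<And>v w t. \<lbrakk>continuous_on {0..T} v; continuous_on {0..T} w;
     \<And>t. t \<in> {0..T} \<Longrightarrow> \<bar>v t - w t\<bar> \<le> d2; t \<in> {0..T}\<rbrakk> \<Longrightarrow> \<bar>\<Psi> v t - \<Psi> w t\<bar> \<le> \<epsilon>/2"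
    by (rule sup_continuousE[OF assms(2) \<open>\<epsilon>/2 > 0\<close>]) blast
  have "\<bar>(\<Phi> v t + \<Psi> v t) - (\<Phi> w t + \<Psi> w t)\<bar> \<le> \<epsilon>"
    if "continuous_on {0..T} v" "continuous_on {0..T} w" "\<forall>t\<in>{0..T}. \<bar>v t - w t\<bar> \<le> min d1 d2" "t \<in> {0..T}" for v w t
  proof -
    have "\<bar>\<Phi> v t - \<Phi> w t\<bar> \<le> \<epsilon>/2" by (rule d1(2)[OF that(1,2) _ that(4)]) (use that(3) in auto)
    moreover have "\<bar>\<Psi> v t - \<Psi> w t\<bar> \<le> \<epsilon>/2" by (rule d2(2)[OF that(1,2) _ that(4)]) (use that(3) in auto)
    ultimately show ?thesis by linarith
  qed
  then show "\<exists>\<delta>>0. \<forall>v w. continuous_on {0..T} v \<longrightarrow> continuous_on {0..T} w \<longrightarrow>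
     (\<forall>t\<in>{0..T}. \<bar>v t - w t\<bar> \<le> \<delta>) \<longrightarrow> (\<forall>t\<in>{0..T}. \<bar>(\<Phi> v t + \<Psi> v t) - (\<Phi> w t + \<Psi> w t)\<bar> \<le> \<epsilon>)"
    using d1(1) d2(1) by (intro exI[of _ "min d1 d2"]) auto
qed

lemma sup_continuous_comp:
  assumes "uniformly_continuous_on UNIV (q :: real \<Rightarrow> real)"
  shows "sup_continuous T (\<lambda>v t. q (v t))"
proof (rule sup_continuousI)
  fix \<epsilon> :: real assume "\<epsilon> > 0"
  then obtain d where "d > 0" and d: "\<And>x y. dist y x < d \<Longrightarrow> dist (q y) (q x) < \<epsilon>"
    using assms unfolding uniformly_continuous_on_def by (metis UNIV_I)
  have "\<bar>q (v t) - q (w t)\<bar> \<le> \<epsilon>" if "\<bar>v t - w t\<bar> \<le> d/2" for v w :: "real \<Rightarrow> real" and t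
    using d[of "v t" "w t"] that \<open>d > 0\<close> by (simp add: dist_real_def)
  then show "\<exists>\<delta>>0. \<forall>v w. continuous_on {0..T} v \<longrightarrow> continuous_on {0..T} w \<longrightarrow>
     (\<forall>t\<in>{0..T}. \<bar>v t - w t\<bar> \<le> \<delta>) \<longrightarrow> (\<forall>t\<in>{0..T}. \<bar>q (v t) - q (w t)\<bar> \<le> \<epsilon>)"
    using \<open>d > 0\<close> by (intro exI[of _ "d/2"]) auto
qed

text \<open>The bounds on \<open>a\<close> and \<open>e\<close> hold at every time, so that no
  exceptional sets have to be carried along; suitable representatives are substituted in the final
  theorem.\<close>

locale forced_lienard = phi_homeo +
  fixes T :: real and a e :: "real \<Rightarrow> real" and A B :: real
  assumes T_pos: "T > 0"
    and a_meas: "a \<in> borel_measurable lebesgue" and e_meas: "e \<in> borel_measurable lebesgue"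
    and a_nonneg: "0 \<le> a t" and a_le: "a t \<le> A" and e_le: "\<bar>e t\<bar> \<le> B"
    and a_integral: "integral {0..T} a = T" and e_integral: "integral {0..T} e = 0"
begin

definition rhs :: "real \<Rightarrow> (real \<Rightarrow> real) \<Rightarrow> real \<Rightarrow> real" where
  "rhs s g t = s + e t - a t * g t"

text \<open>Average with respect to the probability density \<open>a / T\<close>. For continuous
  \<open>g\<close> it is the only level \<open>s\<close> at which \<open>rhs s g\<close> has
  integral 0.\<close>

definition mean :: "(real \<Rightarrow> real) \<Rightarrow> real" where
  "mean g = integral {0..T} (\<lambda>t. a t * g t) / T"

lemma times_a_absolutely_integrable:
  assumes "continuous_on {0..T} g"
  shows "(\<lambda>t. a t * g t) absolutely_integrable_on {0..T}"
proof -
  obtain M where M: "\<And>t. t \<in> {0..T} \<Longrightarrow> \<bar>g t\<bar> \<le> M" using continuous_on_abs_bound[OF assms] by blast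
  have A: "\<bar>a t\<bar> \<le> A" for t using a_nonneg[of t] a_le[of t] by simp
  show ?thesis
  proof (rule measurable_bounded_by_integrable_imp_absolutely_integrable[where g = "\<lambda>_. A * M"])
    show "(\<lambda>t. a t * g t) \<in> borel_measurable (lebesgue_on {0..T})"
      by (intro borel_measurable_times measurable_restrict_space1[OF a_meas]
          continuous_imp_measurable_on_sets_lebesgue[OF assms]) auto
    show "norm (a t * g t) \<le> A * M" if "t \<in> {0..T}" for t
      unfolding real_norm_def abs_mult by (rule mult_mono) (use A[of t] M[OF that] in auto)
  qed auto
qed

lemma a_absolutely_integrable: "a absolutely_integrable_on {0..T}"
  using times_a_absolutely_integrable[of "\<lambda>_. 1"] by simp

lemma e_absolutely_integrable: "e absolutely_integrable_on {0..T}"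
proof (rule measurable_bounded_by_integrable_imp_absolutely_integrable[where g = "\<lambda>_. B"])
  show "e \<in> borel_measurable (lebesgue_on {0..T})" by (rule measurable_restrict_space1[OF e_meas])
qed (use e_le in auto)

lemma const_absolutely_integrable: "(\<lambda>_. c :: real) absolutely_integrable_on {0..T}"
  by (rule absolutely_integrable_continuous_real) simp

lemma rhs_absolutely_integrable:
  assumes "continuous_on {0..T} g"
  shows "rhs s g absolutely_integrable_on {0..T}"
  unfolding rhs_def [abs_def]
  by (intro set_integral_diff(1) set_integral_add(1) const_absolutely_integrable e_absolutely_integrable
      times_a_absolutely_integrable assms)

lemma has_integral_rhs:
  assumes "continuous_on {0..T} g"
  shows "(rhs s g has_integral (s * T - mean g * T)) {0..T}"
proof -
  have "(rhs s g has_integral (integral {0..T} (\<lambda>_. s) + integral {0..T} e - integral {0..T} (\<lambda>t. a t * g t))) {0..T}"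
    unfolding rhs_def [abs_def]
    by (intro has_integral_diff has_integral_add integrable_integral set_lebesgue_integral_eq_integral(1)
        const_absolutely_integrable e_absolutely_integrable times_a_absolutely_integrable assms)
  then show ?thesis using e_integral T_pos by (simp add: mean_def mult.commute)
qed

lemma integral_rhs_eq_0_iff:
  assumes "continuous_on {0..T} g"
  shows "integral {0..T} (rhs s g) = 0 \<longleftrightarrow> s = mean g"
  using integral_unique[OF has_integral_rhs[OF assms, of s]] T_pos by auto

lemma mean_mono:
  assumes "continuous_on {0..T} g" "continuous_on {0..T} h" "\<And>t. t \<in> {0..T} \<Longrightarrow> g t \<le> h t"
  shows "mean g \<le> mean h"
proof -
  have "integral {0..T} (\<lambda>t. a t * g t) \<le> integral {0..T} (\<lambda>t. a t * h t)"
    by (intro integral_le set_lebesgue_integral_eq_integral(1) times_a_absolutely_integrable assms mult_left_mono a_nonneg)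
  then show ?thesis using T_pos by (simp add: mean_def divide_right_mono)
qed

lemma mean_add_const:
  assumes "continuous_on {0..T} g"
  shows "mean (\<lambda>t. g t + c) = mean g + c"
proof -
  have "((\<lambda>t. a t * g t + a t * c) has_integral (integral {0..T} (\<lambda>t. a t * g t) + integral {0..T} a * c)) {0..T}"
    by (intro has_integral_add has_integral_mult_left integrable_integral set_lebesgue_integral_eq_integral(1)
        times_a_absolutely_integrable a_absolutely_integrable assms)
  then have "integral {0..T} (\<lambda>t. a t * (g t + c)) = integral {0..T} (\<lambda>t. a t * g t) + T * c"
    using a_integral by (simp add: integral_unique distrib_left)
  then show ?thesis using T_pos by (simp add: mean_def add_divide_distrib)
qed

lemma mean_const [simp]: "mean (\<lambda>_. c) = c"
  using mean_add_const[of "\<lambda>_. 0" c] by (simp add: mean_def)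

lemma mean_diff_le:
  assumes "continuous_on {0..T} g" "continuous_on {0..T} h" "\<And>t. t \<in> {0..T} \<Longrightarrow> \<bar>g t - h t\<bar> \<le> d"
  shows "\<bar>mean g - mean h\<bar> \<le> d"
proof -
  have "mean g \<le> mean (\<lambda>t. h t + d)" "mean h \<le> mean (\<lambda>t. g t + d)"
    using assms(3) by (intro mean_mono continuous_intros assms(1,2); force simp: abs_le_iff)+
  then show ?thesis using mean_add_const assms(1,2) by simp
qed

text \<open>A one-sided bound on \<open>g\<close> is enough: \<open>g t \<ge> - m\<close> gives
  \<open>\<bar>g t\<bar> \<le> g t + 2 * m\<close>, and the integral of \<open>a t * g t\<close> is
  known to be \<open>s * T\<close>. With \<open>g\<close> the composition of \<open>q\<close> and
  \<open>u\<close>, the estimate is thus unaffected by truncating \<open>q\<close>.\<close>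

lemma integral_abs_rhs_le:
  assumes g: "continuous_on {0..T} g" and m: "\<And>t. t \<in> {0..T} \<Longrightarrow> - m \<le> g t" and "0 \<le> m"
    and 0: "integral {0..T} (rhs s g) = 0"
  shows "integral {0..T} (\<lambda>t. \<bar>rhs s g t\<bar>) \<le> T * (B + 2 * \<bar>s\<bar> + 2 * m)"
proof -
  have i: "((\<lambda>t. a t * g t) has_integral mean g * T) {0..T}" "(a has_integral T) {0..T}"
    using integrable_integral[OF set_lebesgue_integral_eq_integral(1)[OF times_a_absolutely_integrable[OF g]]]
      integrable_integral[OF set_lebesgue_integral_eq_integral(1)[OF a_absolutely_integrable]] T_pos a_integral
    by (simp_all add: mean_def)
  have "((\<lambda>t. (\<bar>s\<bar> + B) + (a t * g t + 2 * m * a t)) has_integral ((\<bar>s\<bar> + B) * T + (mean g * T + 2 * m * T))) {0..T}"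
    using has_integral_const_real[of "\<bar>s\<bar> + B" 0 T] T_pos
    by (intro has_integral_add has_integral_mult_right i) (simp add: mult.commute)
  moreover have "(\<lambda>t. \<bar>rhs s g t\<bar>) integrable_on {0..T}"
    using rhs_absolutely_integrable[OF g, of s] by (simp add: absolutely_integrable_on_def)
  moreover have "\<bar>rhs s g t\<bar> \<le> (\<bar>s\<bar> + B) + (a t * g t + 2 * m * a t)" if "t \<in> {0..T}" for t
  proof -
    have "\<bar>a t * g t\<bar> = a t * \<bar>g t\<bar>" using a_nonneg by (simp add: abs_mult)
    also have "\<dots> \<le> a t * (g t + 2 * m)" using m[OF that] \<open>0 \<le> m\<close> by (intro mult_left_mono a_nonneg) auto
    finally show ?thesis using e_le[of t] by (simp add: rhs_def algebra_simps)
  qed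
  ultimately have "integral {0..T} (\<lambda>t. \<bar>rhs s g t\<bar>) \<le> (\<bar>s\<bar> + B) * T + (mean g * T + 2 * m * T)"
    using has_integral_le[OF integrable_integral] by blast
  also have "mean g = s" using integral_rhs_eq_0_iff[OF g] 0 by simp
  also have "(\<bar>s\<bar> + B) * T + (s * T + 2 * m * T) = T * (B + \<bar>s\<bar> + s + 2 * m)"
    by (simp add: algebra_simps)
  also have "\<dots> \<le> T * (B + 2 * \<bar>s\<bar> + 2 * m)" using T_pos by (intro mult_left_mono) auto
  finally show ?thesis .
qed

text \<open>The argument of \<open>\<psi>\<close> up to its constant, with the level computed from
  \<open>v\<close>. For continuous \<open>q\<close> and \<open>v\<close> the integral term vanishes
  at \<open>T\<close>, whether or not \<open>v\<close> is a solution.\<close>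

definition pot :: "(real \<Rightarrow> real) \<Rightarrow> (real \<Rightarrow> real) \<Rightarrow> (real \<Rightarrow> real) \<Rightarrow> real \<Rightarrow> real" where
  "pot F q v t = integral {0..t} (rhs (mean (\<lambda>t. q (v t))) (\<lambda>t. q (v t))) - F (v t)"

lemma continuous_on_pot:
  assumes "continuous_on UNIV F" "continuous_on UNIV q" "continuous_on {0..T} v"
  shows "continuous_on {0..T} (pot F q v)"
proof -
  have "continuous_on {0..T} (\<lambda>t. q (v t))"
    using assms(2,3) by (rule continuous_on_compose2) auto
  then show ?thesis
    unfolding pot_def [abs_def] by (intro continuous_on_primitive rhs_absolutely_integrable assms)
qed

lemma abs_pot_le:
  assumes "continuous_on UNIV q" "continuous_on {0..T} v" and q: "\<And>x. \<bar>q x\<bar> \<le> Q" and F: "\<And>x. \<bar>F x\<bar> \<le> \<Phi>"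
    and t: "t \<in> {0..T}"
  shows "\<bar>pot F q v t\<bar> \<le> T * (B + 4 * Q) + \<Phi>"
proof -
  define g where "g = (\<lambda>t. q (v t))"
  have g: "continuous_on {0..T} g"
    unfolding g_def using assms(1,2) by (rule continuous_on_compose2) auto
  have "0 \<le> Q" using q[of 0] by linarith
  have 0: "integral {0..T} (rhs (mean g) g) = 0" using integral_rhs_eq_0_iff[OF g] by simp
  have "\<bar>mean g - mean (\<lambda>_. 0)\<bar> \<le> Q" by (rule mean_diff_le[OF g]) (use q in \<open>auto simp: g_def\<close>)
  then have "\<bar>mean g\<bar> \<le> Q" by simp
  have lb: "- Q \<le> g t" for t using q[of "v t"] unfolding g_def by linarith
  have "\<bar>integral {0..t} (rhs (mean g) g)\<bar> \<le> integral {0..T} (\<lambda>t. \<bar>rhs (mean g) g t\<bar>)"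
    using abs_integral_diff_le[OF rhs_absolutely_integrable[OF g], of 0 t "mean g"] t by simp
  also have "\<dots> \<le> T * (B + 2 * \<bar>mean g\<bar> + 2 * Q)"
    by (rule integral_abs_rhs_le[OF g lb \<open>0 \<le> Q\<close> 0])
  also have "\<dots> \<le> T * (B + 4 * Q)" using \<open>\<bar>mean g\<bar> \<le> Q\<close> T_pos by (intro mult_left_mono) auto
  finally show ?thesis using F[of "v t"] unfolding pot_def g_def by linarith
qed

lemma sup_continuous_mean:
  assumes "uniformly_continuous_on UNIV q"
  shows "sup_continuous T (\<lambda>v t. mean (\<lambda>t. q (v t)))"
proof (rule sup_continuous_lipschitz[OF sup_continuous_comp[OF assms], of 1])
  fix v w :: "real \<Rightarrow> real" and d t assume v: "continuous_on {0..T} v" and w: "continuous_on {0..T} w"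
    and d: "\<And>t. t \<in> {0..T} \<Longrightarrow> \<bar>q (v t) - q (w t)\<bar> \<le> d"
  note q = uniformly_continuous_imp_continuous[OF assms]
  show "\<bar>mean (\<lambda>t. q (v t)) - mean (\<lambda>t. q (w t))\<bar> \<le> 1 * d"
    using mean_diff_le[OF continuous_on_compose2[OF q v] continuous_on_compose2[OF q w] d] by simp
qed simp

lemma sup_continuous_pot:
  assumes F: "uniformly_continuous_on UNIV F" and q: "uniformly_continuous_on UNIV q"
  shows "sup_continuous T (pot F q)"
proof -
  note qc = uniformly_continuous_imp_continuous[OF q]
  \<comment> \<open>A change of \<open>q (v t)\<close> by \<open>d\<close> changes the forcing by at
    most \<open>d\<close> through the level and by at most \<open>a t * d\<close> through the
    restoring term. Each contributes \<open>T * d\<close> to the integral, hence the constant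
    \<open>2 * T\<close>.\<close>
  have "sup_continuous T (\<lambda>v t. integral {0..t} (rhs (mean (\<lambda>t. q (v t))) (\<lambda>t. q (v t))))"
  proof (rule sup_continuous_lipschitz[OF sup_continuous_comp[OF q], of "2 * T"])
    fix v w :: "real \<Rightarrow> real" and d t assume v: "continuous_on {0..T} v" and w: "continuous_on {0..T} w"
      and d: "\<And>t. t \<in> {0..T} \<Longrightarrow> \<bar>q (v t) - q (w t)\<bar> \<le> d" and t: "t \<in> {0..T}"
    define g where "g = (\<lambda>t. q (v t))"
    define h where "h = (\<lambda>t. q (w t))"
    have g: "continuous_on {0..T} g" and h: "continuous_on {0..T} h"
      unfolding g_def h_def by (rule continuous_on_compose2[OF qc], use v w in auto)+
    have gh: "\<bar>g t - h t\<bar> \<le> d" if "t \<in> {0..T}" for t using d[OF that] by (simp add: g_def h_def)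
    define D where "D = (\<lambda>t. rhs (mean g) g t - rhs (mean h) h t)"
    have D: "D absolutely_integrable_on {0..T}"
      unfolding D_def by (intro set_integral_diff(1) rhs_absolutely_integrable g h)
    have sub: "{0..t} \<subseteq> {0..T}" using t by auto
    have ii: "rhs (mean g) g integrable_on {0..t}" "rhs (mean h) h integrable_on {0..t}"
      by (rule integrable_on_subinterval[OF set_lebesgue_integral_eq_integral(1)[OF rhs_absolutely_integrable] sub], rule g h)+
    have "integral {0..t} (rhs (mean g) g) - integral {0..t} (rhs (mean h) h) = integral {0..t} D - integral {0..0} D"
      unfolding D_def by (simp add: integral_diff[OF ii])
    also have "\<bar>\<dots>\<bar> \<le> integral {0..T} (\<lambda>t. \<bar>D t\<bar>)"
      by (rule abs_integral_diff_le[OF D]) (use t in auto)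
    also have "\<dots> \<le> 2 * T * d"
    proof -
      have "((\<lambda>t. d + a t * d) has_integral (d * T + T * d)) {0..T}"
        using has_integral_const_real[of d 0 T] T_pos
          has_integral_mult_left[OF integrable_integral[OF set_lebesgue_integral_eq_integral(1)[OF a_absolutely_integrable]], of d] a_integral
        by (intro has_integral_add) (simp_all add: mult.commute)
      moreover have "(\<lambda>t. \<bar>D t\<bar>) integrable_on {0..T}" using D by (simp add: absolutely_integrable_on_def)
      moreover have "\<bar>D t\<bar> \<le> d + a t * d" if "t \<in> {0..T}" for t
      proof -
        have "\<bar>a t * g t - a t * h t\<bar> = a t * \<bar>g t - h t\<bar>"
          using a_nonneg[of t] by (simp add: abs_mult flip: right_diff_distrib)
        also have "\<dots> \<le> a t * d" using gh[OF that] by (intro mult_left_mono a_nonneg)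
        finally show ?thesis using mean_diff_le[OF g h gh] unfolding D_def rhs_def by linarith
      qed
      ultimately have "integral {0..T} (\<lambda>t. \<bar>D t\<bar>) \<le> d * T + T * d"
        using has_integral_le[OF integrable_integral] by blast
      then show ?thesis by (simp add: algebra_simps)
    qed
    finally show "\<bar>integral {0..t} (rhs (mean (\<lambda>t. q (v t))) (\<lambda>t. q (v t))) -
      integral {0..t} (rhs (mean (\<lambda>t. q (w t))) (\<lambda>t. q (w t)))\<bar> \<le> 2 * T * d"
      unfolding g_def h_def .
  qed (use T_pos in simp)
  moreover have "sup_continuous T (\<lambda>v t. - F (v t))"
    by (rule sup_continuous_lipschitz[OF sup_continuous_comp[OF F], of 1]) (auto simp: abs_minus_commute)
  ultimately show ?thesis
    unfolding pot_def [abs_def] by (drule_tac sup_continuous_add) simp_all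
qed

end

section \<open>Solutions with prescribed level\<close>

definition max_diff :: "real \<Rightarrow> (real \<Rightarrow> real) \<Rightarrow> (real \<Rightarrow> real) \<Rightarrow> real" where
  "max_diff T b v = (SUP t\<in>{0..T}. v t - b t)"

lemma max_diff_props:
  assumes "T > 0" "continuous_on {0..T} b" "continuous_on {0..T} v"
  shows "t \<in> {0..T} \<Longrightarrow> v t - b t \<le> max_diff T b v"
    and "\<exists>t\<in>{0..T}. max_diff T b v = v t - b t"
proof -
  have "continuous_on {0..T} (\<lambda>t. v t - b t)" using assms by (intro continuous_intros)
  then obtain x where x: "x \<in> {0..T}" "\<forall>y\<in>{0..T}. v y - b y \<le> v x - b x"
    using continuous_attains_sup[of "{0..T}" "\<lambda>t. v t - b t"] \<open>T > 0\<close> by auto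
  have "max_diff T b v = v x - b x"
    unfolding max_diff_def by (rule cSup_eq_maximum) (use x in auto)
  then show "t \<in> {0..T} \<Longrightarrow> v t - b t \<le> max_diff T b v" "\<exists>t\<in>{0..T}. max_diff T b v = v t - b t"
    using x by auto
qed

lemma max_diff_add_const:
  assumes "T > 0" "continuous_on {0..T} b" "continuous_on {0..T} v" "continuous_on {0..T} w"
    and eq: "\<And>t. t \<in> {0..T} \<Longrightarrow> v t = c + w t"
  shows "max_diff T b v = c + max_diff T b w"
proof (rule antisym)
  obtain x where x: "x \<in> {0..T}" "max_diff T b v = v x - b x" using max_diff_props(2)[OF assms(1-3)] by blast
  then show "max_diff T b v \<le> c + max_diff T b w"
    using max_diff_props(1)[OF assms(1,2,4) x(1)] eq[OF x(1)] by linarith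
  obtain y where y: "y \<in> {0..T}" "max_diff T b w = w y - b y" using max_diff_props(2)[OF assms(1,2,4)] by blast
  then show "c + max_diff T b w \<le> max_diff T b v"
    using max_diff_props(1)[OF assms(1-3) y(1)] eq[OF y(1)] by linarith
qed

lemma max_diff_diff_le:
  assumes "T > 0" "continuous_on {0..T} b" "continuous_on {0..T} v" "continuous_on {0..T} w"
    and d: "\<And>t. t \<in> {0..T} \<Longrightarrow> \<bar>v t - w t\<bar> \<le> d"
  shows "\<bar>max_diff T b v - max_diff T b w\<bar> \<le> d"
proof -
  obtain x where x: "x \<in> {0..T}" "max_diff T b v = v x - b x" using max_diff_props(2)[OF assms(1-3)] by blast
  obtain y where y: "y \<in> {0..T}" "max_diff T b w = w y - b y" using max_diff_props(2)[OF assms(1,2,4)] by blast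
  show ?thesis
    using max_diff_props(1)[OF assms(1,2,4) x(1)] max_diff_props(1)[OF assms(1-3) y(1)] x y d[OF x(1)] d[OF y(1)]
    by linarith
qed

lemma sup_continuous_max_diff:
  assumes "T > 0" "continuous_on {0..T} b" and \<Phi>: "sup_continuous T \<Phi>"
    and cont: "\<And>v. continuous_on {0..T} v \<Longrightarrow> continuous_on {0..T} (\<Phi> v)"
  shows "sup_continuous T (\<lambda>v t. max_diff T b (\<Phi> v))"
proof (rule sup_continuous_lipschitz[OF \<Phi>, of 1])
  show "\<bar>max_diff T b (\<Phi> v) - max_diff T b (\<Phi> w)\<bar> \<le> 1 * d"
    if "continuous_on {0..T} v" "continuous_on {0..T} w" "\<And>t. t \<in> {0..T} \<Longrightarrow> \<bar>\<Phi> v t - \<Phi> w t\<bar> \<le> d" for v w d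
    using max_diff_diff_le[OF assms(1,2) cont[OF that(1)] cont[OF that(2)] that(3)] by simp
qed simp

context forced_lienard
begin

lemma continuous_on_prim: "continuous_on {0..T} p \<Longrightarrow> continuous_on {0..T} (prim T p)"
  by (rule DERIV_continuous_on[OF prim_has_derivative])

lemma sup_continuous_prim_pot:
  assumes F: "uniformly_continuous_on UNIV F" and q: "uniformly_continuous_on UNIV q"
    and "\<And>x. \<bar>F x\<bar> \<le> \<Phi>" "\<And>x. \<bar>q x\<bar> \<le> Q"
  shows "sup_continuous T (\<lambda>v. prim T (pot F q v))"
proof (rule sup_continuousI)
  fix \<epsilon> :: real assume "\<epsilon> > 0"
  define M where "M = T * (B + 4 * Q) + \<Phi>"
  note Fc = uniformly_continuous_imp_continuous[OF F] and qc = uniformly_continuous_imp_continuous[OF q]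
  obtain d where "d > 0" and d: "\<And>p p' t. \<lbrakk>continuous_on {0..T} p; continuous_on {0..T} p'; \<And>t. t \<in> {0..T} \<Longrightarrow> \<bar>p t\<bar> \<le> M;
       \<And>t. t \<in> {0..T} \<Longrightarrow> \<bar>p' t\<bar> \<le> M; \<And>t. t \<in> {0..T} \<Longrightarrow> \<bar>p t - p' t\<bar> \<le> d; t \<in> {0..T}\<rbrakk>
       \<Longrightarrow> \<bar>prim T p t - prim T p' t\<bar> \<le> \<epsilon>"
    by (rule prim_uniformly_continuous[OF T_pos \<open>\<epsilon> > 0\<close>, of M]) blast
  obtain \<delta> where "\<delta> > 0" and \<delta>: "\<And>v w t. \<lbrakk>continuous_on {0..T} v; continuous_on {0..T} w;
     \<And>t. t \<in> {0..T} \<Longrightarrow> \<bar>v t - w t\<bar> \<le> \<delta>; t \<in> {0..T}\<rbrakk> \<Longrightarrow> \<bar>pot F q v t - pot F q w t\<bar> \<le> d"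
    by (rule sup_continuousE[OF sup_continuous_pot[OF F q] \<open>d > 0\<close>]) blast
  have M: "\<bar>pot F q v t\<bar> \<le> M" if "continuous_on {0..T} v" "t \<in> {0..T}" for v t
    unfolding M_def by (rule abs_pot_le[OF qc that(1) assms(4,3) that(2)])
  have "\<bar>prim T (pot F q v) t - prim T (pot F q w) t\<bar> \<le> \<epsilon>"
    if v: "continuous_on {0..T} v" and w: "continuous_on {0..T} w"
      and "\<forall>t\<in>{0..T}. \<bar>v t - w t\<bar> \<le> \<delta>" "t \<in> {0..T}" for v w t
  proof (rule d[OF continuous_on_pot[OF Fc qc v] continuous_on_pot[OF Fc qc w] M[OF v] M[OF w] _ that(4)])
    show "\<bar>pot F q v t - pot F q w t\<bar> \<le> d" if "t \<in> {0..T}" for t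
      by (rule \<delta>[OF v w _ that]) (use \<open>\<forall>t\<in>{0..T}. \<bar>v t - w t\<bar> \<le> \<delta>\<close> in blast)
  qed
  then show "\<exists>\<delta>>0. \<forall>v w. continuous_on {0..T} v \<longrightarrow> continuous_on {0..T} w \<longrightarrow>
     (\<forall>t\<in>{0..T}. \<bar>v t - w t\<bar> \<le> \<delta>) \<longrightarrow> (\<forall>t\<in>{0..T}. \<bar>prim T (pot F q v) t - prim T (pot F q w) t\<bar> \<le> \<epsilon>)"
    using \<open>\<delta> > 0\<close> by (intro exI[of _ \<delta>]) simp
qed

lemma prim_pot_lipschitz:
  assumes F: "continuous_on UNIV F" and q: "continuous_on UNIV q"
    and "\<And>x. \<bar>F x\<bar> \<le> \<Phi>" "\<And>x. \<bar>q x\<bar> \<le> Q" and v: "continuous_on {0..T} v" and "s \<in> {0..T}" "t \<in> {0..T}"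
  shows "\<bar>prim T (pot F q v) s - prim T (pot F q v) t\<bar> \<le> slope (2 * (T * (B + 4 * Q) + \<Phi>)) * \<bar>s - t\<bar>"
  by (rule prim_lipschitz[OF T_pos continuous_on_pot[OF F q v] abs_pot_le[OF q v assms(4,3)] assms(6,7)])

text \<open>The free additive constant is handed to an arbitrary bounded functional
  \<open>C\<close>, through which side conditions on the solution can be imposed.\<close>

lemma exists_prim_fixed_point:
  assumes F: "uniformly_continuous_on UNIV F" and q: "uniformly_continuous_on UNIV q"
    and Fb: "\<And>x. \<bar>F x\<bar> \<le> \<Phi>" and qb: "\<And>x. \<bar>q x\<bar> \<le> Q"
    and C: "sup_continuous T (\<lambda>v t. C v)" and Cb: "\<And>v. continuous_on {0..T} v \<Longrightarrow> \<bar>C v\<bar> \<le> c"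
  obtains u where "continuous_on {0..T} u" "\<And>t. t \<in> {0..T} \<Longrightarrow> u t = C u + prim T (pot F q u) t"
proof -
  note Fc = uniformly_continuous_imp_continuous[OF F] and qc = uniformly_continuous_imp_continuous[OF q]
  define M where "M = T * (B + 4 * Q) + \<Phi>"
  define L where "L = slope (2 * M)"
  have "0 \<le> M"
    using abs_pot_le[where v = "\<lambda>_. 0" and t = 0, OF qc continuous_on_const qb Fb] T_pos
    unfolding M_def by (auto intro: order_trans[OF abs_ge_zero])
  then have "0 \<le> L" unfolding L_def by (intro slope_nonneg) simp
  have "0 \<le> c" using Cb[of "\<lambda>_. 0"] by simp
  \<comment> \<open>\<open>prim\<close> vanishes at 0 and is \<open>L\<close>-Lipschitz, so
    \<open>c + L * T\<close> bounds the image; the summand 1 makes \<open>R\<close>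
    positive.\<close>
  define R where "R = c + L * T + 1"
  have "R > 0" using \<open>0 \<le> L\<close> \<open>0 \<le> c\<close> T_pos unfolding R_def by (simp add: add_nonneg_pos)
  define G where "G = (\<lambda>v t. C v + prim T (pot F q v) t)"
  have lip: "\<bar>prim T (pot F q v) s - prim T (pot F q v) t\<bar> \<le> L * \<bar>s - t\<bar>"
    if "continuous_on {0..T} v" "s \<in> {0..T}" "t \<in> {0..T}" for v s t
    unfolding L_def M_def by (rule prim_pot_lipschitz[OF Fc qc Fb qb that])
  have maps: "G v \<in> lip_ball T R L" if "v \<in> lip_ball T R L" for v
    unfolding lip_ball_def
  proof (intro CollectI conjI ballI)
    note vc = lip_ball_continuous[OF that]
    fix t assume t: "t \<in> {0..T}"
    have "\<bar>prim T (pot F q v) t - prim T (pot F q v) 0\<bar> \<le> L * \<bar>t - 0\<bar>"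
      using T_pos by (intro lip vc t) simp
    also have "\<dots> \<le> L * T" using t \<open>0 \<le> L\<close> by (intro mult_left_mono) auto
    finally show "\<bar>G v t\<bar> \<le> R" using Cb[OF vc] by (simp add: G_def R_def)
    fix s assume "s \<in> {0..T}"
    with lip[OF vc t this] show "\<bar>G v t - G v s\<bar> \<le> L * \<bar>t - s\<bar>" by (simp add: G_def)
  qed
  have G: "sup_continuous T G"
    unfolding G_def [abs_def] using C sup_continuous_prim_pot[OF F q Fb qb] by (rule sup_continuous_add)
  obtain u where u: "u \<in> lip_ball T R L" "\<forall>t\<in>{0..T}. G u t = u t"
  proof (rule lip_ball_fixed_point[OF T_pos \<open>R > 0\<close> \<open>0 \<le> L\<close> maps])
    fix \<epsilon> :: real assume "\<epsilon> > 0"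
    obtain \<delta> where "\<delta> > 0" and \<delta>: "\<And>v w t. \<lbrakk>continuous_on {0..T} v; continuous_on {0..T} w;
     \<And>t. t \<in> {0..T} \<Longrightarrow> \<bar>v t - w t\<bar> \<le> \<delta>; t \<in> {0..T}\<rbrakk> \<Longrightarrow> \<bar>G v t - G w t\<bar> \<le> \<epsilon>"
      by (rule sup_continuousE[OF G \<open>\<epsilon> > 0\<close>]) blast
    then show "\<exists>\<delta>>0. \<forall>v\<in>lip_ball T R L. \<forall>w\<in>lip_ball T R L.
              (\<forall>t\<in>{0..T}. \<bar>v t - w t\<bar> \<le> \<delta>) \<longrightarrow> (\<forall>t\<in>{0..T}. \<bar>G v t - G w t\<bar> \<le> \<epsilon>)"
      by (intro exI[of _ \<delta>]) (simp add: lip_ball_continuous)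
  qed
  then show thesis using that[of u] lip_ball_continuous[OF u(1)] by (simp add: G_def)
qed

lemma prim_pot_fixed_point_weak_solution:
  assumes F: "continuous_on UNIV F" and q: "continuous_on UNIV q" and u: "continuous_on {0..T} u"
    and eq: "\<And>t. t \<in> {0..T} \<Longrightarrow> u t = c + prim T (pot F q u) t"
  shows "weak_solution T \<psi> F (rhs (mean (\<lambda>t. q (u t))) (\<lambda>t. q (u t))) u"
proof -
  have qu: "continuous_on {0..T} (\<lambda>t. q (u t))" by (rule continuous_on_compose2[OF q u]) auto
  show ?thesis
    by (rule prim_imp_weak_solution[OF T_pos F rhs_absolutely_integrable[OF qu] _ u])
      (use eq integral_rhs_eq_0_iff[OF qu] in \<open>simp_all add: pot_def [abs_def]\<close>)
qed

lemma weak_solution_level: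
  assumes "continuous_on UNIV q" "weak_solution T \<psi> F (rhs s (\<lambda>t. q (u t))) u"
  shows "mean (\<lambda>t. q (u t)) = s"
proof -
  have "continuous_on {0..T} (\<lambda>t. q (u t))"
    by (rule continuous_on_compose2[OF assms(1) weak_solution_continuous[OF assms(2)]]) auto
  then show ?thesis using integral_rhs_eq_0_iff assms(2) by (simp add: weak_solution_def)
qed

text \<open>Adding a constant to a function shifts \<open>max_diff\<close> by the same constant. The
  choice \<open>C v = m v - max_diff T b (N v)\<close> therefore forces
  \<open>max_diff T b u = m u\<close> at a fixed point.\<close>

lemma exists_solution_with_max_diff:
  assumes F: "uniformly_continuous_on UNIV F" and q: "uniformly_continuous_on UNIV q"
    and Fb: "\<And>x. \<bar>F x\<bar> \<le> \<Phi>" and qb: "\<And>x. \<bar>q x\<bar> \<le> Q" and b: "continuous_on {0..T} b"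
    and m: "sup_continuous T (\<lambda>v t. m v)" and mb: "\<And>v. continuous_on {0..T} v \<Longrightarrow> \<bar>m v\<bar> \<le> c"
  obtains u where "continuous_on {0..T} u"
    "weak_solution T \<psi> F (rhs (mean (\<lambda>t. q (u t))) (\<lambda>t. q (u t))) u" "max_diff T b u = m u"
proof -
  note Fc = uniformly_continuous_imp_continuous[OF F] and qc = uniformly_continuous_imp_continuous[OF q]
  define N where "N = (\<lambda>v. prim T (pot F q v))"
  have Nc: "continuous_on {0..T} (N v)" if "continuous_on {0..T} v" for v
    unfolding N_def by (intro continuous_on_prim continuous_on_pot Fc qc that)
  define C where "C = (\<lambda>v. m v - max_diff T b (N v))"
  have "sup_continuous T (\<lambda>v t. max_diff T b (N v))"
    using sup_continuous_prim_pot[OF F q Fb qb] Nc unfolding N_def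
    by (intro sup_continuous_max_diff[OF T_pos b])
  then have "sup_continuous T (\<lambda>v t. - max_diff T b (N v))"
    by (rule sup_continuous_lipschitz[of _ _ 1]) (auto simp: abs_minus_commute)
  with m have "sup_continuous T (\<lambda>v t. m v + - max_diff T b (N v))" by (rule sup_continuous_add)
  then have C: "sup_continuous T (\<lambda>v t. C v)" by (simp add: C_def)
  define L where "L = slope (2 * (T * (B + 4 * Q) + \<Phi>))"
  obtain b1 where b1: "\<And>t. t \<in> {0..T} \<Longrightarrow> \<bar>b t\<bar> \<le> b1" using continuous_on_abs_bound[OF b] by blast
  have Cb: "\<bar>C v\<bar> \<le> c + \<bar>L\<bar> * T + b1" if v: "continuous_on {0..T} v" for v
  proof -
    obtain t where t: "t \<in> {0..T}" "max_diff T b (N v) = N v t - b t"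
      using max_diff_props(2)[OF T_pos b Nc[OF v]] by blast
    have "\<bar>N v t - N v 0\<bar> \<le> L * \<bar>t - 0\<bar>"
      unfolding N_def L_def by (rule prim_pot_lipschitz[OF Fc qc Fb qb v t(1)]) (use T_pos in simp)
    also have "\<dots> \<le> \<bar>L\<bar> * T" using t(1) by (intro mult_mono) auto
    finally have "\<bar>N v t\<bar> \<le> \<bar>L\<bar> * T" by (simp add: N_def)
    then show ?thesis using t mb[OF v] b1[OF t(1)] unfolding C_def by linarith
  qed
  obtain u where u: "continuous_on {0..T} u" "\<And>t. t \<in> {0..T} \<Longrightarrow> u t = C u + N u t"
    using exists_prim_fixed_point[OF F q Fb qb C Cb] unfolding N_def by blast
  have "max_diff T b u = C u + max_diff T b (N u)"
    by (rule max_diff_add_const[OF T_pos b u(1) Nc[OF u(1)] u(2)])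
  then have "max_diff T b u = m u" by (simp add: C_def)
  then show thesis
    using that u(1) prim_pot_fixed_point_weak_solution[OF Fc qc u(1)] u(2) unfolding N_def by blast
qed

text \<open>A Poincare--Miranda argument: the maximum of \<^term>\<open>u - b\<close> is pushed along the defect of the
  level, so that at a fixed point the level is \<^term>\<open>s\<close> unless the maximum sits at an end of the interval.\<close>
lemma exists_solution_at_level:
  assumes F: "uniformly_continuous_on UNIV F" and q: "uniformly_continuous_on UNIV q"
    and Fb: "\<And>x. \<bar>F x\<bar> \<le> \<Phi>" and qb: "\<And>x. \<bar>q x\<bar> \<le> Q" and b: "continuous_on {0..T} b"
    and "M1 < M2" and \<sigma>: "\<bar>\<sigma>\<bar> = 1"
    and end1: "\<And>u s'. \<lbrakk>weak_solution T \<psi> F (rhs s' (\<lambda>t. q (u t))) u; max_diff T b u = M1\<rbrakk> \<Longrightarrow> \<sigma> * (s' - s) > 0"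
    and end2: "\<And>u s'. \<lbrakk>weak_solution T \<psi> F (rhs s' (\<lambda>t. q (u t))) u; max_diff T b u = M2\<rbrakk> \<Longrightarrow> \<sigma> * (s' - s) < 0"
  obtains u where "weak_solution T \<psi> F (rhs s (\<lambda>t. q (u t))) u" "M1 < max_diff T b u" "max_diff T b u < M2"
proof -
  \<comment> \<open>\<open>\<sigma>\<close> orients the push: of the two intervals to be treated,
    one has levels above \<open>s\<close> at its left end, the other at its right end.\<close>
  define m where "m = (\<lambda>v. max M1 (min M2 (max_diff T b v + \<sigma> * (mean (\<lambda>t. q (v t)) - s))))"
  have "sup_continuous T (\<lambda>v. v)"
    by (rule sup_continuousI) (metis)
  then have "sup_continuous T (\<lambda>v t. max_diff T b v)"
    by (intro sup_continuous_max_diff[OF T_pos b]) auto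
  moreover have "sup_continuous T (\<lambda>v t. \<sigma> * (mean (\<lambda>t. q (v t)) - s))"
  proof (rule sup_continuous_lipschitz[OF sup_continuous_mean[OF q], of 1])
    fix v w d t assume "\<And>t. t \<in> {0..T} \<Longrightarrow> \<bar>mean (\<lambda>t. q (v t)) - mean (\<lambda>t. q (w t))\<bar> \<le> d" and "t \<in> {0..T}"
    moreover have "\<sigma> * (mean (\<lambda>t. q (v t)) - s) - \<sigma> * (mean (\<lambda>t. q (w t)) - s) = \<sigma> * (mean (\<lambda>t. q (v t)) - mean (\<lambda>t. q (w t)))"
      by (simp add: algebra_simps)
    ultimately show "\<bar>\<sigma> * (mean (\<lambda>t. q (v t)) - s) - \<sigma> * (mean (\<lambda>t. q (w t)) - s)\<bar> \<le> 1 * d"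
      using \<sigma> by (simp add: abs_mult)
  qed simp
  ultimately have "sup_continuous T (\<lambda>v t. max_diff T b v + \<sigma> * (mean (\<lambda>t. q (v t)) - s))"
    by (rule sup_continuous_add)
  then have "sup_continuous T (\<lambda>v t. m v)"
  proof (rule sup_continuous_lipschitz[of _ _ 1])
    fix v w d t
    assume d: "\<And>t. t \<in> {0..T} \<Longrightarrow> \<bar>max_diff T b v + \<sigma> * (mean (\<lambda>t. q (v t)) - s) -
       (max_diff T b w + \<sigma> * (mean (\<lambda>t. q (w t)) - s))\<bar> \<le> d" and t: "t \<in> {0..T}"
    show "\<bar>m v - m w\<bar> \<le> 1 * d"
      unfolding m_def using clamp_diff_le[of M1 M2] d[OF t] by (metis mult_1 order_trans)
  qed simp
  moreover have "\<bar>m v\<bar> \<le> \<bar>M1\<bar> + \<bar>M2\<bar>" for v unfolding m_def by linarith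
  ultimately obtain u where u: "weak_solution T \<psi> F (rhs (mean (\<lambda>t. q (u t))) (\<lambda>t. q (u t))) u" "max_diff T b u = m u"
    using exists_solution_with_max_diff[OF F q Fb qb b, of m "\<bar>M1\<bar> + \<bar>M2\<bar>"] by blast
  define S where "S = mean (\<lambda>t. q (u t))"
  \<comment> \<open>At an end of the interval the push points strictly inwards, so the clamped value
    cannot stay there; at an interior point the equation leaves no push at all.\<close>
  have fp: "max_diff T b u = max M1 (min M2 (max_diff T b u + \<sigma> * (S - s)))"
    using u(2) by (simp add: m_def S_def)
  have "max_diff T b u \<noteq> M1"
  proof
    assume "max_diff T b u = M1"
    with end1[OF u(1)] fp \<open>M1 < M2\<close> show False unfolding S_def by linarith
  qed
  moreover have "max_diff T b u \<noteq> M2"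
  proof
    assume "max_diff T b u = M2"
    with end2[OF u(1)] fp \<open>M1 < M2\<close> show False unfolding S_def by linarith
  qed
  ultimately have "M1 < max_diff T b u" "max_diff T b u < M2" "\<sigma> * (S - s) = 0"
    using fp \<open>M1 < M2\<close> by linarith+
  moreover have "S = s" using \<open>\<sigma> * (S - s) = 0\<close> \<sigma> by auto
  ultimately show thesis using that u(1) unfolding S_def by metis
qed

end

section \<open>Two solutions above an upper solution\<close>

definition clamp :: "real \<Rightarrow> real \<Rightarrow> real" where
  "clamp R x = max (- R) (min R x)"

lemma clamp_id: "\<bar>x\<bar> \<le> R \<Longrightarrow> clamp R x = x"
  by (auto simp: clamp_def)

lemma abs_clamp_le: "0 \<le> R \<Longrightarrow> \<bar>clamp R x\<bar> \<le> R"
  by (auto simp: clamp_def)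

lemma abs_clamp_ge: "\<lbrakk>r \<le> R; r \<le> \<bar>x\<bar>; 0 \<le> r\<rbrakk> \<Longrightarrow> r \<le> \<bar>clamp R x\<bar>"
  by (auto simp: clamp_def)

lemma dist_clamp_le: "\<bar>clamp R x - clamp R y\<bar> \<le> \<bar>x - y\<bar>"
  unfolding clamp_def by (rule clamp_diff_le)

text \<open>Clamping the argument makes a merely continuous function bounded and uniformly
  continuous on the whole line, as the fixed point argument demands of \<open>F\<close> and
  \<open>q\<close>.\<close>

lemma clamp_comp:
  fixes g :: "real \<Rightarrow> real"
  assumes "continuous_on UNIV g" "0 \<le> R"
  shows "uniformly_continuous_on UNIV (\<lambda>x. g (clamp R x))" "\<exists>Q. \<forall>x. \<bar>g (clamp R x)\<bar> \<le> Q"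
proof -
  have "uniformly_continuous_on {-R..R} g"
    by (intro compact_uniformly_continuous continuous_on_subset[OF assms(1)]) auto
  moreover have "uniformly_continuous_on UNIV (clamp R)"
    using dist_clamp_le by (intro lipschitz_on_uniformly_continuous[of 1] lipschitz_onI) (auto simp: dist_real_def)
  ultimately show "uniformly_continuous_on UNIV (\<lambda>x. g (clamp R x))"
  proof -
    assume g: "uniformly_continuous_on {-R..R} g" and c: "uniformly_continuous_on UNIV (clamp R)"
    have "clamp R ` UNIV \<subseteq> {-R..R}" using abs_clamp_le[OF \<open>0 \<le> R\<close>] by (auto simp: abs_le_iff minus_le_iff)
    with g have "uniformly_continuous_on (clamp R ` UNIV) g"
      unfolding uniformly_continuous_on_def by (meson subsetD)
    then show ?thesis by (rule uniformly_continuous_on_compose[OF c])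
  qed
  have "bounded (g ` {-R..R})"
    by (intro compact_imp_bounded compact_continuous_image continuous_on_subset[OF assms(1)]) auto
  then obtain Q where "\<forall>y\<in>g ` {-R..R}. norm y \<le> Q" unfolding bounded_iff by blast
  then have "\<bar>g (clamp R x)\<bar> \<le> Q" for x using abs_clamp_le[OF \<open>0 \<le> R\<close>, of x] by (auto simp: abs_le_iff)
  then show "\<exists>Q. \<forall>x. \<bar>g (clamp R x)\<bar> \<le> Q" by blast
qed

lemma clamp_comp_lipschitz:
  fixes g :: "real \<Rightarrow> real"
  assumes "C-lipschitz_on {-R..R} g" "0 \<le> R"
  shows "C-lipschitz_on UNIV (\<lambda>x. g (clamp R x))"
proof (rule lipschitz_onI)
  fix x y
  have "dist (g (clamp R x)) (g (clamp R y)) \<le> C * dist (clamp R x) (clamp R y)"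
    using abs_clamp_le[OF \<open>0 \<le> R\<close>, of x] abs_clamp_le[OF \<open>0 \<le> R\<close>, of y]
    by (intro lipschitz_onD[OF assms(1)]) auto
  also have "\<dots> \<le> C * dist x y"
    using dist_clamp_le[of R x y] lipschitz_on_nonneg[OF assms(1)] by (intro mult_left_mono) (auto simp: dist_real_def)
  finally show "dist (g (clamp R x)) (g (clamp R y)) \<le> C * dist x y" .
qed (rule lipschitz_on_nonneg[OF assms(1)])

section \<open>Comparison at a touching point, a priori bounds, and the two solutions\<close>

context forced_lienard
begin

text \<open>If the level of \<^term>\<open>u\<close> were larger, then at a touching point, where the derivatives agree, the
  forcing would drive \<^term>\<open>u\<close> above \<^term>\<open>b\<close>; the friction term is of higher order there
  because \<^term>\<open>F\<close> is Lipschitz.\<close>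
lemma touching_level_le:
  assumes u: "weak_solution T \<psi> F (rhs s (\<lambda>t. q (u t))) u" and b: "weak_solution T \<psi> F h b"
    and h: "\<And>t. t \<in> {0..T} \<Longrightarrow> h t \<le> rhs s' (\<lambda>t. q (b t)) t"
    and q: "continuous_on UNIV q" and F: "C-lipschitz_on UNIV F"
    and below: "\<And>t. t \<in> {0..T} \<Longrightarrow> u t \<le> b t" and t0: "t0 \<in> {0..T}" "u t0 = b t0"
  shows "s \<le> s'"
proof (rule ccontr)
  assume "\<not> s \<le> s'"
  define \<eta> where "\<eta> = s - s'"
  have "\<eta> > 0" using \<open>\<not> s \<le> s'\<close> by (simp add: \<eta>_def)
  have "C \<ge> 0" using F by (rule lipschitz_on_nonneg)
  have "A \<ge> 0" using a_nonneg a_le by (meson order_trans)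
  define g where "g = rhs s (\<lambda>t. q (u t))"
  obtain ku where ku: "\<And>t. t \<in> {0..T} \<Longrightarrow> (u has_real_derivative \<psi> (ku + integral {0..t} g - F (u t))) (at t within {0..T})"
    using u unfolding weak_solution_def g_def by blast
  obtain kb where kb: "\<And>t. t \<in> {0..T} \<Longrightarrow> (b has_real_derivative \<psi> (kb + integral {0..t} h - F (b t))) (at t within {0..T})"
    using b unfolding weak_solution_def by blast
  have gi: "g absolutely_integrable_on {0..T}" "integral {0..T} g = 0" and perU: "u 0 = u T"
    using u unfolding weak_solution_def g_def by blast+
  have hi: "h absolutely_integrable_on {0..T}" "integral {0..T} h = 0" and perB: "b 0 = b T"
    using b unfolding weak_solution_def by blast+
  define yu where "yu = (\<lambda>t. ku + integral {0..t} g - F (u t))"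
  define yb where "yb = (\<lambda>t. kb + integral {0..t} h - F (b t))"
  define D where "D = (\<lambda>t. u t - b t)"
  have dD: "(D has_real_derivative \<psi> (yu t) - \<psi> (yb t)) (at t within {0..T})" if "t \<in> {0..T}" for t
    unfolding D_def yu_def yb_def by (intro DERIV_diff ku kb that)
  have D_le: "D t \<le> 0" if "t \<in> {0..T}" for t using below[OF that] by (simp add: D_def)
  \<comment> \<open>\<open>t1\<close> and \<open>t2\<close> are the same touching point modulo the
    period, the first with room on its right, the second with room on its left. Together they give
    both signs for the derivative of \<open>D\<close>.\<close>
  define t1 where "t1 = (if t0 = T then 0 else t0)"
  define t2 where "t2 = (if t1 = 0 then T else t1)"
  have t12: "0 \<le> t1" "t1 < T" "0 < t2" "t2 \<le> T" "D t1 = 0" "D t2 = 0"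
    using t0 T_pos perU perB by (auto simp: t1_def t2_def D_def)
  have y12: "yu t2 = yu t1" "yb t2 = yb t1"
    using perU perB gi(2) hi(2) by (auto simp: t2_def yu_def yb_def)
  have "\<psi> (yu t1) - \<psi> (yb t1) \<le> 0"
  proof (rule ccontr)
    assume "\<not> \<psi> (yu t1) - \<psi> (yb t1) \<le> 0"
    then obtain d where "d > 0" and d: "\<And>r. \<lbrakk>0 < r; t1 + r \<in> {0..T}; r < d\<rbrakk> \<Longrightarrow> D t1 < D (t1 + r)"
      using has_real_derivative_pos_inc_right[OF dD[of t1]] t12 by force
    define r where "r = min (d/2) (T - t1)"
    have "0 < r" "r < d" "t1 + r \<in> {0..T}" using \<open>d > 0\<close> t12 by (auto simp: r_def)
    then show False using d D_le t12 by fastforce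
  qed
  moreover have "0 \<le> \<psi> (yu t1) - \<psi> (yb t1)"
  proof (rule ccontr)
    assume "\<not> 0 \<le> \<psi> (yu t1) - \<psi> (yb t1)"
    then obtain d where "d > 0" and d: "\<And>r. \<lbrakk>0 < r; t2 - r \<in> {0..T}; r < d\<rbrakk> \<Longrightarrow> D t2 < D (t2 - r)"
      using has_real_derivative_neg_dec_left[OF dD[of t2]] t12 y12 by force
    define r where "r = min (d/2) t2"
    have "0 < r" "r < d" "t2 - r \<in> {0..T}" using \<open>d > 0\<close> t12 by (auto simp: r_def)
    then show False using d D_le t12 by fastforce
  qed
  ultimately have "\<psi> (yu t1) = \<psi> (yb t1)" by simp
  then have y1: "yu t1 = yb t1" by (metis phi_psi)
  have t1I: "t1 \<in> {0..T}" using t12 by simp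
  have uc: "continuous_on {0..T} u" and bc: "continuous_on {0..T} b"
    using weak_solution_continuous u b by blast+
  \<comment> \<open>Near \<open>t1\<close> the restoring terms take up at most
    \<open>\<eta>/2\<close> of the excess \<open>\<eta>\<close>, and the friction at most
    \<open>\<eta>/4 * (t - t1)\<close> of its integral, so that \<open>yu t - yb t\<close> stays at
    least \<open>\<eta>/4 * (t - t1)\<close>. The summand 1 in \<open>A + 1\<close> and
    \<open>C + 1\<close> avoids division by 0.\<close>
  have "continuous_on {0..T} (\<lambda>t. q (u t) - q (b t))"
    by (intro continuous_on_diff continuous_on_compose2[OF q] uc bc) auto
  moreover have "q (u t1) - q (b t1) = 0" using t12 by (simp add: D_def)
  moreover have "\<eta> / (2 * (A + 1)) > 0" using \<open>\<eta> > 0\<close> \<open>A \<ge> 0\<close> by simp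
  ultimately obtain d1 where "d1 > 0" and d1: "\<And>t. \<lbrakk>t \<in> {0..T}; \<bar>t - t1\<bar> < d1\<rbrakk> \<Longrightarrow> \<bar>q (u t) - q (b t)\<bar> < \<eta> / (2 * (A + 1))"
    unfolding continuous_on_iff dist_real_def using t1I by (metis diff_zero)
  have "(D has_real_derivative 0) (at t1 within {0..T})" using dD[OF t1I] y1 by simp
  moreover have "\<eta> / (4 * (C + 1)) > 0" using \<open>\<eta> > 0\<close> \<open>C \<ge> 0\<close> by simp
  ultimately obtain d2 where "d2 > 0" and d2: "\<And>t. \<lbrakk>t \<in> {0..T}; \<bar>t - t1\<bar> < d2\<rbrakk> \<Longrightarrow> \<bar>D t\<bar> \<le> \<eta> / (4 * (C + 1)) * \<bar>t - t1\<bar>"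
    unfolding has_field_derivative_def has_derivative_within_alt using t12 by fastforce
  define t3 where "t3 = min T (t1 + min d1 d2 / 2)"
  have t3: "t1 < t3" "t3 \<le> T" "t3 < t1 + d1" "t3 < t1 + d2"
    using \<open>d1 > 0\<close> \<open>d2 > 0\<close> t12 by (auto simp: t3_def min_def)
  have ypos: "yb t < yu t" if t: "t1 < t" "t < t3" for t
  proof -
    have tI: "t \<in> {0..T}" and sub: "{t1..t} \<subseteq> {0..T}" using t t3 t12 by auto
    have ig: "g integrable_on {0..T}" "h integrable_on {0..T}"
      using gi(1) hi(1) by (auto intro: set_lebesgue_integral_eq_integral(1))
    have ig': "g integrable_on {t1..t}" "h integrable_on {t1..t}" "g integrable_on {0..t}" "h integrable_on {0..t}"
      by (rule integrable_subinterval_real[OF ig(1)] integrable_subinterval_real[OF ig(2)]; use t12 t tI in auto)+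
    have split: "integral {0..t1} g + integral {t1..t} g = integral {0..t} g"
      "integral {0..t1} h + integral {t1..t} h = integral {0..t} h"
      using t t12 ig' by (simp_all add: Henstock_Kurzweil_Integration.integral_combine)
    have "\<eta> / 2 \<le> g x - h x" if x: "x \<in> {t1..t}" for x
    proof -
      have xI: "x \<in> {0..T}" "\<bar>x - t1\<bar> < d1" using x t t3 t12 by auto
      have "a x * (q (u x) - q (b x)) \<le> A * (\<eta> / (2 * (A + 1)))"
      proof -
        have "a x * (q (u x) - q (b x)) \<le> a x * (\<eta> / (2 * (A + 1)))"
          using d1[OF xI] by (intro mult_left_mono a_nonneg) auto
        also have "\<dots> \<le> A * (\<eta> / (2 * (A + 1)))"
          using \<open>\<eta> / (2 * (A + 1)) > 0\<close> by (intro mult_right_mono a_le) auto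
        finally show ?thesis .
      qed
      also have "\<dots> \<le> \<eta> / 2" using \<open>\<eta> > 0\<close> \<open>A \<ge> 0\<close> by (simp add: field_simps)
      finally have "a x * q (u x) - a x * q (b x) \<le> \<eta> / 2" by (simp only: right_diff_distrib)
      moreover have "h x \<le> s' + e x - a x * q (b x)" "g x = s + e x - a x * q (u x)"
        using h[OF xI(1)] by (simp_all add: g_def rhs_def)
      moreover have "s - s' = \<eta> / 2 + \<eta> / 2" by (simp add: \<eta>_def)
      ultimately show ?thesis by linarith
    qed
    then have "integral {t1..t} (\<lambda>_. \<eta> / 2) \<le> integral {t1..t} (\<lambda>x. g x - h x)"
      by (intro integral_le integrable_diff ig' integrable_const_ivl) auto
    then have 1: "\<eta> / 2 * (t - t1) \<le> integral {t1..t} g - integral {t1..t} h"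
      using integral_diff[OF ig'(1,2)] t by (simp add: mult.commute)
    have "\<bar>F (u t) - F (b t)\<bar> \<le> C * \<bar>u t - b t\<bar>"
      using lipschitz_onD[OF F, of "u t" "b t"] by (simp add: dist_real_def)
    also have "\<dots> \<le> C * (\<eta> / (4 * (C + 1)) * (t - t1))"
      using d2[OF tI] t t3 \<open>C \<ge> 0\<close> unfolding D_def by (intro mult_left_mono) auto
    also have "\<dots> \<le> \<eta> / 4 * (t - t1)"
    proof -
      have "C * (\<eta> / (4 * (C + 1))) \<le> \<eta> / 4" using \<open>\<eta> > 0\<close> \<open>C \<ge> 0\<close> by (simp add: field_simps)
      then have "C * (\<eta> / (4 * (C + 1))) * (t - t1) \<le> \<eta> / 4 * (t - t1)" using t by (intro mult_right_mono) auto
      then show ?thesis by (simp add: mult.assoc)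
    qed
    finally have 2: "\<bar>F (u t) - F (b t)\<bar> \<le> \<eta> / 4 * (t - t1)" .
    have "F (u t1) = F (b t1)" using t12 by (simp add: D_def)
    then have "yu t - yb t = (integral {t1..t} g - integral {t1..t} h) - (F (u t) - F (b t))"
      using y1 split unfolding yu_def yb_def by simp
    moreover have "\<eta> / 4 * (t - t1) < \<eta> / 2 * (t - t1)" using \<open>\<eta> > 0\<close> t by simp
    ultimately show ?thesis using 1 2 by linarith
  qed
  have "D t1 < D t3"
  proof (rule DERIV_pos_imp_increasing_open[OF t3(1)])
    fix x assume x: "t1 < x" "x < t3"
    then have "(D has_real_derivative \<psi> (yu x) - \<psi> (yb x)) (at x)"
      using dD[of x] t12 t3 by (simp add: at_within_Icc_at)
    then show "\<exists>y. (D has_real_derivative y) (at x) \<and> 0 < y" using ypos[OF x] by auto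
  next
    show "continuous_on {t1..t3} D"
      unfolding D_def by (rule continuous_on_subset[of "{0..T}"]) (use uc bc t12 t3 in \<open>auto intro: continuous_intros\<close>)
  qed
  then show False using D_le[of t3] t12 t3 by simp
qed

lemma level_ge:
  assumes q: "continuous_on UNIV q" and u: "weak_solution T \<psi> F (rhs s (\<lambda>t. q (u t))) u"
    and c: "\<And>x. c \<le> q x"
  shows "c \<le> s"
proof -
  have "continuous_on {0..T} (\<lambda>t. q (u t))"
    by (rule continuous_on_compose2[OF q weak_solution_continuous[OF u]]) auto
  then have "mean (\<lambda>_. c) \<le> mean (\<lambda>t. q (u t))" using c by (intro mean_mono) auto
  then show ?thesis using weak_solution_level[OF q u] by simp
qed

text \<open>The level is the mean of \<open>q (u t)\<close>; being below \<open>K\<close>, it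
  prevents \<open>u\<close> from staying outside \<open>[-r,r]\<close>. One time inside and the
  oscillation \<open>L * T\<close> bound \<open>u\<close> everywhere. Neither \<open>F\<close> nor
  an upper bound of \<open>q\<close> enters \<open>L\<close>, so the same bound serves the truncated
  problem.\<close>

lemma solution_bound:
  assumes u: "weak_solution T \<psi> F (rhs s (\<lambda>t. q (u t))) u" and q: "continuous_on UNIV q"
    and m: "0 \<le> m" "\<And>x. - m \<le> q x" and r: "\<And>x. r \<le> \<bar>x\<bar> \<Longrightarrow> K \<le> q x" "s < K"
    and S: "\<bar>s\<bar> \<le> S"
  defines "L \<equiv> slope (T * (B + 2 * S + 2 * m))"
  shows "\<And>x y. \<lbrakk>x \<in> {0..T}; y \<in> {0..T}\<rbrakk> \<Longrightarrow> \<bar>u x - u y\<bar> \<le> L * \<bar>x - y\<bar>"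
    and "\<And>x y. \<lbrakk>x \<in> {0..T}; y \<in> {0..T}\<rbrakk> \<Longrightarrow> \<bar>u x - u y\<bar> \<le> L * T"
    and "\<And>t. t \<in> {0..T} \<Longrightarrow> \<bar>u t\<bar> \<le> r + L * T"
proof -
  have qu: "continuous_on {0..T} (\<lambda>t. q (u t))"
    by (rule continuous_on_compose2[OF q weak_solution_continuous[OF u]]) auto
  have 0: "integral {0..T} (rhs s (\<lambda>t. q (u t))) = 0" using u by (simp add: weak_solution_def)
  have "T * (B + 2 * \<bar>s\<bar> + 2 * m) \<le> T * (B + 2 * S + 2 * m)" using S T_pos by (intro mult_left_mono) auto
  then have K: "integral {0..T} (\<lambda>t. \<bar>rhs s (\<lambda>t. q (u t)) t\<bar>) \<le> T * (B + 2 * S + 2 * m)"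
    using integral_abs_rhs_le[OF qu m(2) m(1) 0] by linarith
  then have "0 \<le> L" unfolding L_def
    by (intro slope_nonneg) (use e_le[of 0] S m T_pos in simp)
  show lip: "\<bar>u x - u y\<bar> \<le> L * \<bar>x - y\<bar>" if "x \<in> {0..T}" "y \<in> {0..T}" for x y
    unfolding L_def by (rule weak_solution_lipschitz[OF T_pos u K that])
  show osc: "\<bar>u x - u y\<bar> \<le> L * T" if "x \<in> {0..T}" "y \<in> {0..T}" for x y
  proof -
    have "L * \<bar>x - y\<bar> \<le> L * T" using that \<open>0 \<le> L\<close> by (intro mult_left_mono) auto
    then show ?thesis using lip[OF that] by linarith
  qed
  have "\<exists>t\<in>{0..T}. \<bar>u t\<bar> < r"
  proof (rule ccontr)
    assume "\<not> ?thesis"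
    then have "K \<le> q (u t)" if "t \<in> {0..T}" for t using r(1) that by force
    then have "mean (\<lambda>_. K) \<le> mean (\<lambda>t. q (u t))" by (intro mean_mono qu) auto
    then show False using weak_solution_level[OF q u] r(2) by simp
  qed
  then obtain t0 where "t0 \<in> {0..T}" "\<bar>u t0\<bar> < r" by blast
  then show "\<bar>u t\<bar> \<le> r + L * T" if "t \<in> {0..T}" for t using osc[OF that, of t0] by linarith
qed

text \<open>\<open>b\<close> has a forcing \<open>h\<close> of its own and needs only an inequality
  against level \<open>s'\<close>. This covers both a genuine solution of level \<open>s'\<close>
  and the solution of the problem without restoring term.\<close>

lemma two_solutions_above_upper_solution:
  assumes F: "continuous_on UNIV F" "\<And>R. \<exists>C. C-lipschitz_on {-R..R} F"
    and q: "continuous_on UNIV q" and m: "0 \<le> m" "\<And>x. - m \<le> q x"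
    and coercive: "\<And>K. \<exists>r\<ge>0. \<forall>x. r \<le> \<bar>x\<bar> \<longrightarrow> K \<le> q x"
    and b: "weak_solution T \<psi> F h b" and h: "\<And>t. t \<in> {0..T} \<Longrightarrow> h t \<le> rhs s' (\<lambda>t. q (b t)) t"
    and "s' < s"
  obtains u v where "weak_solution T \<psi> F (rhs s (\<lambda>t. q (u t))) u" "weak_solution T \<psi> F (rhs s (\<lambda>t. q (v t))) v"
    "\<exists>t\<in>{0..T}. u t \<noteq> v t"
proof -
  obtain r where "r \<ge> 0" and r: "\<And>x. r \<le> \<bar>x\<bar> \<Longrightarrow> s + 1 \<le> q x" using coercive by blast
  note bc = weak_solution_continuous[OF b]
  obtain b1 where b1: "\<And>t. t \<in> {0..T} \<Longrightarrow> \<bar>b t\<bar> \<le> b1" using continuous_on_abs_bound[OF bc] by blast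
  have "0 \<le> b1" using b1[of 0] T_pos by auto
  \<comment> \<open>A bound for every level in \<open>[-m, s]\<close>; the truncated problem has no
    solutions of level below \<open>- m\<close>.\<close>
  define S where "S = \<bar>s\<bar> + m"
  have "0 \<le> S" using m by (simp add: S_def)
  define L where "L = slope (T * (B + 2 * S + 2 * m))"
  have "0 \<le> L" unfolding L_def by (intro slope_nonneg) (use e_le[of 0] m \<open>0 \<le> S\<close> T_pos in simp)
  then have "0 \<le> L * T" using T_pos by simp
  \<comment> \<open>Chosen so that truncation at \<open>R\<close> affects neither \<open>b\<close>
    nor any solution of level \<open>s\<close>.\<close>
  define R where "R = r + L * T + b1"
  have R: "0 \<le> R" "r \<le> R" "b1 \<le> R" "r + L * T \<le> R"
    using \<open>0 \<le> L * T\<close> \<open>r \<ge> 0\<close> \<open>0 \<le> b1\<close> by (auto simp: R_def)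
  define F' where "F' = (\<lambda>x. F (clamp R x))"
  define q' where "q' = (\<lambda>x. q (clamp R x))"
  have F'u: "uniformly_continuous_on UNIV F'" and q'u: "uniformly_continuous_on UNIV q'"
    unfolding F'_def q'_def by (intro clamp_comp(1) F q R)+
  obtain \<Phi> where \<Phi>: "\<And>x. \<bar>F' x\<bar> \<le> \<Phi>" unfolding F'_def using clamp_comp(2)[OF F(1) R(1)] by blast
  obtain Q where Q: "\<And>x. \<bar>q' x\<bar> \<le> Q" unfolding q'_def using clamp_comp(2)[OF q R(1)] by blast
  obtain C where C: "C-lipschitz_on UNIV F'" unfolding F'_def using clamp_comp_lipschitz F(2) R(1) by blast
  note q'c = uniformly_continuous_imp_continuous[OF q'u]
  have q'r: "s + 1 \<le> q' x" if "r \<le> \<bar>x\<bar>" for x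
    unfolding q'_def by (rule r[OF abs_clamp_ge[OF R(2) that \<open>r \<ge> 0\<close>]])
  have q'm: "- m \<le> q' x" for x unfolding q'_def by (rule m)
  have b': "weak_solution T \<psi> F' h b"
    by (rule weak_solution_cong[OF b]) (use b1 R in \<open>force simp: F'_def clamp_id\<close>, simp)
  have h': "h t \<le> rhs s' (\<lambda>t. q' (b t)) t" if "t \<in> {0..T}" for t
  proof -
    have "\<bar>b t\<bar> \<le> R" using b1[OF that] R by simp
    then show ?thesis using h[OF that] by (simp add: rhs_def q'_def clamp_id)
  qed
  have unclamp: "weak_solution T \<psi> F (rhs s (\<lambda>t. q (u t))) u"
    if u: "weak_solution T \<psi> F' (rhs s (\<lambda>t. q' (u t))) u" for u
  proof -
    have "\<bar>u t\<bar> \<le> R" if "t \<in> {0..T}" for t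
    proof -
      have "\<bar>u t\<bar> \<le> r + L * T"
        unfolding L_def by (rule solution_bound(3)[OF u q'c m(1) q'm q'r _ _ that]) (use m(1) in \<open>simp_all add: S_def\<close>)
      then show ?thesis using R(4) by simp
    qed
    then show ?thesis
      by (intro weak_solution_cong[OF u]) (auto simp: F'_def q'_def rhs_def clamp_id)
  qed
  \<comment> \<open>If the maximum of \<open>u - b\<close> is \<open>- M\<close>, then
    \<open>u\<close> stays below \<open>- r\<close>, which makes the level at least
    \<open>s + 1\<close>. If it is \<open>M\<close>, then \<open>u\<close> exceeds
    \<open>r + L * T\<close> somewhere, which \<open>solution_bound\<close> excludes for levels up
    to \<open>s\<close>.\<close>
  define M where "M = b1 + r + L * T + 1"
  have "M > 0" using \<open>0 \<le> b1\<close> \<open>r \<ge> 0\<close> \<open>0 \<le> L * T\<close> by (simp add: M_def)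
  have touch: "\<sigma> < s" if u: "weak_solution T \<psi> F' (rhs \<sigma> (\<lambda>t. q' (u t))) u" and 0: "max_diff T b u = 0" for u \<sigma>
  proof -
    note uc = weak_solution_continuous[OF u]
    obtain t0 where t0: "t0 \<in> {0..T}" "u t0 = b t0" using max_diff_props(2)[OF T_pos bc uc] 0 by force
    have "\<sigma> \<le> s'"
      by (rule touching_level_le[OF u b' h' q'c C _ t0]) (use max_diff_props(1)[OF T_pos bc uc] 0 in force)+
    then show ?thesis using \<open>s' < s\<close> by simp
  qed
  have far: "s + 1 \<le> \<sigma>"
    if u: "weak_solution T \<psi> F' (rhs \<sigma> (\<lambda>t. q' (u t))) u" and "\<And>t. t \<in> {0..T} \<Longrightarrow> r \<le> \<bar>u t\<bar>" for u \<sigma>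
  proof -
    have "continuous_on {0..T} (\<lambda>t. q' (u t))"
      by (rule continuous_on_compose2[OF q'c weak_solution_continuous[OF u]]) auto
    then have "mean (\<lambda>_. s + 1) \<le> mean (\<lambda>t. q' (u t))" using that(2) q'r by (intro mean_mono) auto
    then show ?thesis using weak_solution_level[OF q'c u] by simp
  qed
  have low: "s < \<sigma>" if u: "weak_solution T \<psi> F' (rhs \<sigma> (\<lambda>t. q' (u t))) u" and M': "max_diff T b u = - M" for u \<sigma>
  proof -
    have "r \<le> \<bar>u t\<bar>" if t: "t \<in> {0..T}" for t
      using max_diff_props(1)[OF T_pos bc weak_solution_continuous[OF u] t] b1[OF t] M' \<open>0 \<le> L * T\<close>
      unfolding M_def by linarith
    then show ?thesis using far[OF u] by fastforce
  qed
  have high: "s < \<sigma>" if u: "weak_solution T \<psi> F' (rhs \<sigma> (\<lambda>t. q' (u t))) u" and M': "max_diff T b u = M" for u \<sigma>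
  proof (rule ccontr)
    assume "\<not> s < \<sigma>"
    moreover have "- m \<le> \<sigma>" by (rule level_ge[OF q'c u q'm])
    ultimately have \<sigma>: "\<sigma> < s + 1" "\<bar>\<sigma>\<bar> \<le> S" using m(1) unfolding S_def by linarith+
    obtain t where t: "t \<in> {0..T}" "M = u t - b t"
      using max_diff_props(2)[OF T_pos bc weak_solution_continuous[OF u]] M' by force
    have "\<bar>u t\<bar> \<le> r + L * T"
      unfolding L_def by (rule solution_bound(3)[OF u q'c m(1) q'm q'r \<sigma> t(1)])
    then show False using t(2) b1[OF t(1)] unfolding M_def by linarith
  qed
  have *: "\<bar>1 :: real\<bar> = 1" "\<bar>-1 :: real\<bar> = 1" by simp_all
  obtain u where u: "weak_solution T \<psi> F' (rhs s (\<lambda>t. q' (u t))) u" "max_diff T b u < 0"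
    by (rule exists_solution_at_level[OF F'u q'u \<Phi> Q bc _ *(1), of "-M" 0 s])
      (use \<open>M > 0\<close> low touch in auto)
  obtain v where v: "weak_solution T \<psi> F' (rhs s (\<lambda>t. q' (v t))) v" "0 < max_diff T b v"
    by (rule exists_solution_at_level[OF F'u q'u \<Phi> Q bc _ *(2), of 0 M s])
      (use \<open>M > 0\<close> high touch in auto)
  have "\<exists>t\<in>{0..T}. u t \<noteq> v t"
  proof (rule ccontr)
    assume "\<not> ?thesis"
    then have "max_diff T b v = 0 + max_diff T b u"
      by (intro max_diff_add_const[OF T_pos bc] weak_solution_continuous[OF u(1)] weak_solution_continuous[OF v(1)]) auto
    then show False using u(2) v(2) by simp
  qed
  then show thesis using that unclamp[OF u(1)] unclamp[OF v(1)] by blast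
qed

end

section \<open>The threshold level\<close>

lemma sup_continuous_tendsto:
  assumes \<Phi>: "sup_continuous T \<Phi>" and v: "\<And>n. continuous_on {0..T} (v n)" and u: "continuous_on {0..T} u"
    and lim: "\<And>e. 0 < e \<Longrightarrow> \<exists>N. \<forall>n\<ge>N. \<forall>t\<in>{0..T}. \<bar>v n t - u t\<bar> < e" and t: "t \<in> {0..T}"
  shows "(\<lambda>n. \<Phi> (v n) t) \<longlonglongrightarrow> \<Phi> u t"
proof (rule LIMSEQ_I)
  fix r :: real assume "0 < r"
  then have "r / 2 > 0" by simp
  obtain \<delta> where "\<delta> > 0" and \<delta>: "\<And>v w t. \<lbrakk>continuous_on {0..T} v; continuous_on {0..T} w;
     \<And>t. t \<in> {0..T} \<Longrightarrow> \<bar>v t - w t\<bar> \<le> \<delta>; t \<in> {0..T}\<rbrakk> \<Longrightarrow> \<bar>\<Phi> v t - \<Phi> w t\<bar> \<le> r / 2"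
    by (rule sup_continuousE[OF \<Phi> \<open>r / 2 > 0\<close>]) blast
  obtain N where N: "\<forall>n\<ge>N. \<forall>t\<in>{0..T}. \<bar>v n t - u t\<bar> < \<delta>" using lim[OF \<open>\<delta> > 0\<close>] by blast
  have "norm (\<Phi> (v n) t - \<Phi> u t) < r" if "n \<ge> N" for n
  proof -
    have "\<bar>\<Phi> (v n) t - \<Phi> u t\<bar> \<le> r / 2"
      by (rule \<delta>[OF v u _ t]) (use N that in \<open>simp add: less_imp_le\<close>)
    then show ?thesis using \<open>0 < r\<close> by simp
  qed
  then show "\<exists>N. \<forall>n\<ge>N. norm (\<Phi> (v n) t - \<Phi> u t) < r" by blast
qed

context forced_lienard
begin

text \<open>With additive constant 0 the solution vanishes at time 0, and the slope bound gives
  \<open>\<bar>b t\<bar> \<le> L * T\<close> whatever \<open>F\<close> is. Hence \<open>F\<close>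
  can be truncated at \<open>L * T\<close> beforehand.\<close>

lemma exists_periodic_forced_without_restoring:
  assumes F: "continuous_on UNIV F"
  obtains b where "weak_solution T \<psi> F (rhs 0 (\<lambda>_. 0)) b"
proof -
  define L where "L = slope (T * B)"
  have "0 \<le> L" unfolding L_def by (intro slope_nonneg) (use e_le[of 0] T_pos in simp)
  then have R: "0 \<le> L * T" using T_pos by simp
  define F' where "F' = (\<lambda>x. F (clamp (L * T) x))"
  have F'u: "uniformly_continuous_on UNIV F'" unfolding F'_def by (rule clamp_comp(1)[OF F R])
  obtain \<Phi> where \<Phi>: "\<And>x. \<bar>F' x\<bar> \<le> \<Phi>" unfolding F'_def using clamp_comp(2)[OF F R] by blast
  have qu: "uniformly_continuous_on UNIV (\<lambda>_::real. 0::real)" by (rule uniformly_continuous_on_const)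
  have C: "sup_continuous T (\<lambda>v t. 0)" by (rule sup_continuousI) (auto intro: exI[of _ 1])
  obtain b where b: "continuous_on {0..T} b" "\<And>t. t \<in> {0..T} \<Longrightarrow> b t = 0 + prim T (pot F' (\<lambda>_. 0) b) t"
    by (rule exists_prim_fixed_point[OF F'u qu \<Phi> _ C, of 0 0]) auto
  have sol: "weak_solution T \<psi> F' (rhs 0 (\<lambda>_. 0)) b"
    using prim_pot_fixed_point_weak_solution[OF uniformly_continuous_imp_continuous[OF F'u] _ b(1), of "\<lambda>_. 0" 0] b(2) by simp
  have "integral {0..T} (\<lambda>t. \<bar>rhs 0 (\<lambda>_. 0) t\<bar>) \<le> T * (B + 2 * \<bar>0\<bar> + 2 * 0)"
    by (rule integral_abs_rhs_le) (use sol in \<open>simp_all add: weak_solution_def\<close>)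
  then have K: "integral {0..T} (\<lambda>t. \<bar>rhs 0 (\<lambda>_. 0) t\<bar>) \<le> T * B" by simp
  have "\<bar>b t\<bar> \<le> L * T" if t: "t \<in> {0..T}" for t
  proof -
    have "\<bar>b t - b 0\<bar> \<le> L * \<bar>t - 0\<bar>"
      unfolding L_def by (rule weak_solution_lipschitz[OF T_pos sol K t]) (use T_pos in simp)
    also have "\<dots> \<le> L * T" using t \<open>0 \<le> L\<close> by (intro mult_left_mono) auto
    finally show ?thesis using b(2)[of 0] T_pos by simp
  qed
  then have "weak_solution T \<psi> F (rhs 0 (\<lambda>_. 0)) b"
    by (intro weak_solution_cong[OF sol]) (simp_all add: F'_def clamp_id)
  then show thesis by (rule that)
qed

text \<open>Solutions of bounded level share one Lipschitz ball, so a subsequence converges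
  uniformly. The limit is taken in the operator form of the truncated problem, where sup norm
  continuity is available; it lies in the same ball, on which truncation has no effect.\<close>

lemma level_limit:
  assumes F: "continuous_on UNIV F" and q: "continuous_on UNIV q" and m: "0 \<le> m" "\<And>x. - m \<le> q x"
    and coercive: "\<And>K. \<exists>r\<ge>0. \<forall>x. r \<le> \<bar>x\<bar> \<longrightarrow> K \<le> q x"
    and sol: "\<And>n. weak_solution T \<psi> F (rhs (\<sigma> n) (\<lambda>t. q (u n t))) (u n)"
    and lim: "\<sigma> \<longlonglongrightarrow> s"
  obtains v where "weak_solution T \<psi> F (rhs s (\<lambda>t. q (v t))) v"
proof -
  obtain S where "S > 0" and S: "\<And>n. \<bar>\<sigma> n\<bar> \<le> S"
    using Bseq_def[of \<sigma>] convergent_imp_Bseq[OF convergentI[OF lim]] by auto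
  obtain r where "r \<ge> 0" and r: "\<And>x. r \<le> \<bar>x\<bar> \<Longrightarrow> S + 1 \<le> q x" using coercive by blast
  define L where "L = slope (T * (B + 2 * S + 2 * m))"
  have "0 \<le> L" unfolding L_def by (intro slope_nonneg) (use e_le[of 0] m \<open>S > 0\<close> T_pos in simp)
  define R where "R = r + L * T"
  have "0 \<le> R" using \<open>0 \<le> L\<close> \<open>r \<ge> 0\<close> T_pos by (simp add: R_def)
  have lt: "\<sigma> n < S + 1" for n using S[of n] by linarith
  have uX: "u n \<in> lip_ball T R L" for n
    unfolding lip_ball_def R_def L_def
    using solution_bound(1,3)[OF sol q m(1) m(2) r lt S] by blast
  obtain v k where vX: "v \<in> lip_ball T R L" and k: "strict_mono (k :: nat \<Rightarrow> nat)"
    and conv: "\<And>e. 0 < e \<Longrightarrow> \<exists>N. \<forall>n\<ge>N. \<forall>t\<in>{0..T}. \<bar>u (k n) t - v t\<bar> < e"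
    using lip_ball_compact[of u T R L] uX \<open>0 \<le> L\<close> by blast
  define F' where "F' = (\<lambda>x. F (clamp R x))"
  define q' where "q' = (\<lambda>x. q (clamp R x))"
  have F'u: "uniformly_continuous_on UNIV F'" and q'u: "uniformly_continuous_on UNIV q'"
    unfolding F'_def q'_def by (intro clamp_comp(1) F q \<open>0 \<le> R\<close>)+
  note F'c = uniformly_continuous_imp_continuous[OF F'u] and q'c = uniformly_continuous_imp_continuous[OF q'u]
  obtain \<Phi> where \<Phi>: "\<And>x. \<bar>F' x\<bar> \<le> \<Phi>" unfolding F'_def using clamp_comp(2)[OF F \<open>0 \<le> R\<close>] by blast
  obtain Q where Q: "\<And>x. \<bar>q' x\<bar> \<le> Q" unfolding q'_def using clamp_comp(2)[OF q \<open>0 \<le> R\<close>] by blast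
  have same: "F' (w t) = F (w t)" "q' (w t) = q (w t)" if "w \<in> lip_ball T R L" "t \<in> {0..T}" for w t
    using lip_ballD(1)[OF that] by (simp_all add: F'_def q'_def clamp_id)
  have sol': "weak_solution T \<psi> F' (rhs (\<sigma> n) (\<lambda>t. q' (u n t))) (u n)" for n
    by (rule weak_solution_cong[OF sol[of n]]) (use same[OF uX[of n]] in \<open>simp_all add: rhs_def\<close>)
  note uc = lip_ball_continuous[OF uX] and vc = lip_ball_continuous[OF vX]
  have mean_u: "mean (\<lambda>t. q' (u n t)) = \<sigma> n" for n by (rule weak_solution_level[OF q'c sol'])
  have "(\<lambda>n. mean (\<lambda>t. q' (u (k n) t))) \<longlonglongrightarrow> mean (\<lambda>t. q' (v t))"
    by (rule sup_continuous_tendsto[where t = 0, OF sup_continuous_mean[OF q'u] uc vc conv]) (use T_pos in simp_all)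
  moreover have "(\<lambda>n. mean (\<lambda>t. q' (u (k n) t))) \<longlonglongrightarrow> s"
    using LIMSEQ_subseq_LIMSEQ[OF lim k] by (simp add: mean_u o_def)
  ultimately have mean_v: "mean (\<lambda>t. q' (v t)) = s" by (rule LIMSEQ_unique)
  have "v t = v 0 + prim T (pot F' q' v) t" if t: "t \<in> {0..T}" for t
  proof -
    have pw: "(\<lambda>n. u (k n) t) \<longlonglongrightarrow> v t" if "t \<in> {0..T}" for t
      unfolding LIMSEQ_iff real_norm_def using conv that by blast
    have "u n t = u n 0 + prim T (pot F' q' (u n)) t" for n
      using weak_solution_imp_prim[OF T_pos sol' F'c t, of n] by (simp add: pot_def [abs_def] mean_u)
    then have "(\<lambda>n. u (k n) t - u (k n) 0) = (\<lambda>n. prim T (pot F' q' (u (k n))) t)"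
      by (metis add_diff_cancel_left')
    moreover have "(\<lambda>n. prim T (pot F' q' (u (k n))) t) \<longlonglongrightarrow> prim T (pot F' q' v) t"
      by (rule sup_continuous_tendsto[OF sup_continuous_prim_pot[OF F'u q'u \<Phi> Q] uc vc conv t])
    moreover have "(\<lambda>n. u (k n) t - u (k n) 0) \<longlonglongrightarrow> v t - v 0"
      by (intro tendsto_diff pw t) (use T_pos in simp)
    ultimately have "v t - v 0 = prim T (pot F' q' v) t" by (metis LIMSEQ_unique)
    then show ?thesis by simp
  qed
  then have "weak_solution T \<psi> F' (rhs s (\<lambda>t. q' (v t))) v"
    using prim_pot_fixed_point_weak_solution[OF F'c q'c vc, of "v 0"] unfolding mean_v by blast
  then have "weak_solution T \<psi> F (rhs s (\<lambda>t. q (v t))) v"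
    by (rule weak_solution_cong) (use same[OF vX] in \<open>simp_all add: rhs_def\<close>)
  then show thesis by (rule that)
qed

lemma exists_threshold_level:
  assumes F: "continuous_on UNIV F" "\<And>R. \<exists>C. C-lipschitz_on {-R..R} F"
    and q: "continuous_on UNIV q" and m: "0 \<le> m" "\<And>x. - m \<le> q x"
    and coercive: "\<And>K. \<exists>r\<ge>0. \<forall>x. r \<le> \<bar>x\<bar> \<longrightarrow> K \<le> q x"
  defines "sol \<equiv> \<lambda>s u. weak_solution T \<psi> F (rhs s (\<lambda>t. q (u t))) u"
  shows "\<exists>s0. (\<forall>s<s0. \<not> (\<exists>u. sol s u)) \<and> (\<exists>u. sol s0 u) \<and>
     (\<forall>s>s0. \<exists>u v. sol s u \<and> sol s v \<and> (\<exists>t\<in>{0..T}. u t \<noteq> v t))"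
proof -
  define \<Sigma> where "\<Sigma> = {s. \<exists>u. sol s u}"
  obtain b where b: "weak_solution T \<psi> F (rhs 0 (\<lambda>_. 0)) b"
    using exists_periodic_forced_without_restoring[OF F(1)] by blast
  have "continuous_on {0..T} (\<lambda>t. q (b t))"
    by (rule continuous_on_compose2[OF q weak_solution_continuous[OF b]]) auto
  then obtain Q where Q: "\<And>t. t \<in> {0..T} \<Longrightarrow> \<bar>q (b t)\<bar> \<le> Q" using continuous_on_abs_bound by blast
  \<comment> \<open>The missing restoring term is compensated by raising the level by
    \<open>A * Q\<close>, a bound for \<open>a t * q (b t)\<close>.\<close>
  have "rhs 0 (\<lambda>_. 0) t \<le> rhs (A * Q) (\<lambda>t. q (b t)) t" if "t \<in> {0..T}" for t
  proof -
    have "\<bar>a t * q (b t)\<bar> \<le> A * Q"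
      unfolding abs_mult by (rule mult_mono) (use a_nonneg[of t] a_le[of t] Q[OF that] in auto)
    then show ?thesis by (simp add: rhs_def)
  qed
  then obtain u where "sol (A * Q + 1) u"
    using two_solutions_above_upper_solution[OF F q m coercive b, of "A * Q" "A * Q + 1"] unfolding sol_def by auto
  then have "\<Sigma> \<noteq> {}" by (auto simp: \<Sigma>_def)
  have bdd: "bdd_below \<Sigma>"
    by (rule bdd_belowI[of _ "- m"]) (use level_ge[OF q _ m(2)] in \<open>auto simp: \<Sigma>_def sol_def\<close>)
  define s0 where "s0 = Inf \<Sigma>"
  have "\<exists>s u. sol s u \<and> s0 \<le> s \<and> s < s0 + 1 / real (Suc n)" for n
  proof -
    have "Inf \<Sigma> < s0 + 1 / real (Suc n)" by (simp add: s0_def)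
    then obtain s where "s \<in> \<Sigma>" "s < s0 + 1 / real (Suc n)" using \<open>\<Sigma> \<noteq> {}\<close> bdd by (auto simp: cInf_less_iff)
    moreover have "s0 \<le> s" unfolding s0_def by (rule cInf_lower[OF \<open>s \<in> \<Sigma>\<close> bdd])
    ultimately show ?thesis by (auto simp: \<Sigma>_def)
  qed
  then obtain \<sigma> w where \<sigma>: "\<And>n. sol (\<sigma> n) (w n)" "\<And>n. s0 \<le> \<sigma> n" "\<And>n. \<sigma> n < s0 + 1 / real (Suc n)" by metis
  have "\<sigma> \<longlonglongrightarrow> s0"
  proof (rule tendsto_sandwich[of "\<lambda>_. s0" _ _ "\<lambda>n. s0 + 1 / real (Suc n)"])
    show "(\<lambda>n. s0 + 1 / real (Suc n)) \<longlonglongrightarrow> s0"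
      using tendsto_add[OF tendsto_const[of s0] LIMSEQ_inverse_real_of_nat] by (simp add: inverse_eq_divide)
  qed (use \<sigma>(2) less_imp_le[OF \<sigma>(3)] in simp_all)
  then obtain u0 where u0: "sol s0 u0"
    using level_limit[where \<sigma> = \<sigma> and u = w and s = s0, OF F(1) q m coercive \<sigma>(1)[unfolded sol_def]]
    unfolding sol_def by blast
  have "\<not> (\<exists>u. sol s u)" if "s < s0" for s
    using cInf_lower[of s \<Sigma>, OF _ bdd] that by (auto simp: \<Sigma>_def s0_def)
  \<comment> \<open>The solution \<open>u0\<close> of least level is itself the upper solution for
    every higher level.\<close>
  moreover have "\<exists>u v. sol s u \<and> sol s v \<and> (\<exists>t\<in>{0..T}. u t \<noteq> v t)" if "s0 < s" for s
    using two_solutions_above_upper_solution[OF F q m coercive u0[unfolded sol_def] order_refl that]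
    unfolding sol_def by blast
  ultimately show ?thesis using u0 by blast
qed

end

section \<open>Elementary properties of absolute continuity\<close>

lemma lipschitz_imp_abs_cont_on:
  assumes "C-lipschitz_on {a..b} g"
  shows "abs_cont_on a b g"
  unfolding abs_cont_on_def
proof (intro allI impI)
  fix \<epsilon> :: real assume "\<epsilon> > 0"
  have "C \<ge> 0" using assms by (rule lipschitz_on_nonneg)
  have "(\<Sum>i<n. \<bar>g (y i) - g (x i)\<bar>) < \<epsilon>"
    if xy: "\<forall>i<n. a \<le> x i \<and> x i \<le> y i \<and> y i \<le> b" and small: "(\<Sum>i<n. y i - x i) < \<epsilon> / (C + 1)"
    for n :: nat and x y :: "nat \<Rightarrow> real"
  proof -
    have "(\<Sum>i<n. \<bar>g (y i) - g (x i)\<bar>) \<le> (\<Sum>i<n. C * (y i - x i))"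
    proof (rule sum_mono)
      fix i assume "i \<in> {..<n}"
      then have "a \<le> x i" "x i \<le> y i" "y i \<le> b" using xy by auto
      then show "\<bar>g (y i) - g (x i)\<bar> \<le> C * (y i - x i)"
        using lipschitz_onD[OF assms, of "y i" "x i"] by (auto simp: dist_real_def)
    qed
    also have "\<dots> = C * (\<Sum>i<n. y i - x i)" by (simp add: sum_distrib_left)
    also have "\<dots> \<le> C * (\<epsilon> / (C + 1))" using small \<open>C \<ge> 0\<close> by (intro mult_left_mono) auto
    also have "\<dots> < \<epsilon>" using \<open>\<epsilon> > 0\<close> \<open>C \<ge> 0\<close> by (simp add: field_simps)
    finally show ?thesis .
  qed
  moreover have "\<epsilon> / (C + 1) > 0" using \<open>\<epsilon> > 0\<close> \<open>C \<ge> 0\<close> by simp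
  ultimately show "\<exists>\<delta>>0. \<forall>(n::nat) (x::nat \<Rightarrow> real) (y::nat \<Rightarrow> real).
        (\<forall>i<n. a \<le> x i \<and> x i \<le> y i \<and> y i \<le> b) \<and>
        (\<forall>i<n. \<forall>j<n. i \<noteq> j \<longrightarrow> y i \<le> x j \<or> y j \<le> x i) \<and>
        (\<Sum>i<n. y i - x i) < \<delta>
        \<longrightarrow> (\<Sum>i<n. \<bar>g (y i) - g (x i)\<bar>) < \<epsilon>"
    by (intro exI[of _ "\<epsilon> / (C + 1)"]) simp
qed

lemma abs_cont_on_subinterval:
  assumes "abs_cont_on a b g" "b' \<le> b"
  shows "abs_cont_on a b' g"
  unfolding abs_cont_on_def
proof (intro allI impI)
  fix \<epsilon> :: real assume "\<epsilon> > 0"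
  obtain \<delta> where "\<delta> > 0" and \<delta>: "\<forall>(n::nat) (x::nat \<Rightarrow> real) (y::nat \<Rightarrow> real).
        (\<forall>i<n. a \<le> x i \<and> x i \<le> y i \<and> y i \<le> b) \<and>
        (\<forall>i<n. \<forall>j<n. i \<noteq> j \<longrightarrow> y i \<le> x j \<or> y j \<le> x i) \<and>
        (\<Sum>i<n. y i - x i) < \<delta>
        \<longrightarrow> (\<Sum>i<n. \<bar>g (y i) - g (x i)\<bar>) < \<epsilon>"
    using assms(1)[unfolded abs_cont_on_def, THEN spec, THEN mp, OF \<open>\<epsilon> > 0\<close>] by (elim exE conjE) (rule that)
  show "\<exists>\<delta>>0. \<forall>(n::nat) (x::nat \<Rightarrow> real) (y::nat \<Rightarrow> real).
        (\<forall>i<n. a \<le> x i \<and> x i \<le> y i \<and> y i \<le> b') \<and>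
        (\<forall>i<n. \<forall>j<n. i \<noteq> j \<longrightarrow> y i \<le> x j \<or> y j \<le> x i) \<and>
        (\<Sum>i<n. y i - x i) < \<delta>
        \<longrightarrow> (\<Sum>i<n. \<bar>g (y i) - g (x i)\<bar>) < \<epsilon>"
  proof (intro exI[of _ \<delta>] conjI allI impI)
    fix n :: nat and x y :: "nat \<Rightarrow> real"
    assume "(\<forall>i<n. a \<le> x i \<and> x i \<le> y i \<and> y i \<le> b') \<and>
        (\<forall>i<n. \<forall>j<n. i \<noteq> j \<longrightarrow> y i \<le> x j \<or> y j \<le> x i) \<and> (\<Sum>i<n. y i - x i) < \<delta>"
    then show "(\<Sum>i<n. \<bar>g (y i) - g (x i)\<bar>) < \<epsilon>"
      using assms(2) by (intro \<delta>[THEN spec, THEN spec, THEN spec, THEN mp]) force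
  qed (rule \<open>\<delta> > 0\<close>)
qed

section \<open>Solutions in the sense of absolute continuity\<close>

lemma continuous_antiderivative:
  fixes f :: "real \<Rightarrow> real"
  assumes "continuous_on UNIV f"
  obtains F where "\<And>x. (F has_real_derivative f x) (at x)"
proof -
  have "\<exists>F. \<forall>x::real. (- \<infinity>::ereal) < x \<longrightarrow> x < \<infinity> \<longrightarrow> (F has_vector_derivative f x) (at x)"
    by (rule einterval_antiderivative) (use assms in \<open>auto simp: continuous_on_eq_continuous_at\<close>)
  then show thesis
    using that by (auto simp: has_real_derivative_iff_has_vector_derivative)
qed

lemma antiderivative_lipschitz:
  fixes F f :: "real \<Rightarrow> real"
  assumes F: "\<And>x. (F has_real_derivative f x) (at x)" and f: "continuous_on UNIV f"
  shows "\<exists>C. C-lipschitz_on {-R..R} F"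
proof -
  have "bounded (f ` {-R..R})"
    by (intro compact_imp_bounded compact_continuous_image continuous_on_subset[OF f]) auto
  then obtain C where C: "\<forall>y\<in>f ` {-R..R}. norm y \<le> C" unfolding bounded_iff by blast
  have "\<bar>C\<bar>-lipschitz_on {-R..R} F"
  proof (rule lipschitz_onI)
    fix x y assume xy: "x \<in> {-R..R}" "y \<in> {-R..R}"
    have "norm (F x - F y) \<le> \<bar>C\<bar> * norm (x - y)"
    proof (rule field_differentiable_bound[OF _ _ _ xy])
      show "(F has_real_derivative f z) (at z within {-R..R})" for z
        by (rule has_field_derivative_at_within[OF F])
      show "norm (f z) \<le> \<bar>C\<bar>" if "z \<in> {-R..R}" for z using C that by force
    qed simp
    then show "dist (F x) (F y) \<le> \<bar>C\<bar> * dist x y" by (simp add: dist_norm)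
  qed simp
  then show ?thesis by blast
qed

lemma AE_lebesgue_negligible:
  assumes "AE x in lebesgue. P x"
  obtains N where "negligible N" "\<And>x. x \<notin> N \<Longrightarrow> P x"
proof -
  from assms obtain N where "N \<in> null_sets lebesgue" "{x \<in> space lebesgue. \<not> P x} \<subseteq> N"
    unfolding eventually_ae_filter by blast
  then show thesis by (intro that[of N]) (auto simp: negligible_iff_null_sets)
qed

lemma negligible_AE_lebesgue:
  assumes "negligible N" "\<And>x. x \<notin> N \<Longrightarrow> P x"
  shows "AE x in lebesgue. P x"
  by (rule AE_I'[of N]) (use assms in \<open>auto simp: negligible_iff_null_sets\<close>)

text \<open>Clamping the extension by zero turns the almost everywhere bounds into pointwise ones.\<close>
lemma bounded_representative:
  fixes g :: "real \<Rightarrow> real"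
  assumes "set_borel_measurable lebesgue {0..T} g" "l \<le> 0" "0 \<le> u"
    and bd: "AE t in lebesgue. t \<in> {0..T} \<longrightarrow> l \<le> g t \<and> g t \<le> u"
  obtains g' N where "g' \<in> borel_measurable lebesgue" "\<And>t. l \<le> g' t \<and> g' t \<le> u"
    "negligible N" "\<And>t. t \<in> {0..T} - N \<Longrightarrow> g' t = g t"
    "integral {0..T} g' = (LINT t:{0..T}|lebesgue. g t)"
proof -
  define g' where "g' = (\<lambda>t. max l (min u (indicator {0..T} t *\<^sub>R g t)))"
  have meas: "g' \<in> borel_measurable lebesgue"
    unfolding g'_def
    by (intro borel_measurable_max borel_measurable_min borel_measurable_const
        assms(1)[unfolded set_borel_measurable_def])
  obtain N where N: "negligible N" "\<And>t. t \<notin> N \<Longrightarrow> t \<in> {0..T} \<longrightarrow> l \<le> g t \<and> g t \<le> u"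
    using AE_lebesgue_negligible[OF bd] by blast
  have eq: "g' t = g t" if "t \<in> {0..T} - N" for t
    using N(2)[of t] that by (auto simp: g'_def)
  have bnd: "l \<le> g' t \<and> g' t \<le> u" for t using assms(2,3) by (auto simp: g'_def)
  have "\<bar>g' t\<bar> \<le> \<bar>l\<bar> + \<bar>u\<bar>" for t using bnd[of t] by linarith
  then have "g' absolutely_integrable_on {0..T}"
    by (intro measurable_bounded_by_integrable_imp_absolutely_integrable[where g = "\<lambda>_. \<bar>l\<bar> + \<bar>u\<bar>"]
        measurable_restrict_space1[OF meas]) auto
  then have "integral {0..T} g' = (LINT t:{0..T}|lebesgue. g' t)"
    by (simp add: set_lebesgue_integral_eq_integral(2))
  also have "\<dots> = (LINT t:{0..T}|lebesgue. g t)"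
    unfolding set_lebesgue_integral_def
  proof (rule integral_cong_AE)
    show "(\<lambda>x. indicator {0..T} x *\<^sub>R g' x) \<in> borel_measurable lebesgue"
      using meas by (intro borel_measurable_scaleR borel_measurable_indicator) auto
    show "AE x in lebesgue. indicator {0..T} x *\<^sub>R g' x = indicator {0..T} x *\<^sub>R g x"
      by (rule negligible_AE_lebesgue[OF N(1)]) (use eq in \<open>auto simp: indicator_def\<close>)
  qed (use assms(1) in \<open>simp add: set_borel_measurable_def\<close>)
  finally show thesis using that meas bnd N(1) eq by blast
qed

context forced_lienard
begin

lemma rhs_bounded:
  assumes "continuous_on {0..T} g"
  obtains H where "\<And>t. t \<in> {0..T} \<Longrightarrow> \<bar>rhs s g t\<bar> \<le> H"
proof -
  obtain M where M: "\<And>t. t \<in> {0..T} \<Longrightarrow> \<bar>g t\<bar> \<le> M" using continuous_on_abs_bound[OF assms] by blast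
  have "\<bar>rhs s g t\<bar> \<le> \<bar>s\<bar> + B + A * M" if "t \<in> {0..T}" for t
  proof -
    have "\<bar>a t * g t\<bar> \<le> A * M"
      unfolding abs_mult by (rule mult_mono) (use a_nonneg[of t] a_le[of t] M[OF that] in auto)
    then show ?thesis using e_le[of t] unfolding rhs_def by linarith
  qed
  then show thesis by (rule that)
qed

text \<open>\<open>\<phi> (du t)\<close> is recovered from its derivative by absolute continuity,
  while the friction term is integrated separately as the derivative of \<open>F (u t)\<close>. The
  values at time 0 make up the constant of the weak form.\<close>

lemma periodic_imp_weak_solution:
  assumes per: "periodic_solution \<phi> f a' q e' T s u"
    and N: "negligible N" "\<And>t. t \<in> {0..T} - N \<Longrightarrow> a t = a' t \<and> e t = e' t"
    and F: "\<And>x. (F has_real_derivative f x) (at x)" and q: "continuous_on UNIV q"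
  shows "weak_solution T \<psi> F (rhs s (\<lambda>t. q (u t))) u"
proof -
  obtain du where du: "\<And>t. t \<in> {0..T} \<Longrightarrow> (u has_real_derivative du t) (at t within {0..T})"
    and per0: "u 0 = u T" "du 0 = du T"
    and ac: "abs_cont_on 0 T (\<lambda>t. \<phi> (du t))"
    and ae: "AE t in lebesgue. t \<in> {0..T} \<longrightarrow>
              ((\<lambda>x. \<phi> (du x)) has_real_derivative
                 (s + e' t - f (u t) * du t - a' t * q (u t))) (at t within {0..T})"
    using per unfolding periodic_solution_def by blast
  define h where "h = rhs s (\<lambda>t. q (u t))"
  obtain N' where N': "negligible N'" "\<And>t. t \<notin> N' \<Longrightarrow> t \<in> {0..T} \<longrightarrow>
              ((\<lambda>x. \<phi> (du x)) has_real_derivative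
                 (s + e' t - f (u t) * du t - a' t * q (u t))) (at t within {0..T})"
    using AE_lebesgue_negligible[OF ae] by blast
  have uc: "continuous_on {0..T} u" by (rule DERIV_continuous_on[OF du])
  have qu: "continuous_on {0..T} (\<lambda>t. q (u t))" by (rule continuous_on_compose2[OF q uc]) auto
  have prim_h: "integral {0..t} h = \<phi> (du t) - \<phi> (du 0) + (F (u t) - F (u 0))" if t: "t \<in> {0..T}" for t
  proof -
    have sub: "{0..t} \<subseteq> {0..T}" using t by auto
    have "((\<lambda>x. h x - f (u x) * du x) has_integral (\<phi> (du t) - \<phi> (du 0))) {0..t}"
    proof (rule fundamental_theorem_of_calculus_abs_cont)
      show "abs_cont_on 0 t (\<lambda>t. \<phi> (du t))" by (rule abs_cont_on_subinterval[OF ac]) (use t in simp)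
      show "negligible (N \<union> N')" using N(1) N'(1) by (rule negligible_Un)
      fix x assume x: "x \<in> {0..t} - (N \<union> N')"
      then have xI: "x \<in> {0..T} - N" "x \<notin> N'" using t by auto
      then have "((\<lambda>x. \<phi> (du x)) has_real_derivative
                 (s + e' x - f (u x) * du x - a' x * q (u x))) (at x within {0..t})"
        using DERIV_subset[OF _ sub] N'(2) by blast
      then show "((\<lambda>x. \<phi> (du x)) has_real_derivative (h x - f (u x) * du x)) (at x within {0..t})"
        using N(2)[OF xI(1)] by (simp add: h_def rhs_def algebra_simps)
    qed (use t in simp)
    moreover have "((\<lambda>x. f (u x) * du x) has_integral (F (u t) - F (u 0))) {0..t}"
    proof (rule fundamental_theorem_of_calculus)
      fix x assume "x \<in> {0..t}"
      then have "x \<in> {0..T}" using t by auto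
      then have "(u has_real_derivative du x) (at x within {0..t})" by (rule DERIV_subset[OF du sub])
      then have "((\<lambda>x. F (u x)) has_real_derivative f (u x) * du x) (at x within {0..t})"
        by (rule DERIV_chain2[OF F])
      then show "((\<lambda>x. F (u x)) has_vector_derivative f (u x) * du x) (at x within {0..t})"
        by (simp add: has_real_derivative_iff_has_vector_derivative)
    qed (use t in simp)
    ultimately have "((\<lambda>x. (h x - f (u x) * du x) + f (u x) * du x) has_integral
       (\<phi> (du t) - \<phi> (du 0)) + (F (u t) - F (u 0))) {0..t}" by (rule has_integral_add)
    then show ?thesis by (simp add: integral_unique)
  qed
  have du_eq: "du t = \<psi> (\<phi> (du 0) + F (u 0) + integral {0..t} h - F (u t))" if "t \<in> {0..T}" for t
    by (simp add: prim_h[OF that])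
  have "\<forall>t\<in>{0..T}. (u has_real_derivative \<psi> (\<phi> (du 0) + F (u 0) + integral {0..t} h - F (u t))) (at t within {0..T})"
    by (intro ballI) (simp only: du_eq[symmetric] du)
  moreover have "integral {0..T} h = 0" using prim_h[of T] T_pos per0 by simp
  moreover have "h absolutely_integrable_on {0..T}" unfolding h_def by (rule rhs_absolutely_integrable[OF qu])
  ultimately show ?thesis using per0(1) unfolding weak_solution_def h_def by blast
qed

text \<open>\<open>\<phi> (du t)\<close> is a primitive of the bounded function \<open>h\<close>
  minus the continuously differentiable \<open>F (u t)\<close>, hence Lipschitz and so absolutely
  continuous. Lebesgue differentiation of the primitive gives the equation outside a null
  set.\<close>

lemma weak_imp_periodic_solution:
  assumes sol: "weak_solution T \<psi> F (rhs s (\<lambda>t. q (u t))) u"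
    and N: "negligible N" "\<And>t. t \<in> {0..T} - N \<Longrightarrow> a t = a' t \<and> e t = e' t"
    and F: "\<And>x. (F has_real_derivative f x) (at x)" and f: "continuous_on UNIV f" and q: "continuous_on UNIV q"
  shows "periodic_solution \<phi> f a' q e' T s u"
proof -
  define h where "h = rhs s (\<lambda>t. q (u t))"
  obtain k where k: "\<forall>t\<in>{0..T}. (u has_real_derivative \<psi> (k + integral {0..t} h - F (u t))) (at t within {0..T})"
    using sol unfolding weak_solution_def h_def by blast
  have h: "h absolutely_integrable_on {0..T}" "integral {0..T} h = 0" and per: "u 0 = u T"
    using sol unfolding weak_solution_def h_def by blast+
  have hi: "h integrable_on {0..T}" by (rule set_lebesgue_integral_eq_integral(1)[OF h(1)])
  define y where "y = (\<lambda>t. k + integral {0..t} h - F (u t))"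
  define du where "du = (\<lambda>t. \<psi> (y t))"
  have du: "(u has_real_derivative du t) (at t within {0..T})" if "t \<in> {0..T}" for t
    using k that unfolding du_def y_def by blast
  have uc: "continuous_on {0..T} u" by (rule DERIV_continuous_on[OF du])
  have qu: "continuous_on {0..T} (\<lambda>t. q (u t))" by (rule continuous_on_compose2[OF q uc]) auto
  have Fc: "continuous_on UNIV F" using F by (intro DERIV_continuous_on[of UNIV F f]) auto
  have yc: "continuous_on {0..T} y"
    using continuous_on_add[OF continuous_on_const[of _ k] continuous_on_primitive[OF h(1) Fc uc]]
    by (simp add: y_def add_diff_eq)
  then have duc: "continuous_on {0..T} du"
    unfolding du_def by (intro continuous_on_compose2[OF continuous_psi]) auto
  have "abs_cont_on 0 T y"
  proof -
    obtain H where H: "\<And>t. t \<in> {0..T} \<Longrightarrow> \<bar>h t\<bar> \<le> H" using rhs_bounded[OF qu] unfolding h_def by blast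
    have "continuous_on {0..T} (\<lambda>t. f (u t) * du t)"
      by (intro continuous_on_mult duc continuous_on_compose2[OF f uc]) auto
    then obtain G where G: "\<And>t. t \<in> {0..T} \<Longrightarrow> \<bar>f (u t) * du t\<bar> \<le> G" using continuous_on_abs_bound by blast
    have step: "\<bar>y t - y x\<bar> \<le> (H + G) * (t - x)" if xt: "0 \<le> x" "x \<le> t" "t \<le> T" for x t
    proof -
      have ix: "h integrable_on {x..t}" "h integrable_on {0..t}"
        by (rule integrable_subinterval_real[OF hi]; use xt in simp)+
      have "integral {0..x} h + integral {x..t} h = integral {0..t} h"
        using xt ix(2) by (simp add: Henstock_Kurzweil_Integration.integral_combine)
      moreover have "\<bar>integral {x..t} h\<bar> \<le> integral {x..t} (\<lambda>_. H)"
        using integral_norm_bound_integral[OF ix(1), of "\<lambda>_. H"] H xt by auto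
      moreover have "integral {x..t} (\<lambda>_. H) = H * (t - x)" using xt by (simp add: mult.commute)
      moreover have "norm (F (u t) - F (u x)) \<le> G * norm (t - x)"
      proof (rule field_differentiable_bound[of "{0..T}" "\<lambda>t. F (u t)" "\<lambda>t. f (u t) * du t"])
        show "((\<lambda>t. F (u t)) has_real_derivative f (u z) * du z) (at z within {0..T})" if "z \<in> {0..T}" for z
          by (rule DERIV_chain2[OF F du[OF that]])
      qed (use G xt in simp_all)
      ultimately show ?thesis using xt unfolding y_def by (simp add: algebra_simps)
    qed
    have "(\<bar>H + G\<bar>)-lipschitz_on {0..T} y"
    proof (rule lipschitz_onI)
      fix x t assume xt: "x \<in> {0..T}" "t \<in> {0..T}"
      have le: "(H + G) * \<bar>x - t\<bar> \<le> \<bar>H + G\<bar> * \<bar>x - t\<bar>" by (intro mult_right_mono) auto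
      show "dist (y x) (y t) \<le> \<bar>H + G\<bar> * dist x t"
      proof (cases "x \<le> t")
        case True
        then have "\<bar>y x - y t\<bar> \<le> (H + G) * \<bar>x - t\<bar>" using step[of x t] xt by (simp add: abs_minus_commute)
        then show ?thesis using le unfolding dist_real_def by linarith
      next
        case False
        then have "\<bar>y x - y t\<bar> \<le> (H + G) * \<bar>x - t\<bar>" using step[of t x] xt by simp
        then show ?thesis using le unfolding dist_real_def by linarith
      qed
    qed simp
    then show ?thesis by (rule lipschitz_imp_abs_cont_on)
  qed
  define N' where "N' = {x\<in>{0..T}. \<not> ((\<lambda>t. integral {0..t} h) has_real_derivative h x) (at x within {0..T})}"
  have "negligible N'" unfolding N'_def by (rule integral_has_real_derivative_negligible[OF hi])
  have "AE t in lebesgue. t \<in> {0..T} \<longrightarrow>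
      (y has_real_derivative (s + e' t - f (u t) * du t - a' t * q (u t))) (at t within {0..T})"
  proof (rule negligible_AE_lebesgue[OF negligible_Un[OF N(1) \<open>negligible N'\<close>]], rule impI)
    fix t assume t: "t \<notin> N \<union> N'" "t \<in> {0..T}"
    have "((\<lambda>t. integral {0..t} h) has_real_derivative h t) (at t within {0..T})"
      using t by (simp add: N'_def)
    then have d: "(y has_real_derivative (0 + h t - f (u t) * du t)) (at t within {0..T})"
      unfolding y_def by (intro DERIV_diff DERIV_add DERIV_const DERIV_chain2[OF F du[OF t(2)]])
    have eq: "0 + h t - f (u t) * du t = s + e' t - f (u t) * du t - a' t * q (u t)"
      using N(2)[of t] t by (simp add: h_def rhs_def)
    show "(y has_real_derivative (s + e' t - f (u t) * du t - a' t * q (u t))) (at t within {0..T})"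
      using d unfolding eq .
  qed
  moreover have "(\<lambda>t. \<phi> (du t)) = y" by (simp add: du_def)
  moreover have "du 0 = du T" using h(2) per by (simp add: du_def y_def)
  ultimately show ?thesis
    unfolding periodic_solution_def using du duc per \<open>abs_cont_on 0 T y\<close>
    by (intro exI[of _ du]) simp
qed

end

theorem theorem1p1:
  fixes \<phi> f q a e :: "real \<Rightarrow> real" and T :: real
  assumes "T > 0"
    and "strict_mono \<phi>" and "\<exists>\<psi>. homeomorphism UNIV UNIV \<phi> \<psi>" and "\<phi> 0 = 0"
    and "continuous_on UNIV f" and "continuous_on UNIV q"
    and "Linf_on T a" and "Linf_on T e"
    and "AE t in lebesgue. t \<in> {0..T} \<longrightarrow> a t \<ge> 0"
    and "(1 / T) * (LINT t:{0..T}|lebesgue. a t) = 1"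
    and "(1 / T) * (LINT t:{0..T}|lebesgue. e t) = 0"
    and "filterlim q at_top at_bot" and "filterlim q at_top at_top"
  shows "\<exists>s0::real.
           (\<forall>s<s0. \<not> (\<exists>u. periodic_solution \<phi> f a q e T s u)) \<and>
           (\<exists>u. periodic_solution \<phi> f a q e T s0 u) \<and>
           (\<forall>s>s0. \<exists>u v. periodic_solution \<phi> f a q e T s u \<and>
                          periodic_solution \<phi> f a q e T s v \<and>
                          (\<exists>t\<in>{0..T}. u t \<noteq> v t))"
proof -
  obtain \<psi> where \<psi>: "homeomorphism UNIV UNIV \<phi> \<psi>" using assms(3) by blast
  obtain A0 where A0: "AE t in lebesgue. t \<in> {0..T} \<longrightarrow> \<bar>a t\<bar> \<le> A0"
    and am: "set_borel_measurable lebesgue {0..T} a" using assms(7) unfolding Linf_on_def by blast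
  obtain B0 where B0: "AE t in lebesgue. t \<in> {0..T} \<longrightarrow> \<bar>e t\<bar> \<le> B0"
    and em: "set_borel_measurable lebesgue {0..T} e" using assms(8) unfolding Linf_on_def by blast
  have "AE t in lebesgue. t \<in> {0..T} \<longrightarrow> 0 \<le> a t \<and> a t \<le> \<bar>A0\<bar>"
    using A0 assms(9) by eventually_elim auto
  then obtain a' N1 where a': "a' \<in> borel_measurable lebesgue" "\<And>t. 0 \<le> a' t \<and> a' t \<le> \<bar>A0\<bar>"
    "negligible N1" "\<And>t. t \<in> {0..T} - N1 \<Longrightarrow> a' t = a t"
    "integral {0..T} a' = (LINT t:{0..T}|lebesgue. a t)"
    by (rule bounded_representative[OF am order_refl abs_ge_zero]) blast
  have "AE t in lebesgue. t \<in> {0..T} \<longrightarrow> - \<bar>B0\<bar> \<le> e t \<and> e t \<le> \<bar>B0\<bar>"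
    using B0 by eventually_elim auto
  then obtain e' N2 where e': "e' \<in> borel_measurable lebesgue" "\<And>t. - \<bar>B0\<bar> \<le> e' t \<and> e' t \<le> \<bar>B0\<bar>"
    "negligible N2" "\<And>t. t \<in> {0..T} - N2 \<Longrightarrow> e' t = e t"
    "integral {0..T} e' = (LINT t:{0..T}|lebesgue. e t)"
    by (rule bounded_representative[OF em _ abs_ge_zero, rotated]) auto
  \<comment> \<open>Passing to the representatives \<open>a'\<close> and \<open>e'\<close> does not
    change the solutions, because the equation is required only almost everywhere.\<close>
  interpret forced_lienard \<phi> \<psi> T a' e' "\<bar>A0\<bar>" "\<bar>B0\<bar>"
  proof
    show "\<phi> (\<psi> x) = x" "\<psi> (\<phi> x) = x" for x using \<psi> by (auto simp: homeomorphism_def)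
    show "continuous_on UNIV \<psi>" using \<psi> by (simp add: homeomorphism_def)
    show "0 \<le> a' t" "a' t \<le> \<bar>A0\<bar>" for t using a'(2)[of t] by auto
    show "\<bar>e' t\<bar> \<le> \<bar>B0\<bar>" for t using e'(2)[of t] by linarith
    show "integral {0..T} a' = T" using a'(5) assms(1,10) by (simp add: field_simps)
    show "integral {0..T} e' = 0" using e'(5) assms(1,11) by simp
  qed (rule assms(1,2,4) a'(1) e'(1))+
  obtain F where F: "\<And>x. (F has_real_derivative f x) (at x)" using continuous_antiderivative[OF assms(5)] by blast
  have Fc: "continuous_on UNIV F" using F by (intro DERIV_continuous_on[of UNIV F f]) auto
  have coercive: "\<exists>r\<ge>0. \<forall>x. r \<le> \<bar>x\<bar> \<longrightarrow> K \<le> q x" for K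
  proof -
    have "\<forall>\<^sub>F x in at_bot. K \<le> q x" "\<forall>\<^sub>F x in at_top. K \<le> q x"
      using assms(12,13) unfolding filterlim_at_top by blast+
    then obtain r1 r2 where "\<And>x. x \<le> r1 \<Longrightarrow> K \<le> q x" "\<And>x. r2 \<le> x \<Longrightarrow> K \<le> q x"
      unfolding eventually_at_bot_linorder eventually_at_top_linorder by blast
    then have "K \<le> q x" if "\<bar>r1\<bar> + \<bar>r2\<bar> \<le> \<bar>x\<bar>" for x
      using that by (cases "x \<le> r1") (auto simp: abs_if split: if_splits)
    then show ?thesis by (intro exI[of _ "\<bar>r1\<bar> + \<bar>r2\<bar>"]) auto
  qed
  obtain m where m: "0 \<le> m" "\<And>x. - m \<le> q x"
  proof -
    obtain r where r: "r \<ge> 0" "\<And>x. r \<le> \<bar>x\<bar> \<Longrightarrow> 0 \<le> q x" using coercive by blast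
    have "bounded (q ` {-r..r})"
      by (intro compact_imp_bounded compact_continuous_image continuous_on_subset[OF assms(6)]) auto
    then obtain c where c: "\<forall>y\<in>q ` {-r..r}. norm y \<le> c" unfolding bounded_iff by blast
    have "- \<bar>c\<bar> \<le> q x" for x
    proof (cases "r \<le> \<bar>x\<bar>")
      case True
      then show ?thesis using r(2)[of x] by simp
    next
      case False
      then have "x \<in> {-r..r}" by auto
      then have "norm (q x) \<le> c" using c by blast
      then show ?thesis by simp
    qed
    then show thesis using that[of "\<bar>c\<bar>"] by simp
  qed
  have N: "negligible (N1 \<union> N2)" using a'(3) e'(3) by (rule negligible_Un)
  have eq: "a' t = a t \<and> e' t = e t" if "t \<in> {0..T} - (N1 \<union> N2)" for t
    using a'(4)[of t] e'(4)[of t] that by simp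
  have iff: "periodic_solution \<phi> f a q e T s u \<longleftrightarrow> weak_solution T \<psi> F (rhs s (\<lambda>t. q (u t))) u" for s u
  proof
    assume "periodic_solution \<phi> f a q e T s u"
    then show "weak_solution T \<psi> F (rhs s (\<lambda>t. q (u t))) u"
      by (rule periodic_imp_weak_solution[OF _ N eq F assms(6)])
  next
    assume "weak_solution T \<psi> F (rhs s (\<lambda>t. q (u t))) u"
    then show "periodic_solution \<phi> f a q e T s u"
      by (rule weak_imp_periodic_solution[OF _ N eq F assms(5,6)])
  qed
  show ?thesis
    unfolding iff by (rule exists_threshold_level[OF Fc antiderivative_lipschitz[OF F assms(5)] assms(6) m coercive])
qed

end
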